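(* Let $G$ be a finite simple connected graph which is complete intersection. Then the edge ring $K[G]$ is normal if and only if $G$ has at most one non-bipartite block, or $G$ has exactly two non-bipartite blocks and they are strongly contiguous.
   Context: For a finite simple graph $G$ with edges $e_1,\dots,e_m$ and a field $K$, the toric ideal $I_G\subseteq K[e_1,\dots,e_m]$ is the kernel of the $K$-algebra map $e_i=\{v_j,v_k\}\mapsto v_jv_k$; $G$ is complete intersection if $I_G$ is generated by $\operatorname{ht}(I_G)$ elements. The edge ring $K[G]$ is the subalgebra of $K[v_1,\dots,v_n]$ generated by the monomials $v_iv_j$ with $\{v_i,v_j\}\in E(G)$. A block is a maximal biconnected subgraph of $G$. A cycle is chordless if no edge of $G$ joins two of its vertices other than its own edges. A block is of type $T_i$ if it contains exactly $i$ odd chordless cycles. Two non-bipartite blocks are strongly contiguous if either both are of type $T_1$ and the distance between them (minimum distance in $G$ between a vertex of one and a vertex of the other) is at most one, or one is of type $T_1$, the other of type $T_2$, and they have a common (cut) vertex. *)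

theory Defs
  imports "HOL-Library.Poly_Mapping" "HOL-Library.Extended_Nat"
    "HOL-Computational_Algebra.Fraction_Field" "HOL-Algebra.Ideal"
begin

definition simple_graph :: "'v set \<Rightarrow> 'v set set \<Rightarrow> bool" where
  "simple_graph V E \<longleftrightarrow> finite V \<and> (\<forall>e\<in>E. \<exists>u v. u \<in> V \<and> v \<in> V \<and> u \<noteq> v \<and> e = {u, v})"

definition subgraph :: "'v set \<Rightarrow> 'v set set \<Rightarrow> 'v set \<Rightarrow> 'v set set \<Rightarrow> bool" where
  "subgraph VH EH V E \<longleftrightarrow> VH \<subseteq> V \<and> EH \<subseteq> E \<and> (\<forall>e\<in>EH. e \<subseteq> VH)"

definition walk :: "'v set \<Rightarrow> 'v set set \<Rightarrow> 'v list \<Rightarrow> bool" where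
  "walk V E xs \<longleftrightarrow> xs \<noteq> [] \<and> set xs \<subseteq> V \<and>
     (\<forall>i. Suc i < length xs \<longrightarrow> {xs ! i, xs ! Suc i} \<in> E)"

definition connected_graph :: "'v set \<Rightarrow> 'v set set \<Rightarrow> bool" where
  "connected_graph V E \<longleftrightarrow> V \<noteq> {} \<and>
     (\<forall>u\<in>V. \<forall>v\<in>V. \<exists>xs. walk V E xs \<and> hd xs = u \<and> last xs = v)"

definition del_vertex :: "'v \<Rightarrow> 'v set \<Rightarrow> 'v set set \<Rightarrow> 'v set \<times> 'v set set" where
  "del_vertex x V E = (V - {x}, {e\<in>E. x \<notin> e})"

definition biconnected :: "'v set \<Rightarrow> 'v set set \<Rightarrow> bool" where
  "biconnected V E \<longleftrightarrow> connected_graph V E \<and> 2 \<le> card V \<and>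
     (\<forall>x\<in>V. case_prod connected_graph (del_vertex x V E))"

definition is_block :: "'v set \<Rightarrow> 'v set set \<Rightarrow> 'v set \<times> 'v set set \<Rightarrow> bool" where
  "is_block V E B \<longleftrightarrow> subgraph (fst B) (snd B) V E \<and> biconnected (fst B) (snd B) \<and>
     (\<forall>VH EH. subgraph VH EH V E \<and> biconnected VH EH \<and> fst B \<subseteq> VH \<and> snd B \<subseteq> EH
        \<longrightarrow> VH = fst B \<and> EH = snd B)"

definition bipartite :: "'v set \<Rightarrow> 'v set set \<Rightarrow> bool" where
  "bipartite V E \<longleftrightarrow> (\<exists>c :: 'v \<Rightarrow> bool. \<forall>u v. {u, v} \<in> E \<longrightarrow> c u \<noteq> c v)"

definition is_cycle :: "'v set \<Rightarrow> 'v set set \<Rightarrow> bool" where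
  "is_cycle C EC \<longleftrightarrow> finite C \<and> 3 \<le> card C \<and> connected_graph C EC \<and>
     (\<forall>e\<in>EC. e \<subseteq> C) \<and> (\<forall>v\<in>C. card {e\<in>EC. v \<in> e} = 2)"

definition chordless_cycle :: "'v set \<Rightarrow> 'v set set \<Rightarrow> 'v set \<Rightarrow> 'v set set \<Rightarrow> bool" where
  "chordless_cycle V E C EC \<longleftrightarrow> subgraph C EC V E \<and> is_cycle C EC \<and>
     (\<forall>e\<in>E. e \<subseteq> C \<longrightarrow> e \<in> EC)"

definition odd_chordless_cycles_in :: "'v set \<Rightarrow> 'v set set \<Rightarrow> 'v set \<times> 'v set set
     \<Rightarrow> ('v set \<times> 'v set set) set" where
  "odd_chordless_cycles_in V E B = {(C, EC). chordless_cycle V E C EC \<and> odd (card C) \<and>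
      C \<subseteq> fst B \<and> EC \<subseteq> snd B}"

definition block_type :: "'v set \<Rightarrow> 'v set set \<Rightarrow> nat \<Rightarrow> 'v set \<times> 'v set set \<Rightarrow> bool" where
  "block_type V E i B \<longleftrightarrow> is_block V E B \<and> finite (odd_chordless_cycles_in V E B) \<and>
     card (odd_chordless_cycles_in V E B) = i"

definition non_bipartite_blocks :: "'v set \<Rightarrow> 'v set set \<Rightarrow> ('v set \<times> 'v set set) set" where
  "non_bipartite_blocks V E = {B. is_block V E B \<and> \<not> bipartite (fst B) (snd B)}"

definition block_dist_le_1 :: "'v set \<Rightarrow> 'v set set \<Rightarrow> 'v set \<times> 'v set set
     \<Rightarrow> 'v set \<times> 'v set set \<Rightarrow> bool" where
  "block_dist_le_1 V E B1 B2 \<longleftrightarrow> (\<exists>u\<in>fst B1. \<exists>v\<in>fst B2. u = v \<or> {u, v} \<in> E)"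

definition strongly_contiguous :: "'v set \<Rightarrow> 'v set set \<Rightarrow> 'v set \<times> 'v set set
     \<Rightarrow> 'v set \<times> 'v set set \<Rightarrow> bool" where
  "strongly_contiguous V E B1 B2 \<longleftrightarrow>
     B1 \<in> non_bipartite_blocks V E \<and> B2 \<in> non_bipartite_blocks V E \<and>
     ((block_type V E 1 B1 \<and> block_type V E 1 B2 \<and> block_dist_le_1 V E B1 B2) \<or>
      (((block_type V E 1 B1 \<and> block_type V E 2 B2) \<or> (block_type V E 2 B1 \<and> block_type V E 1 B2))
        \<and> fst B1 \<inter> fst B2 \<noteq> {}))"

definition edge_polys :: "'v set set \<Rightarrow> (('v set \<Rightarrow>\<^sub>0 nat) \<Rightarrow>\<^sub>0 'k::field) set" where
  "edge_polys E = {p. \<forall>\<alpha>\<in>Poly_Mapping.keys p. Poly_Mapping.keys \<alpha> \<subseteq> E}"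

definition edge_poly_ring :: "'v set set \<Rightarrow> (('v set \<Rightarrow>\<^sub>0 nat) \<Rightarrow>\<^sub>0 'k::field) ring" where
  "edge_poly_ring E = \<lparr>carrier = edge_polys E, monoid.mult = (*), one = 1, zero = 0, add = (+)\<rparr>"

text \<open>Image of the monomial e^alpha: the product over edges {v_j,v_k} of (v_j v_k)^alpha(e).\<close>
definition edge_mono :: "('v set \<Rightarrow>\<^sub>0 nat) \<Rightarrow> ('v \<Rightarrow>\<^sub>0 nat)" where
  "edge_mono \<alpha> = (\<Sum>e\<in>Poly_Mapping.keys \<alpha>. (\<Sum>v\<in>e. Poly_Mapping.single v (Poly_Mapping.lookup \<alpha> e)))"

text \<open>The K-algebra map e_i = {v_j,v_k} \<mapsto> v_j v_k.\<close>
definition edge_map :: "(('v set \<Rightarrow>\<^sub>0 nat) \<Rightarrow>\<^sub>0 'k::field) \<Rightarrow> (('v \<Rightarrow>\<^sub>0 nat) \<Rightarrow>\<^sub>0 'k)" where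
  "edge_map p = (\<Sum>\<alpha>\<in>Poly_Mapping.keys p. Poly_Mapping.single (edge_mono \<alpha>) (Poly_Mapping.lookup p \<alpha>))"

definition toric_ideal :: "'v set set \<Rightarrow> (('v set \<Rightarrow>\<^sub>0 nat) \<Rightarrow>\<^sub>0 'k::field) set" where
  "toric_ideal E = {p \<in> edge_polys E. edge_map p = 0}"

definition prime_height :: "('a, 'b) ring_scheme \<Rightarrow> 'a set \<Rightarrow> enat" where
  "prime_height R P = Sup {enat n | n. \<exists>Q :: nat \<Rightarrow> 'a set. Q n = P \<and>
       (\<forall>i\<le>n. primeideal (Q i) R) \<and> (\<forall>i<n. Q i \<subset> Q (Suc i))}"

definition ideal_height :: "('a, 'b) ring_scheme \<Rightarrow> 'a set \<Rightarrow> enat" where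
  "ideal_height R I = Inf {prime_height R P | P. primeideal P R \<and> I \<subseteq> P}"

definition complete_intersection :: "'k::field itself \<Rightarrow> 'v set set \<Rightarrow> bool" where
  "complete_intersection _ E \<longleftrightarrow>
     (\<exists>gs :: (('v set \<Rightarrow>\<^sub>0 nat) \<Rightarrow>\<^sub>0 'k) list. set gs \<subseteq> edge_polys E \<and>
        genideal (edge_poly_ring E) (set gs) = toric_ideal E \<and>
        enat (length gs) = ideal_height (edge_poly_ring E) (toric_ideal E :: (('v set \<Rightarrow>\<^sub>0 nat) \<Rightarrow>\<^sub>0 'k) set))"

inductive_set edge_ring :: "'v set set \<Rightarrow> (('v \<Rightarrow>\<^sub>0 nat) \<Rightarrow>\<^sub>0 'k::field) set" for E where
  const: "Poly_Mapping.single 0 c \<in> edge_ring E"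
| edge: "{u, v} \<in> E \<Longrightarrow> u \<noteq> v \<Longrightarrow>
     Poly_Mapping.single (Poly_Mapping.single u 1 + Poly_Mapping.single v 1) 1 \<in> edge_ring E"
| add: "p \<in> edge_ring E \<Longrightarrow> q \<in> edge_ring E \<Longrightarrow> p + q \<in> edge_ring E"
| mult: "p \<in> edge_ring E \<Longrightarrow> q \<in> edge_ring E \<Longrightarrow> p * q \<in> edge_ring E"

definition normal_domain :: "'a::idom set \<Rightarrow> bool" where
  "normal_domain D \<longleftrightarrow> (\<forall>a\<in>D. \<forall>b\<in>D. b \<noteq> 0 \<longrightarrow>
     (\<exists>n c. (\<forall>i<n. c i \<in> D) \<and>
        Fract a b ^ n + (\<Sum>i<n. Fract (c i) 1 * Fract a b ^ i) = 0) \<longrightarrow>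
     (\<exists>d\<in>D. Fract a b = Fract d 1))"

end

theory Submission
  imports Defs Complex_Main "HOL-Library.Multiset" "HOL-Computational_Algebra.Polynomial"
begin

text \<open>Sums of the coefficients of a polynomial over a connected component of a fibre (monomials of one
  degree, adjacent when they share an edge variable) vanish on the product of \<open>I\<^sub>G\<close> with the irrelevant ideal.
  Hence every generating set of \<open>I\<^sub>G\<close> has at least as many elements as there are minimal binomials, whose
  exponent vectors span the relation lattice, while the height of \<open>I\<^sub>G\<close> is at most the rank of that lattice.
  For a complete intersection the exponent vectors of a minimal binomial system are therefore linearly
  independent: for every minimal binomial \<open>z - w\<close> of degree \<open>\<beta>\<close> there is an edge weighting \<open>f\<close> that separates
  \<open>z\<close> from \<open>w\<close> but has alternating sum zero on every even closed walk whose degree does not dominate \<open>\<beta>\<close>.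

  The graph theory consists of contradictions to this duality. Two odd cycles joined by a path form a
  dumbbell, whose degree is not squarefree and lies above a minimal degree \<open>\<beta>\<close> with an entry \<open>2\<close>. The
  weighting \<open>f\<close> for \<open>\<beta>\<close> kills all even closed walks that pass once through that vertex, hence comes from a
  vertex potential on every block. If the potentials of the blocks involved fit together, \<open>f\<close> cannot
  separate \<open>z\<close> from \<open>w\<close>. In this way one sees that odd cycles of one block touch, that three
  non-bipartite blocks are impossible in the presence of the odd cycle condition, and that the types of two
  non-bipartite blocks are as stated.

  The edge ring is normal if and only if any two odd cycles intersect or are joined by an edge. For
  sufficiency, the leading exponents of an almost integral fraction satisfy Hall's condition; the permutation
  given by the marriage theorem splits into closed walks, and two odd ones that touch can be merged.\<close>

text \<open>Every contradiction ends with a potential: if \<open>f {u, v} = g u + g v\<close> on the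
  edges of a region, the weight of a monomial supported there depends only on its degree, so
  \<open>f\<close> cannot separate two monomials of one fibre. The obstacle is to glue the
  potentials of single blocks. On a bipartite piece a potential can be shifted by a multiple of the
  two-colouring, so it always fits. On a connected non-bipartite piece it is unique, and agreement
  at the link has to come from one more even closed walk whose degree does not dominate \<beta>. If
  that walk does dominate \<beta>, it bounds the support of the minimal binomial, which is then
  shown to be bipartite inside one of the blocks. The entry 2 in \<beta> comes from parity: the two
  halves of a dumbbell differ by two in the number of edges crossing its waist, while this number
  has constant parity on the fibre. All arguments use vertex sets and closed walks with repetitions:
  blocks and odd chordless cycles are induced, hence determined by their vertex sets.\<close>

abbreviation lookup :: "('a \<Rightarrow>\<^sub>0 'b::zero) \<Rightarrow> 'a \<Rightarrow> 'b" where "lookup \<equiv> Poly_Mapping.lookup"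
abbreviation keys :: "('a \<Rightarrow>\<^sub>0 'b::zero) \<Rightarrow> 'a set" where "keys \<equiv> Poly_Mapping.keys"
abbreviation single :: "'a \<Rightarrow> 'b \<Rightarrow> ('a \<Rightarrow>\<^sub>0 'b::zero)" where "single \<equiv> Poly_Mapping.single"

section \<open>Walks\<close>

text \<open>The list holds the vertices after the starting point, so its length is the number of edges, and for a
  closed walk it lists every visit exactly once.\<close>
fun walk_from :: "'v set set \<Rightarrow> 'v set \<Rightarrow> 'v \<Rightarrow> 'v list \<Rightarrow> 'v \<Rightarrow> bool" where
  "walk_from E X a [] b \<longleftrightarrow> a = b \<and> a \<in> X"
| "walk_from E X a (c # xs) b \<longleftrightarrow> a \<in> X \<and> {a, c} \<in> E \<and> walk_from E X c xs b"

text \<open>Along an even closed walk this is the difference of the weights of the two monomials of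
  the binomial attached to the walk; see \<open>weight_half_walk\<close>.\<close>

fun alt_sum :: "('v set \<Rightarrow> real) \<Rightarrow> 'v \<Rightarrow> 'v list \<Rightarrow> real" where
  "alt_sum f a [] = 0"
| "alt_sum f a (c # xs) = f {a, c} - alt_sum f c xs"

text \<open>Lists omit the starting vertex, so reversal has to drop the end of the walk and append
  the old start.\<close>

definition rev_walk :: "'v \<Rightarrow> 'v list \<Rightarrow> 'v list" where
  "rev_walk a xs = rev (butlast (a # xs))"

definition conn :: "'v set set \<Rightarrow> 'v set \<Rightarrow> bool" where
  "conn E X \<longleftrightarrow> (\<forall>a\<in>X. \<forall>b\<in>X. \<exists>xs. walk_from E X a xs b)"

definition odd_closed :: "'v set set \<Rightarrow> 'v set \<Rightarrow> 'v \<Rightarrow> 'v list \<Rightarrow> bool" where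
  "odd_closed E X a xs \<longleftrightarrow> walk_from E X a xs a \<and> odd (length xs)"

text \<open>Non-bipartiteness of the subgraph induced on \<open>X\<close>, in the form in which it
  is used.\<close>

definition has_odd :: "'v set set \<Rightarrow> 'v set \<Rightarrow> bool" where
  "has_odd E X \<longleftrightarrow> (\<exists>a xs. odd_closed E X a xs)"

text \<open>For monomials supported on \<open>X\<close>, a functional on edges with a potential
  factors through the vertex degree; see \<open>weight_potential\<close>.\<close>

definition potential :: "'v set set \<Rightarrow> ('v set \<Rightarrow> real) \<Rightarrow> 'v set \<Rightarrow> ('v \<Rightarrow> real) \<Rightarrow> bool" where
  "potential E f X g \<longleftrightarrow> (\<forall>u\<in>X. \<forall>v\<in>X. {u, v} \<in> E \<longrightarrow> f {u, v} = g u + g v)"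

lemma walk_from_ends:
  "walk_from E X a xs b \<Longrightarrow> a \<in> X \<and> b \<in> X \<and> set xs \<subseteq> X \<and> last (a # xs) = b"
  by (induction xs arbitrary: a) auto

lemma walk_from_append:
  "walk_from E X a (xs @ ys) c \<longleftrightarrow> (\<exists>b. walk_from E X a xs b \<and> walk_from E X b ys c)"
  by (induction xs arbitrary: a) (auto dest: walk_from_ends)

lemma walk_from_appendI:
  "walk_from E X a xs b \<Longrightarrow> walk_from E X b ys c \<Longrightarrow> walk_from E X a (xs @ ys) c"
  by (auto simp: walk_from_append)

lemma walk_from_restrict:
  "walk_from E X a xs b \<Longrightarrow> insert a (set xs) \<subseteq> Y \<Longrightarrow> walk_from E Y a xs b"
  by (induction xs arbitrary: a) auto

lemma walk_from_mono: "walk_from E X a xs b \<Longrightarrow> X \<subseteq> Y \<Longrightarrow> walk_from E Y a xs b"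
  by (induction xs arbitrary: a) auto

lemma rev_walk_Nil [simp]: "rev_walk a [] = []"
  by (simp add: rev_walk_def)

lemma rev_walk_Cons [simp]: "rev_walk a (c # xs) = rev_walk c xs @ [a]"
  by (simp add: rev_walk_def)

lemma length_rev_walk [simp]: "length (rev_walk a xs) = length xs"
  by (simp add: rev_walk_def)

lemma set_rev_walk: "set (rev_walk a xs) \<subseteq> insert a (set xs)"
  by (induction xs arbitrary: a) auto

lemma walk_from_rev: "walk_from E X a xs b \<Longrightarrow> walk_from E X b (rev_walk a xs) a"
proof (induction xs arbitrary: a)
  case (Cons c xs)
  then have "walk_from E X b (rev_walk c xs) c" and "c \<in> X" by (auto dest: walk_from_ends)
  then show ?case using Cons.prems by (auto simp: walk_from_append insert_commute)
qed auto

lemma alt_sum_append: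
  "walk_from E X a xs b \<Longrightarrow> alt_sum f a (xs @ ys) = alt_sum f a xs + (-1) ^ length xs * alt_sum f b ys"
  by (induction xs arbitrary: a) auto

lemma alt_sum_rev:
  "walk_from E X a xs b \<Longrightarrow> alt_sum f b (rev_walk a xs) = - ((-1) ^ length xs) * alt_sum f a xs"
proof (induction xs arbitrary: a)
  case (Cons c xs)
  then have w: "walk_from E X b (rev_walk c xs) c" by (auto intro: walk_from_rev)
  have "alt_sum f b (rev_walk a (c # xs)) = - ((-1) ^ length xs) * alt_sum f c xs + (-1) ^ length xs * f {c, a}"
    using Cons alt_sum_append[OF w, of f "[a]"] by simp
  then show ?case by (simp add: insert_commute algebra_simps)
qed auto

lemma alt_sum_potential:
  "potential E f X g \<Longrightarrow> walk_from E X a xs b \<Longrightarrow> alt_sum f a xs = g a - (-1) ^ length xs * g b"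
proof (induction xs arbitrary: a)
  case (Cons c xs)
  then have "f {a, c} = g a + g c" unfolding potential_def by (auto dest: walk_from_ends)
  then show ?case using Cons by simp
qed auto

lemma closed_rotate:
  assumes "walk_from E X a xs a" "v \<in> insert a (set xs)"
  obtains ys where "walk_from E X v ys v" "mset ys = mset xs"
proof (cases "v = a")
  case True
  then show ?thesis using assms that by blast
next
  case False
  then obtain us ws where xs: "xs = us @ v # ws" using assms(2) by (auto simp: in_set_conv_decomp)
  then have xs': "xs = (us @ [v]) @ ws" by simp
  then obtain b where b: "walk_from E X a (us @ [v]) b" "walk_from E X b ws a"
    using assms(1) walk_from_append by metis
  then have "b = v" using walk_from_ends[OF b(1)] by simp
  then have "walk_from E X v (ws @ us @ [v]) v" using b walk_from_appendI by metis
  moreover have "mset (ws @ us @ [v]) = mset xs" using xs by simp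
  ultimately show ?thesis using that by blast
qed

lemma odd_closed_rotate:
  assumes "odd_closed E X a xs" "v \<in> insert a (set xs)"
  obtains ys where "odd_closed E X v ys" "mset ys = mset xs"
proof -
  obtain ys where ys: "walk_from E X v ys v" "mset ys = mset xs"
    using closed_rotate assms unfolding odd_closed_def by metis
  then have "length ys = length xs" by (metis size_mset)
  then show ?thesis using that ys assms unfolding odd_closed_def by metis
qed

lemma odd_closed_nonempty: "odd_closed E X a xs \<Longrightarrow> a \<in> set xs"
  unfolding odd_closed_def by (cases xs) (auto dest: walk_from_ends split: if_splits)

lemma walk_from_distinct:
  assumes "walk_from E X a xs b"
  obtains ys where "walk_from E X a ys b" "distinct (a # ys)" "set ys \<subseteq> set xs"
proof -
  have "\<exists>ys. walk_from E X a ys b \<and> distinct (a # ys) \<and> set ys \<subseteq> set xs"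
    using assms
  proof (induction xs arbitrary: a)
    case Nil
    then show ?case by (intro exI[of _ "[]"]) auto
  next
    case (Cons c xs)
    then obtain ys where ys: "walk_from E X c ys b" "distinct (c # ys)" "set ys \<subseteq> set xs" by fastforce
    show ?case
    proof (cases "a \<in> set (c # ys)")
      case False
      then show ?thesis using ys Cons.prems by (intro exI[of _ "c # ys"]) auto
    next
      case True
      then obtain us ws where uw: "c # ys = us @ a # ws" by (meson split_list)
      have "walk_from E X a ws b"
      proof (cases us)
        case Nil
        then show ?thesis using uw ys by auto
      next
        case (Cons d us')
        then have "ys = us' @ a # ws" using uw by auto
        then have "ys = (us' @ [a]) @ ws" by simp
        then obtain e where "walk_from E X c (us' @ [a]) e" "walk_from E X e ws b"
          using ys(1) walk_from_append by metis
        moreover from this(1) have "e = a" using walk_from_ends by fastforce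
        ultimately show ?thesis by simp
      qed
      moreover have "distinct (a # ws)" using ys(2) uw by auto
      moreover have "set (c # ys) \<subseteq> set (c # xs)" using ys(3) by auto
      then have "set ws \<subseteq> set (c # xs)" unfolding uw by auto
      ultimately show ?thesis by blast
    qed
  qed
  then show ?thesis using that by blast
qed

text \<open>A detour around an odd closed walk switches the parity of a walk.\<close>

lemma conn_odd_parity:
  assumes "conn E X" "has_odd E X" "a \<in> X" "b \<in> X"
  obtains xs where "walk_from E X a xs b" "even (length xs) = p"
proof -
  obtain c ys where c: "walk_from E X c ys c" "odd (length ys)"
    using assms(2) unfolding has_odd_def odd_closed_def by blast
  obtain us where us: "walk_from E X a us c" using assms c walk_from_ends unfolding conn_def by metis
  obtain ws where ws: "walk_from E X c ws b" using assms c walk_from_ends unfolding conn_def by metis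
  have "walk_from E X a (us @ ws) b" "walk_from E X a (us @ ys @ ws) b"
    using us ws c by (auto intro!: walk_from_appendI)
  moreover have "even (length (us @ ws)) \<noteq> even (length (us @ ys @ ws))" using c by auto
  ultimately show ?thesis using that by metis
qed

lemma odd_closed_at:
  assumes "conn E X" "has_odd E X" "a \<in> X"
  obtains xs where "odd_closed E X a xs"
  using conn_odd_parity[OF assms assms(3), of False] unfolding odd_closed_def by metis

text \<open>Parity of walks from a root of each component. The values are real signs, so that the
  colouring is itself a potential of the zero weighting and can be added to other
  potentials.\<close>

lemma two_colouring:
  assumes "\<not> has_odd E X"
  obtains s :: "'v \<Rightarrow> real" where "\<And>v. s v = 1 \<or> s v = -1"
    "\<And>u v. u \<in> X \<Longrightarrow> v \<in> X \<Longrightarrow> {u, v} \<in> E \<Longrightarrow> s v = - s u"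
proof -
  \<comment> \<open>The chosen root depends only on the component, because adjacent vertices give
    the same predicate under \<open>SOME\<close>.\<close>
  define R where "R v = (SOME r. \<exists>xs. walk_from E X r xs v)" for v
  define s :: "'v \<Rightarrow> real" where
    "s v = (if \<exists>xs. walk_from E X (R v) xs v \<and> even (length xs) then 1 else -1)" for v
  have "s v = - s u" if uv: "u \<in> X" "v \<in> X" "{u, v} \<in> E" for u v
  proof -
    have step: "\<exists>xs. walk_from E X r xs v \<and> even (length xs) = p"
      if "walk_from E X r ys u" "even (length ys) \<noteq> p" "u \<in> X" "v \<in> X" "{u, v} \<in> E" for r ys u v p
    proof -
      have "walk_from E X r (ys @ [v]) v" using that by (intro walk_from_appendI) auto
      then show ?thesis using that(2) by (intro exI[of _ "ys @ [v]"]) auto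
    qed
    have vu: "{v, u} \<in> E" using uv by (simp add: insert_commute)
    have "(\<exists>xs. walk_from E X r xs u) = (\<exists>xs. walk_from E X r xs v)" for r
      using step uv vu by metis
    then have R: "R u = R v" unfolding R_def by simp
    have "\<exists>xs. walk_from E X u xs u" using uv by (intro exI[of _ "[]"]) auto
    then have "\<exists>xs. walk_from E X (R u) xs u" unfolding R_def by (intro someI_ex[of "\<lambda>r. \<exists>xs. walk_from E X r xs u"]) blast
    then obtain xs where xs: "walk_from E X (R u) xs u" by blast
    have par: "even (length ys) = even (length zs)"
      if "walk_from E X r ys w" "walk_from E X r zs w" for r w ys zs
    proof (rule ccontr)
      assume "even (length ys) \<noteq> even (length zs)"
      then have "odd_closed E X r (ys @ rev_walk r zs)"
        using that walk_from_rev walk_from_appendI unfolding odd_closed_def by fastforce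
      then show False using assms unfolding has_odd_def by blast
    qed
    obtain zs where zs: "walk_from E X (R v) zs v" "even (length zs) \<noteq> even (length xs)"
      using step[OF xs, of "odd (length xs)" v] uv R by auto
    have "s u = (if even (length xs) then 1 else -1)" unfolding s_def using par xs by metis
    moreover have "s v = (if even (length zs) then 1 else -1)" unfolding s_def using par zs by metis
    ultimately show ?thesis using zs(2) by auto
  qed
  moreover have "s v = 1 \<or> s v = -1" for v unfolding s_def by auto
  ultimately show ?thesis using that by blast
qed

text \<open>The colouring is a potential of the zero weighting; along an odd closed walk at
  \<open>a\<close> the alternating sum, which is zero, equals \<open>2 * s a\<close>.\<close>

lemma colouring_no_odd:
  fixes s :: "'v \<Rightarrow> real"
  assumes "\<And>v. v \<in> X \<Longrightarrow> s v \<noteq> 0"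
    "\<And>u v. u \<in> X \<Longrightarrow> v \<in> X \<Longrightarrow> {u, v} \<in> E \<Longrightarrow> s v = - s u"
  shows "\<not> has_odd E X"
proof
  assume "has_odd E X"
  then obtain a xs where a: "walk_from E X a xs a" "odd (length xs)"
    unfolding has_odd_def odd_closed_def by blast
  have "potential E (\<lambda>_. 0) X s" using assms(2) unfolding potential_def by fastforce
  moreover have "alt_sum (\<lambda>_. 0) c ys = 0" for c and ys :: "'v list" by (induction ys arbitrary: c) auto
  ultimately have "s a = 0" using alt_sum_potential[OF _ a(1)] a(2) by fastforce
  then show False using assms(1) a walk_from_ends by metis
qed

lemma has_odd_mono: "has_odd E X \<Longrightarrow> X \<subseteq> Y \<Longrightarrow> has_odd E Y"
  unfolding has_odd_def odd_closed_def using walk_from_mono by metis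

lemma conn_union:
  assumes "conn E X" "conn E Y" "X \<inter> Y \<noteq> {}"
  shows "conn E (X \<union> Y)"
proof -
  obtain c where c: "c \<in> X" "c \<in> Y" using assms by auto
  have "\<exists>xs. walk_from E (X \<union> Y) a xs c" if "a \<in> X \<union> Y" for a
    using that c assms walk_from_mono[of E X _ _ _ "X \<union> Y"] walk_from_mono[of E Y _ _ _ "X \<union> Y"]
    unfolding conn_def by (metis Un_iff Un_upper1 Un_upper2)
  then show ?thesis unfolding conn_def using walk_from_rev walk_from_appendI by metis
qed

lemma conn_walk_set:
  assumes "walk_from E X a xs b"
  shows "conn E (insert a (set xs))"
  using assms
proof (induction xs arbitrary: a)
  case Nil
  then show ?case unfolding conn_def by (auto intro: exI[of _ "[]"])
next
  case (Cons c xs)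
  have "conn E {a, c}"
    unfolding conn_def
  proof (intro ballI)
    fix u v assume "u \<in> {a, c}" "v \<in> {a, c}"
    then consider "u = v" | "{u, v} = {a, c}" by auto
    then show "\<exists>xs. walk_from E {a, c} u xs v"
    proof cases
      case 1
      then show ?thesis using \<open>u \<in> {a, c}\<close> by (intro exI[of _ "[]"]) auto
    next
      case 2
      then show ?thesis using Cons.prems \<open>u \<in> {a, c}\<close> \<open>v \<in> {a, c}\<close> by (intro exI[of _ "[v]"]) auto
    qed
  qed
  moreover have "conn E (insert c (set xs))" using Cons by auto
  ultimately have "conn E ({a, c} \<union> insert c (set xs))" by (intro conn_union) auto
  then show ?case by (simp add: insert_commute)
qed

lemma conn_insert:
  assumes "conn E X" "u \<in> X" "{u, v} \<in> E"
  shows "conn E (insert v X)"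
proof -
  have "walk_from E UNIV u [v] v" using assms by auto
  then have "conn E {u, v}" using conn_walk_set by fastforce
  then have "conn E ({u, v} \<union> X)" using assms by (intro conn_union) auto
  then show ?thesis using assms(2) by (metis Un_insert_left insert_absorb insert_commute sup_bot_left)
qed

section \<open>Potentials\<close>

locale ugraph =
  fixes E :: "'v set set"
  assumes finite_E: "finite E" and card_edge: "e \<in> E \<Longrightarrow> card e = 2"
begin

lemma no_loop: "{v} \<notin> E" "{v, v} \<notin> E"
  using card_edge[of "{v}"] by auto

lemma edgeE: assumes "e \<in> E" obtains u v where "u \<noteq> v" "e = {u, v}"
  using card_edge[OF assms] by (auto simp: card_2_iff)

lemma finite_edge: "e \<in> E \<Longrightarrow> finite e"
  by (auto elim: edgeE)

lemma edge_memE: assumes "e \<in> E" "a \<in> e" obtains b where "b \<noteq> a" "e = {a, b}"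
proof -
  obtain u v where "u \<noteq> v" "e = {u, v}" using assms edgeE by metis
  then show ?thesis using assms(2) that[of u] that[of v] by auto
qed

text \<open>Fix a root \<open>r\<close>. A walk from \<open>v\<close> to \<open>r\<close> expresses
  \<open>g v\<close> through its alternating sum and \<open>g r\<close>. Two walks of equal parity
  give the same value because together they form an even closed walk; walks of different parity
  agree once \<open>g r\<close> is half the alternating sum of an odd closed walk at
  \<open>r\<close>.\<close>

lemma potential_exists:
  assumes "conn E X" and kill: "\<And>a xs. walk_from E X a xs a \<Longrightarrow> even (length xs) \<Longrightarrow> alt_sum f a xs = 0"
  shows "\<exists>g. potential E f X g"
proof (cases "X = {}")
  case True
  then show ?thesis unfolding potential_def by auto
next
  case False
  then obtain r where r: "r \<in> X" by auto
  \<comment> \<open>The value of the potential at \<open>r\<close>: forced if there is an odd closed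
    walk, free otherwise, with \<open>0\<close> as default.\<close>
  define c where "c = (if \<exists>xs. odd_closed E X r xs then alt_sum f r (SOME xs. odd_closed E X r xs) / 2 else 0)"
  have c: "alt_sum f r xs = 2 * c" if o: "odd_closed E X r xs" for xs
  proof -
    define ys where "ys = (SOME xs. odd_closed E X r xs)"
    have ys: "odd_closed E X r ys" unfolding ys_def using o by (rule someI)
    have "alt_sum f r (xs @ ys) = 0" using o ys unfolding odd_closed_def
      by (intro kill) (auto intro: walk_from_appendI)
    moreover have "alt_sum f r (xs @ ys) = alt_sum f r xs - alt_sum f r ys"
      using o alt_sum_append[of E X r xs r f ys] unfolding odd_closed_def by simp
    moreover have "c = alt_sum f r ys / 2" unfolding c_def ys_def using o by auto
    ultimately show ?thesis by simp
  qed
  define w where "w v = (SOME xs. walk_from E X v xs r)" for v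
  have w: "walk_from E X v (w v) r" if "v \<in> X" for v
  proof -
    have "\<exists>xs. walk_from E X v xs r" using assms(1) r that unfolding conn_def by blast
    then show ?thesis unfolding w_def by (rule someI_ex)
  qed
  define g where "g v = alt_sum f v (w v) + (-1) ^ length (w v) * c" for v
  have g: "alt_sum f v xs + (-1) ^ length xs * c = g v" if xs: "walk_from E X v xs r" for v xs
  proof -
    have v: "v \<in> X" using xs walk_from_ends by metis
    note rw = walk_from_rev[OF w[OF v]]
    show ?thesis
    proof (cases "even (length xs) = even (length (w v))")
      case True
      have "alt_sum f v (xs @ rev_walk v (w v)) = 0"
        using xs rw True by (intro kill) (auto intro: walk_from_appendI)
      then have "alt_sum f v xs - (-1) ^ length xs * (-1) ^ length (w v) * alt_sum f v (w v) = 0"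
        using alt_sum_append[OF xs] alt_sum_rev[OF w[OF v]] by simp
      moreover have sg: "(-1::real) ^ length xs = (-1) ^ length (w v)" using True
        by (simp add: minus_one_power_iff)
      moreover have "(-1::real) ^ length (w v) * (-1) ^ length (w v) = 1"
        by (simp flip: power_add)
      ultimately show ?thesis unfolding g_def by simp
    next
      case False
      have "odd_closed E X r (rev_walk v xs @ w v)" using walk_from_rev[OF xs] w[OF v] False
        unfolding odd_closed_def by (auto intro: walk_from_appendI)
      then have "2 * c = alt_sum f r (rev_walk v xs) + (-1) ^ length xs * alt_sum f v (w v)"
        using c alt_sum_append[OF walk_from_rev[OF xs], of f "w v"] by fastforce
      then have "2 * c = (-1) ^ length xs * (alt_sum f v (w v) - alt_sum f v xs)"
        using alt_sum_rev[OF xs] by (simp add: algebra_simps)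
      then show ?thesis unfolding g_def using False
        by (cases "even (length xs)") (simp_all add: minus_one_power_iff)
    qed
  qed
  have "f {u, v} = g u + g v" if "u \<in> X" "v \<in> X" "{u, v} \<in> E" for u v
  proof -
    have "walk_from E X u (v # w v) r" using that w by auto
    from g[OF this] show ?thesis using g[OF w[OF that(2)]] by simp
  qed
  then show ?thesis unfolding potential_def by blast
qed

text \<open>If \<open>X - {p}\<close> is bipartite, its potentials form a one-parameter family, which leaves the freedom to fit the
  two colour classes of neighbours of \<open>p\<close>.\<close>
lemma potential_exists_once:
  assumes "conn E (X - {p})"
    and kill: "\<And>a xs. walk_from E X a xs a \<Longrightarrow> even (length xs) \<Longrightarrow> count_list xs p \<le> 1 \<Longrightarrow> alt_sum f a xs = 0"
  shows "\<exists>g. potential E f X g"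
proof -
  define Y where "Y = X - {p}"
  have "alt_sum f a xs = 0" if "walk_from E Y a xs a" "even (length xs)" for a xs
  proof (rule kill)
    show "walk_from E X a xs a" by (rule walk_from_mono[OF that(1)]) (auto simp: Y_def)
    have "p \<notin> set xs" using walk_from_ends[OF that(1)] unfolding Y_def by auto
    then show "count_list xs p \<le> 1" by (simp add: count_list_0_iff)
  qed (use that in auto)
  then obtain g0 where g0: "potential E f Y g0"
    using potential_exists[of Y f] assms(1)[folded Y_def] by blast
  show ?thesis
  proof (cases "p \<in> X")
    case False
    then show ?thesis using g0 unfolding Y_def by auto
  next
    case True
    define N where "N = {r\<in>Y. {p, r} \<in> E}"
    \<comment> \<open>\<open>h r\<close> is the value that the neighbour \<open>r\<close> demands of
      the potential at \<open>p\<close>; what remains is to make this demand constant on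
      \<open>N\<close>.\<close>
    define h where "h r = f {p, r} - g0 r" for r
    have heq: "h r = h s" if rs: "r \<in> N" "s \<in> N" "walk_from E Y r ys s" "even (length ys)" for r s ys
    proof -
      have w: "walk_from E X r ys s" by (rule walk_from_mono[OF rs(3)]) (auto simp: Y_def)
      have pn: "p \<notin> set ys" "p \<noteq> r" using walk_from_ends[OF rs(3)] unfolding Y_def by auto
      \<comment> \<open>Closing the walk through \<open>p\<close> gives an even closed walk that
        lists \<open>p\<close> exactly once, so the hypothesis applies.\<close>
      have "walk_from E X r (ys @ [p]) p" using w rs True unfolding N_def
        by (intro walk_from_appendI[OF w]) (auto simp: insert_commute Y_def)
      then have "alt_sum f p (r # ys @ [p]) = 0" using rs True pn unfolding N_def
        by (intro kill) (auto simp: count_list_0_iff)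
      then have "f {p, r} - alt_sum f r ys - f {s, p} = 0"
        using alt_sum_append[OF w, of f "[p]"] rs(4) by simp
      then show ?thesis using alt_sum_potential[OF g0 rs(3)] rs(4) unfolding h_def
        by (simp add: insert_commute)
    qed
    have fin: "\<exists>g. potential E f X g" if g: "potential E f Y g" and k: "\<And>r. r \<in> N \<Longrightarrow> f {p, r} - g r = k" for g k
    proof -
      have "potential E f X (g(p := k))" unfolding potential_def
      proof (intro ballI impI)
        fix u v assume uv: "u \<in> X" "v \<in> X" "{u, v} \<in> E"
        then have "u \<noteq> v" using no_loop by auto
        then consider "u = p" "v \<in> N" | "v = p" "u \<in> N" | "u \<in> Y" "v \<in> Y"
          using uv insert_commute[of u v "{}"] unfolding N_def Y_def by (cases "u = p"; cases "v = p") auto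
        then show "f {u, v} = (g(p := k)) u + (g(p := k)) v"
        proof cases
          case 1
          then show ?thesis using k[of v] unfolding N_def Y_def by auto
        next
          case 2
          then show ?thesis using k[of u] unfolding N_def Y_def by (auto simp: insert_commute)
        next
          case 3
          then show ?thesis using g uv unfolding potential_def Y_def by auto
        qed
      qed
      then show ?thesis by blast
    qed
    have cY: "conn E Y" using assms(1) unfolding Y_def .
    show ?thesis
    proof (cases "has_odd E Y")
      case True
      have "h r = h s" if rs: "r \<in> N" "s \<in> N" for r s
      proof -
        obtain ys where "walk_from E Y r ys s" "even (length ys) = True"
          using conn_odd_parity[OF cY True] rs unfolding N_def by (metis (lifting) mem_Collect_eq)
        then show ?thesis using heq rs by blast
      qed
      then show ?thesis using fin[OF g0, of "h (SOME r. r \<in> N)"] unfolding h_def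
        by (metis someI)
    next
      case False
      then obtain s :: "'v \<Rightarrow> real" where s: "\<And>v. s v = 1 \<or> s v = -1"
        "\<And>u v. u \<in> Y \<Longrightarrow> v \<in> Y \<Longrightarrow> {u, v} \<in> E \<Longrightarrow> s v = - s u" using two_colouring by metis
      have ps: "potential E (\<lambda>_. 0) Y s" using s(2) unfolding potential_def by fastforce
      have z: "alt_sum (\<lambda>_. 0) c ys = 0" for c and ys :: "'v list" by (induction ys arbitrary: c) auto
      have same: "h r = h q" if rq: "r \<in> N" "q \<in> N" "s r = s q" for r q
      proof -
        obtain ys where ys: "walk_from E Y r ys q"
          using cY rq unfolding conn_def N_def by (metis (lifting) mem_Collect_eq)
        then have "s r = (-1) ^ length ys * s q" using alt_sum_potential[OF ps ys] z by simp
        then have "even (length ys)" using rq(3) s(1)[of q] by (cases "even (length ys)") auto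
        then show ?thesis using heq rq ys by blast
      qed
      define c where "c = (if \<exists>r q. r \<in> N \<and> q \<in> N \<and> s r = 1 \<and> s q = -1
        then (h (SOME r. r \<in> N \<and> s r = 1) - h (SOME q. q \<in> N \<and> s q = -1)) / 2 else 0)"
      have cc: "h r - c = h q + c" if rq: "r \<in> N" "q \<in> N" "s r = 1" "s q = -1" for r q
      proof -
        have "h (SOME r. r \<in> N \<and> s r = 1) = h r"
          using someI[of "\<lambda>r. r \<in> N \<and> s r = 1" r] same rq by metis
        moreover have "h (SOME q. q \<in> N \<and> s q = -1) = h q"
          using someI[of "\<lambda>r. r \<in> N \<and> s r = -1" q] same rq by metis
        ultimately have "c = (h r - h q) / 2" unfolding c_def using rq by auto
        then show ?thesis by simp
      qed
      define g where "g v = g0 v + c * s v" for v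
      have pg: "potential E f Y g" unfolding potential_def
      proof (intro ballI impI)
        fix u v assume "u \<in> Y" "v \<in> Y" "{u, v} \<in> E"
        then show "f {u, v} = g u + g v" using g0 s(2)[of u v] unfolding potential_def g_def by auto
      qed
      have "f {p, r} - g r = f {p, q} - g q" if rq: "r \<in> N" "q \<in> N" for r q
      proof -
        have "h r - c * s r = h q - c * s q"
        proof (cases "s r = s q")
          case True
          then show ?thesis using same[OF rq] by simp
        next
          case False
          then consider "s r = 1" "s q = -1" | "s r = -1" "s q = 1" using s(1)[of r] s(1)[of q] by fastforce
          then show ?thesis
          proof cases
            case 1
            then show ?thesis using cc[OF rq] by simp
          next
            case 2
            then show ?thesis using cc[OF rq(2,1)] by simp
          qed
        qed
        then show ?thesis unfolding g_def h_def by linarith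
      qed
      then show ?thesis using fin[OF pg, of "f {p, SOME r. r \<in> N} - g (SOME r. r \<in> N)"]
        by (metis someI)
    qed
  qed
qed

text \<open>An odd closed walk at \<open>v\<close> determines \<open>2 * g v\<close>.\<close>

lemma potential_unique:
  assumes "conn E K" "has_odd E K" "potential E f K g" "potential E f K g'" "v \<in> K"
  shows "g v = g' v"
proof -
  obtain xs where "odd_closed E K v xs" using odd_closed_at assms by metis
  then show ?thesis
    using alt_sum_potential[OF assms(3), of v xs v] alt_sum_potential[OF assms(4), of v xs v]
    unfolding odd_closed_def by simp
qed

lemma potential_subset: "potential E f X g \<Longrightarrow> Y \<subseteq> X \<Longrightarrow> potential E f Y g"
  unfolding potential_def by blast

text \<open>The two ways in which blocks are adjacent, treated uniformly: a common cut vertex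
  \<open>a = b\<close>, or disjoint sets whose only joining edge is \<open>{a, b}\<close>.\<close>

definition linked :: "'v set \<Rightarrow> 'v set \<Rightarrow> 'v \<Rightarrow> 'v \<Rightarrow> bool" where
  "linked X Y a b \<longleftrightarrow> a \<in> X \<and> b \<in> Y \<and>
     ((a = b \<and> X \<inter> Y = {a} \<and> (\<forall>u\<in>X - Y. \<forall>v\<in>Y - X. {u, v} \<notin> E)) \<or>
      (X \<inter> Y = {} \<and> {a, b} \<in> E \<and> (\<forall>u\<in>X. \<forall>v\<in>Y. {u, v} \<in> E \<longrightarrow> u = a \<and> v = b)))"

lemma potentialD: "potential E f X g \<Longrightarrow> u \<in> X \<Longrightarrow> v \<in> X \<Longrightarrow> {u, v} \<in> E \<Longrightarrow> f {u, v} = g u + g v"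
  unfolding potential_def by blast

lemma linked_cases:
  assumes "linked X Y a b"
  obtains "a = b" "X \<inter> Y = {a}" "\<And>u v. u \<in> X \<Longrightarrow> v \<in> Y \<Longrightarrow> {u, v} \<in> E \<Longrightarrow> u \<in> Y \<or> v \<in> X"
  | "a \<noteq> b" "X \<inter> Y = {}" "{a, b} \<in> E" "\<And>u v. u \<in> X \<Longrightarrow> v \<in> Y \<Longrightarrow> {u, v} \<in> E \<Longrightarrow> u = a \<and> v = b"
  using assms no_loop(2)[of a] unfolding linked_def by blast

lemma linked_mem: "linked X Y a b \<Longrightarrow> a \<in> X \<and> b \<in> Y"
  unfolding linked_def by blast

lemma linked_sym: assumes "linked X Y a b" shows "linked Y X b a"
proof -
  have c: "{u, v} = {v, u}" for u v :: 'v by auto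
  show ?thesis using assms
  proof (cases rule: linked_cases)
    case 1
    then have "\<forall>u\<in>Y - X. \<forall>v\<in>X - Y. {u, v} \<notin> E" using c by (metis DiffD1 DiffD2)
    then show ?thesis using 1 unfolding linked_def by blast
  next
    case 2
    then have "\<forall>u\<in>Y. \<forall>v\<in>X. {u, v} \<in> E \<longrightarrow> u = b \<and> v = a" using c by metis
    then show ?thesis using 2 linked_mem[OF assms] c unfolding linked_def by (metis inf_commute)
  qed
qed

text \<open>All interaction between the two sets runs through the link, so agreement there suffices.
  The second set may be shrunk to \<open>Y'\<close>, since only the support of a binomial has to be
  covered.\<close>

lemma potential_glue:
  assumes L: "linked X Y a b" and g1: "potential E f X g1" and "Y' \<subseteq> Y" "b \<in> Y'" and g2: "potential E f Y' g2"
    and ab: "if a = b then g1 a = g2 a else f {a, b} = g1 a + g2 b"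
  shows "\<exists>g. potential E f (X \<union> Y') g"
proof -
  define g where "g v = (if v \<in> X then g1 v else g2 v)" for v
  have Y: "g v = g2 v" if "v \<in> Y'" for v
  proof (cases "v \<in> X")
    case True
    then have "v \<in> X \<inter> Y" using that assms(3) by blast
    then have "v = a \<and> a = b" using linked_cases[OF L] by (metis empty_iff singletonD)
    then show ?thesis using ab True unfolding g_def by auto
  qed (simp add: g_def)
  have X: "g v = g1 v" if "v \<in> X" for v using that unfolding g_def by simp
  have cross: "f {u, v} = g u + g v" if uv: "u \<in> X" "v \<in> Y'" "{u, v} \<in> E" for u v
    using L
  proof (cases rule: linked_cases)
    case 1
    have "v \<in> Y" using uv assms(3) by blast
    then consider "v \<in> X" | "u \<in> Y" using 1(3) uv by blast
    then show ?thesis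
    proof cases
      case 1
      then show ?thesis using potentialD[OF g1 uv(1) _ uv(3)] X uv by simp
    next
      case 2
      then have "u \<in> Y'" using 1(1,2) uv assms(4) by auto
      then show ?thesis using potentialD[OF g2 _ uv(2,3)] Y uv by simp
    qed
  next
    case 2
    then have "u = a" "v = b" using uv assms(3) by blast+
    then show ?thesis using ab 2(1) X[OF uv(1)] Y[OF uv(2)] by simp
  qed
  have "f {u, v} = g u + g v" if uv: "u \<in> X \<union> Y'" "v \<in> X \<union> Y'" "{u, v} \<in> E" for u v
  proof -
    have c: "{u, v} = {v, u}" by auto
    consider "u \<in> X" "v \<in> X" | "u \<in> Y'" "v \<in> Y'" | "u \<in> X" "v \<in> Y'" | "v \<in> X" "u \<in> Y'" using uv by blast
    then show ?thesis
    proof cases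
      case 1
      then show ?thesis using potentialD[OF g1 1 uv(3)] X by simp
    next
      case 2
      then show ?thesis using potentialD[OF g2 2 uv(3)] Y by simp
    next
      case 3
      then show ?thesis using cross uv by blast
    next
      case 4
      then have "f {v, u} = g v + g u" using cross uv(3) c by metis
      then show ?thesis using c by simp
    qed
  qed
  then show ?thesis unfolding potential_def by blast
qed

text \<open>On a bipartite set, adding a multiple of the colouring changes no edge sum, so the value
  at \<open>b\<close> can be chosen freely.\<close>

lemma potential_glue_bip:
  assumes "linked X Y a b" "potential E f X g1" "potential E f Y g2" "Y' \<subseteq> Y" "b \<in> Y'" "\<not> has_odd E Y'"
  shows "\<exists>g. potential E f (X \<union> Y') g"
proof -
  obtain s :: "'v \<Rightarrow> real" where s: "\<And>v. s v = 1 \<or> s v = -1"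
    "\<And>u v. u \<in> Y' \<Longrightarrow> v \<in> Y' \<Longrightarrow> {u, v} \<in> E \<Longrightarrow> s v = - s u" using two_colouring assms(6) by metis
  define t where "t = (if a = b then g1 a else f {a, b} - g1 a)"
  \<comment> \<open>\<open>s b\<close> is a sign and thus its own inverse; the shifted potential
    takes the value \<open>t\<close> at \<open>b\<close>.\<close>
  define c where "c = (t - g2 b) * s b"
  have "potential E f Y' (\<lambda>v. g2 v + c * s v)" unfolding potential_def
  proof (intro ballI impI)
    fix u v assume "u \<in> Y'" "v \<in> Y'" "{u, v} \<in> E"
    then show "f {u, v} = g2 u + c * s u + (g2 v + c * s v)"
      using s(2)[of u v] potentialD[OF assms(3), of u v] assms(4) by (auto simp: algebra_simps)
  qed
  moreover have "g2 b + c * s b = t" unfolding c_def using s(1)[of b] by auto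
  ultimately show ?thesis
    by (intro potential_glue[OF assms(1,2,4,5), of "\<lambda>v. g2 v + c * s v"]) (auto simp: t_def)
qed

end

section \<open>Monomials and their fibres\<close>

text \<open>Every second edge of the walk; the flag tells whether the next edge is taken. For an
  even closed walk the two halves are the monomials of its binomial.\<close>

fun half_walk :: "bool \<Rightarrow> 'v \<Rightarrow> 'v list \<Rightarrow> ('v set \<Rightarrow>\<^sub>0 nat)" where
  "half_walk p a [] = 0"
| "half_walk True a (c # xs) = single {a, c} 1 + half_walk False c xs"
| "half_walk False a (c # xs) = half_walk True c xs"

abbreviation vdeg :: "('v set \<Rightarrow>\<^sub>0 nat) \<Rightarrow> 'v \<Rightarrow> nat" where
  "vdeg u v \<equiv> lookup (edge_mono u) v"

lemma edge_mono_add: "edge_mono (u + w) = edge_mono u + edge_mono w"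
  unfolding edge_mono_def
  by (rule setsum_keys_plus_distrib[of "\<lambda>e n. \<Sum>v\<in>e. single v n"])
    (simp_all add: single_add sum.distrib)

lemma edge_mono_0 [simp]: "edge_mono 0 = 0"
  by (simp add: edge_mono_def)

context ugraph
begin

definition mon :: "('v set \<Rightarrow>\<^sub>0 nat) set" where
  "mon = {u. keys u \<subseteq> E}"

definition weight :: "('v set \<Rightarrow> real) \<Rightarrow> ('v set \<Rightarrow>\<^sub>0 nat) \<Rightarrow> real" where
  "weight f u = (\<Sum>e\<in>E. f e * real (lookup u e))"

lemma weight_add: "weight f (u + w) = weight f u + weight f w"
  unfolding weight_def by (simp add: lookup_add algebra_simps sum.distrib)

lemma weight_0 [simp]: "weight f 0 = 0"
  unfolding weight_def by simp

lemma weight_single: "e \<in> E \<Longrightarrow> weight f (single e n) = f e * real n"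
  unfolding weight_def using finite_E
  by (simp add: lookup_single when_def if_distrib[of real] if_distrib[of "(*) _"] sum.delta cong: if_cong)

lemma mon_0 [simp]: "0 \<in> mon"
  unfolding mon_def by simp

lemma mon_add: "u \<in> mon \<Longrightarrow> w \<in> mon \<Longrightarrow> u + w \<in> mon"
  unfolding mon_def using keys_add[of u w] by blast

lemma mon_single: "e \<in> E \<Longrightarrow> single e n \<in> mon"
  unfolding mon_def by auto

lemma vdeg_eq:
  assumes "u \<in> mon"
  shows "vdeg u v = (\<Sum>e\<in>{e\<in>E. v \<in> e}. lookup u e)"
proof -
  have k: "keys u \<subseteq> E" using assms unfolding mon_def by auto
  have "vdeg u v = (\<Sum>e\<in>keys u. \<Sum>w\<in>e. (lookup u e when w = v))"
    unfolding edge_mono_def by (simp add: lookup_sum lookup_single)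
  also have "\<dots> = (\<Sum>e\<in>keys u. if v \<in> e then lookup u e else 0)"
    using k finite_edge by (intro sum.cong refl) (auto simp: when_def)
  also have "\<dots> = (\<Sum>e\<in>E. if v \<in> e then lookup u e else 0)"
    by (rule sum.mono_neutral_left[OF finite_E k]) (auto simp: in_keys_iff)
  finally show ?thesis using finite_E by (simp add: sum.inter_filter)
qed

lemma vdeg_single_edge:
  assumes "{a, b} \<in> E"
  shows "vdeg (single {a, b} 1) v = (if v = a then 1 else 0) + (if v = b then 1 else 0)"
proof -
  have "vdeg (single {a, b} 1) v = (\<Sum>e\<in>{e\<in>E. v \<in> e}. (1 when {a, b} = e))"
    using vdeg_eq[OF mon_single[OF assms]] by (simp add: lookup_single)
  also have "\<dots> = (if v \<in> {a, b} then 1 else 0)"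
    using finite_E assms by (auto simp: when_def)
  finally show ?thesis using no_loop(2)[of a] assms by auto
qed

lemma half_walk_mon: "walk_from E X a xs b \<Longrightarrow> half_walk p a xs \<in> mon"
  by (induction p a xs rule: half_walk.induct) (auto intro!: mon_add mon_single)

text \<open>Each inner visit uses one edge of either half. The corrections concern the ends: the
  half \<open>False\<close> misses the first edge at \<open>a\<close>, and the half that does not
  own the last edge misses \<open>b\<close>.\<close>

lemma vdeg_half_walk:
  assumes "walk_from E X a xs b"
  shows "vdeg (half_walk True a xs) v + (if even (length xs) \<and> v = b then 1 else 0) = count_list (a # xs) v"
    and "vdeg (half_walk False a xs) v + (if v = a then 1 else 0) + (if odd (length xs) \<and> v = b then 1 else 0)
      = count_list (a # xs) v"
  using assms
proof (induction xs arbitrary: a)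
  case Nil
  { case 1 then show ?case by auto }
  { case 2 then show ?case by auto }
next
  case (Cons c xs)
  { case 1
    then have w: "{a, c} \<in> E" "walk_from E X c xs b" by auto
    show ?case using Cons.IH(2)[OF w(2)] vdeg_single_edge[OF w(1), of v]
      by (auto simp: edge_mono_add lookup_add split: if_splits) }
  { case 2
    then have w: "walk_from E X c xs b" by auto
    show ?case using Cons.IH(1)[OF w] by (auto split: if_splits) }
qed

lemma weight_half_walk:
  "walk_from E X a xs b \<Longrightarrow> weight f (half_walk True a xs) - weight f (half_walk False a xs) = alt_sum f a xs"
proof (induction xs arbitrary: a)
  case (Cons c xs)
  then have "weight f (half_walk True c xs) - weight f (half_walk False c xs) = alt_sum f c xs" by simp
  then show ?case using Cons.prems by (simp add: weight_add weight_single)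
qed auto

lemma even_closed_halves:
  assumes "walk_from E X a xs a" "even (length xs)"
  shows "edge_mono (half_walk True a xs) = edge_mono (half_walk False a xs)"
    "vdeg (half_walk True a xs) v = count_list xs v"
proof -
  have *: "vdeg (half_walk True a xs) v = count_list xs v" "vdeg (half_walk False a xs) v = count_list xs v" for v
    using vdeg_half_walk[OF assms(1), of v] assms(2) by (auto split: if_splits)
  then show "edge_mono (half_walk True a xs) = edge_mono (half_walk False a xs)"
    by (intro poly_mapping_eqI) simp
  show "vdeg (half_walk True a xs) v = count_list xs v" by fact
qed

section \<open>Components of fibres and minimal binomials\<close>

definition share :: "(('v set \<Rightarrow>\<^sub>0 nat) \<times> ('v set \<Rightarrow>\<^sub>0 nat)) set" where
  "share = {(u, w). u \<in> mon \<and> w \<in> mon \<and> edge_mono u = edge_mono w \<and>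
     keys u \<inter> keys w \<noteq> {}}"

definition minimal_pair :: "('v set \<Rightarrow>\<^sub>0 nat) \<Rightarrow> ('v set \<Rightarrow>\<^sub>0 nat) \<Rightarrow> bool" where
  "minimal_pair u w \<longleftrightarrow> u \<in> mon \<and> w \<in> mon \<and> edge_mono u = edge_mono w \<and> (u, w) \<notin> share\<^sup>*"

lemma share_degree: "(u, w) \<in> share\<^sup>* \<Longrightarrow> u \<in> mon \<Longrightarrow> w \<in> mon \<and> edge_mono w = edge_mono u"
  by (induction rule: rtrancl_induct) (auto simp: share_def)

lemma split_edge:
  assumes "u \<in> mon" "e \<in> keys u"
  obtains u' where "u' \<in> mon" "u = single e 1 + u'"
proof -
  define u' where "u' = u - single e 1"
  have "lookup u e \<ge> 1" using assms by (simp add: in_keys_iff Suc_le_eq)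
  then have "u = single e 1 + u'" unfolding u'_def
    by (intro poly_mapping_eqI) (auto simp: lookup_add lookup_minus lookup_single when_def)
  moreover have "keys u' \<subseteq> keys u" unfolding u'_def
    by (auto simp: in_keys_iff lookup_minus)
  ultimately show ?thesis using that assms unfolding mon_def by blast
qed

lemma share_split:
  assumes "(p, q) \<in> share"
  obtains e p' q' where "e \<in> E" "p' \<in> mon" "q' \<in> mon" "p = single e 1 + p'"
    "q = single e 1 + q'" "edge_mono p' = edge_mono q'"
proof -
  have pq: "p \<in> mon" "q \<in> mon" "edge_mono p = edge_mono q" using assms unfolding share_def by auto
  obtain e where e: "e \<in> keys p" "e \<in> keys q" using assms unfolding share_def by auto
  then have "e \<in> E" using pq unfolding mon_def by auto
  moreover obtain p' where "p' \<in> mon" "p = single e 1 + p'" using split_edge pq e by metis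
  moreover obtain q' where "q' \<in> mon" "q = single e 1 + q'" using split_edge pq e by metis
  ultimately show ?thesis using pq(3) by (intro that[of e p' q']) (auto simp: edge_mono_add)
qed

text \<open>Induction on the total vertex degree. The hypothesis covers every monomial of the
  smaller degree, not only divisors of \<open>x\<close>, because the edge may be removed from
  another monomial of the same fibre.\<close>

lemma edge_mono_induct:
  assumes step: "\<And>x. x \<in> mon \<Longrightarrow>
      (\<And>e y. e \<in> E \<Longrightarrow> y \<in> mon \<Longrightarrow> edge_mono x = edge_mono (single e 1) + edge_mono y \<Longrightarrow> P y) \<Longrightarrow> P x"
    and "x \<in> mon"
  shows "P x"
  using assms(2)
proof (induction "\<Sum>v\<in>\<Union>E. vdeg x v" arbitrary: x rule: less_induct)
  case less
  show ?case
  proof (rule step[OF less.prems])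
    fix e y assume ey: "e \<in> E" "y \<in> mon" "edge_mono x = edge_mono (single e 1) + edge_mono y"
    have fin: "finite (\<Union>E)" using finite_E finite_edge by auto
    obtain a b where ab: "a \<noteq> b" "e = {a, b}" using edgeE ey by metis
    have "(\<Sum>v\<in>\<Union>E. vdeg y v) < (\<Sum>v\<in>\<Union>E. vdeg x v)"
    proof (rule sum_strict_mono_ex1[OF fin])
      show "\<forall>v\<in>\<Union>E. vdeg y v \<le> vdeg x v" using ey(3) by (simp add: lookup_add)
      have "vdeg y a < vdeg x a" using ey vdeg_single_edge[of a b a] ab by (simp add: lookup_add)
      then show "\<exists>v\<in>\<Union>E. vdeg y v < vdeg x v" using ey ab by blast
    qed
    then show "P y" using less.hyps ey(2) by blast
  qed
qed

text \<open>If \<open>x\<close> and \<open>y\<close> lie in different components, they are the pair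
  sought. Otherwise some step of a chain between them is separated by \<open>f\<close>; its two
  monomials share an edge, and cancelling it lowers the degree.\<close>

lemma minimal_move:
  assumes "x \<in> mon" "y \<in> mon" "edge_mono x = edge_mono y" "weight f x \<noteq> weight f y"
  shows "\<exists>z w. minimal_pair z w \<and> weight f z \<noteq> weight f w \<and> (\<forall>v. vdeg z v \<le> vdeg x v)"
  using assms
proof (induction x arbitrary: y rule: edge_mono_induct)
  case (1 x)
  show ?case
  proof (cases "(x, y) \<in> share\<^sup>*")
    case False
    then show ?thesis using 1 unfolding minimal_pair_def by blast
  next
    case True
    have "\<exists>p q. (x, p) \<in> share\<^sup>* \<and> (p, q) \<in> share \<and> weight f p \<noteq> weight f q"
      using True 1(6)
    proof (induction rule: rtrancl_induct)
      case (step p q)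
      then show ?case by (cases "weight f x = weight f p") auto
    qed auto
    then obtain p q where pq: "(x, p) \<in> share\<^sup>*" "(p, q) \<in> share" "weight f p \<noteq> weight f q" by blast
    obtain e p' q' where s: "e \<in> E" "p' \<in> mon" "q' \<in> mon" "p = single e 1 + p'"
      "q = single e 1 + q'" "edge_mono p' = edge_mono q'" using share_split[OF pq(2)] by metis
    have x: "edge_mono x = edge_mono (single e 1) + edge_mono p'"
      using share_degree[OF pq(1) 1(1)] s by (simp add: edge_mono_add)
    have "weight f p' \<noteq> weight f q'" using pq(3) s by (simp add: weight_add)
    then obtain z w where "minimal_pair z w" "weight f z \<noteq> weight f w" "\<And>v. vdeg z v \<le> vdeg p' v"
      using 1(2)[OF s(1,2) x s(2,3,6)] by blast
    then show ?thesis using x by (metis lookup_add trans_le_add2)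
  qed
qed (use assms in auto)

text \<open>Double counting of incident pairs of vertex and edge: an edge of the support contributes
  \<open>g a + g b\<close> per occurrence, which is its value under \<open>f\<close>.\<close>

lemma weight_potential:
  assumes "u \<in> mon" "potential E f X g" "\<And>v. vdeg u v > 0 \<Longrightarrow> v \<in> X"
  shows "weight f u = (\<Sum>v\<in>\<Union>E. g v * real (vdeg u v))"
proof -
  have fin: "finite (\<Union>E)" using finite_E finite_edge by auto
  have "(\<Sum>v\<in>\<Union>E. g v * real (vdeg u v))
      = (\<Sum>v\<in>\<Union>E. \<Sum>e\<in>E. if v \<in> e then g v * real (lookup u e) else 0)"
    using finite_E by (simp add: vdeg_eq[OF assms(1)] sum_distrib_left sum.inter_filter if_distrib cong: if_cong)
  also have "\<dots> = (\<Sum>e\<in>E. \<Sum>v\<in>\<Union>E. if v \<in> e then g v * real (lookup u e) else 0)"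
    by (rule sum.swap)
  also have "\<dots> = (\<Sum>e\<in>E. f e * real (lookup u e))"
  proof (rule sum.cong[OF refl])
    fix e assume e: "e \<in> E"
    then obtain a b where ab: "a \<noteq> b" "e = {a, b}" using edgeE by metis
    have "(\<Sum>v\<in>\<Union>E. if v \<in> e then g v * real (lookup u e) else 0)
      = (\<Sum>v\<in>e. g v * real (lookup u e))"
      using fin e by (intro sum.mono_neutral_cong_right) auto
    also have "\<dots> = (g a + g b) * real (lookup u e)" using ab by (simp add: algebra_simps)
    also have "\<dots> = f e * real (lookup u e)"
    proof (cases "lookup u e = 0")
      case False
      have "vdeg u v > 0" if "v \<in> e" for v
        unfolding vdeg_eq[OF assms(1)] using that e False finite_E
        by (intro sum_pos2[of _ e]) auto
      then have "a \<in> X" "b \<in> X" using assms(3) ab by auto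
      then show ?thesis using potentialD[OF assms(2)] ab e by simp
    qed simp
    finally show "(\<Sum>v\<in>\<Union>E. if v \<in> e then g v * real (lookup u e) else 0)
      = f e * real (lookup u e)" .
  qed
  finally show ?thesis unfolding weight_def by simp
qed

lemma weight_potential_eq:
  assumes "u \<in> mon" "w \<in> mon" "edge_mono u = edge_mono w" "potential E f X g" "\<And>v. vdeg u v > 0 \<Longrightarrow> v \<in> X"
  shows "weight f u = weight f w"
  using weight_potential[OF assms(1,4,5)] weight_potential[OF assms(2,4)] assms(3,5) by simp

end

section \<open>Elimination\<close>

text \<open>Fraction-free Gaussian elimination, so that the same statement serves the coefficient
  field and the integers.\<close>

lemma homogeneous_system_solution:
  fixes a :: "'j \<Rightarrow> nat \<Rightarrow> 'r::idom"
  assumes "finite J" "n < card J"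
  shows "\<exists>c. (\<exists>j\<in>J. c j \<noteq> 0) \<and> (\<forall>l<n. (\<Sum>j\<in>J. c j * a j l) = 0)"
  using assms
proof (induction n arbitrary: J a)
  case 0
  then have "J \<noteq> {}" by auto
  then show ?case by (intro exI[of _ "\<lambda>_. 1"]) auto
next
  case (Suc n)
  show ?case
  proof (cases "\<forall>j\<in>J. a j n = 0")
    case True
    obtain c where c: "\<exists>j\<in>J. c j \<noteq> 0" "\<forall>l<n. (\<Sum>j\<in>J. c j * a j l) = 0"
      using Suc.IH[OF Suc.prems(1), of a] Suc.prems(2) by auto
    have "(\<Sum>j\<in>J. c j * a j n) = 0" using True by simp
    then show ?thesis using c less_Suc_eq by metis
  next
    case False
    then obtain i where i: "i \<in> J" "a i n \<noteq> 0" by auto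
    define K where "K = J - {i}"
    have K: "finite K" "n < card K" "i \<notin> K" "J = insert i K" using Suc.prems i unfolding K_def by auto
    \<comment> \<open>Unknown \<open>i\<close> is eliminated by means of equation \<open>n\<close>,
      cross-multiplying instead of dividing.\<close>
    define b where "b j l = a i n * a j l - a j n * a i l" for j l
    obtain c where c: "\<exists>j\<in>K. c j \<noteq> 0" "\<forall>l<n. (\<Sum>j\<in>K. c j * b j l) = 0"
      using Suc.IH[OF K(1,2), of b] by auto
    define d where "d j = (if j = i then - (\<Sum>j\<in>K. c j * a j n) else a i n * c j)" for j
    have dK: "d j = a i n * c j" if "j \<in> K" for j using that K(3) unfolding d_def by auto
    have "\<exists>j\<in>J. d j \<noteq> 0" using c(1) dK i K by force
    moreover have "(\<Sum>j\<in>J. d j * a j l) = 0" if "l < Suc n" for l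
    proof -
      have "(\<Sum>j\<in>J. d j * a j l) = d i * a i l + (\<Sum>j\<in>K. a i n * c j * a j l)"
        using K dK by simp
      also have "\<dots> = (\<Sum>j\<in>K. a i n * c j * a j l) - (\<Sum>j\<in>K. c j * a j n * a i l)"
        unfolding d_def by (simp add: sum_distrib_right)
      also have "\<dots> = (\<Sum>j\<in>K. c j * b j l)"
        unfolding b_def by (simp add: sum_subtractf[symmetric] algebra_simps)
      also have "\<dots> = 0"
      proof (cases "l = n")
        case True
        then show ?thesis unfolding b_def by (simp add: mult.commute)
      qed (use c(2) that in auto)
      finally show ?thesis .
    qed
    ultimately show ?thesis by blast
  qed
qed

section \<open>Pseudo-division and elimination modulo prime ideals\<close>

lemma coeff_mult_closed:
  fixes A :: "'r::comm_ring_1 set"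
  assumes "0 \<in> A" "\<And>a b. a \<in> A \<Longrightarrow> b \<in> A \<Longrightarrow> a + b \<in> A" "\<And>a b. a \<in> A \<Longrightarrow> b \<in> A \<Longrightarrow> a * b \<in> A"
    and "\<And>i. poly.coeff p i \<in> A" "\<And>i. poly.coeff q i \<in> A"
  shows "poly.coeff (p * q) i \<in> A"
proof -
  have "sum h S \<in> A" if "\<And>x. x \<in> S \<Longrightarrow> h x \<in> A" for h :: "nat \<Rightarrow> 'r" and S
    using that by (induction S rule: infinite_finite_induct) (auto intro: assms)
  from this[of "{..i}"] show ?thesis unfolding coeff_mult using assms(3-5) by simp
qed

text \<open>Division with remainder after multiplication by a power of the coefficient of
  \<open>F\<close> at \<open>d\<close>. The bounds \<open>d\<close> and \<open>n\<close> need not be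
  exact degrees. The top coefficient of the quotient is recorded so that it can later be shown to
  lie outside a prime ideal.\<close>

lemma pseudo_division:
  fixes F :: "'r::comm_ring_1 poly"
  assumes A: "0 \<in> A" "1 \<in> A" "\<And>a b. a \<in> A \<Longrightarrow> b \<in> A \<Longrightarrow> a + b \<in> A" "\<And>a b. a \<in> A \<Longrightarrow> b \<in> A \<Longrightarrow> a * b \<in> A"
      "\<And>a. a \<in> A \<Longrightarrow> - a \<in> A"
    and F: "\<And>i. poly.coeff F i \<in> A" "\<And>i. i > d \<Longrightarrow> poly.coeff F i = 0"
    and H: "\<And>i. poly.coeff H i \<in> A" "\<And>i. i > n \<Longrightarrow> poly.coeff H i = 0" and "d \<le> n"
  shows "\<exists>k q s. smult (poly.coeff F d ^ Suc k) H = q * F + s \<and> (\<forall>i. poly.coeff q i \<in> A) \<and> (\<forall>i. poly.coeff s i \<in> A)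
     \<and> (\<forall>i\<ge>d. poly.coeff s i = 0) \<and> (\<forall>i>n - d. poly.coeff q i = 0)
     \<and> poly.coeff q (n - d) = poly.coeff F d ^ k * poly.coeff H n"
  using assms(8-10)
proof (induction n arbitrary: H)
  case (0 H)
  define s where "s = smult (poly.coeff F d) H - smult (poly.coeff H 0) F"
  have d: "d = 0" using 0 by simp
  have "poly.coeff s i = 0" for i using 0(2) F(2) d unfolding s_def by (cases "i = 0") auto
  then have "s = 0" by (simp add: poly_eq_iff)
  then have "smult (poly.coeff F d ^ Suc 0) H = [:poly.coeff H 0:] * F + 0" unfolding s_def by simp
  then show ?case using 0(1) A d
    by (intro exI[of _ 0] exI[of _ "[:poly.coeff H 0:]"] exI[of _ 0]) (auto simp: coeff_pCons split: nat.split)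
next
  case (Suc n)
  define a where "a = poly.coeff H (Suc n)"
  define M where "M = monom a (Suc n - d)"
  define H1 where "H1 = smult (poly.coeff F d) H - M * F"
  have cM: "poly.coeff M i \<in> A" for i using Suc.prems(1) A(1) unfolding M_def a_def by simp
  have diff: "x - y \<in> A" if "x \<in> A" "y \<in> A" for x y using A(3)[OF that(1) A(5)[OF that(2)]] by simp
  have cH1: "poly.coeff H1 i \<in> A" for i
    unfolding H1_def using coeff_mult_closed[of A M F i] A F(1) Suc.prems(1) cM diff by simp
  have MF: "poly.coeff (M * F) i = (if Suc n - d \<le> i then a * poly.coeff F (i - (Suc n - d)) else 0)" for i
    unfolding M_def by (simp add: coeff_monom_mult)
  have zH1: "poly.coeff H1 i = 0" if "i > n" for i
  proof (cases "i = Suc n")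
    case True
    then show ?thesis unfolding H1_def using MF Suc.prems(3) by (simp add: a_def mult.commute)
  next
    case False
    then have "i > Suc n" using that by simp
    moreover from this have "i - (Suc n - d) > d" using Suc.prems(3) by simp
    ultimately show ?thesis unfolding H1_def using MF Suc.prems(2) F(2) by simp
  qed
  show ?case
  proof (cases "d = Suc n")
    case True
    have "smult (poly.coeff F d ^ Suc 0) H = M * F + H1" unfolding H1_def by simp
    then show ?thesis using cM cH1 zH1 True unfolding M_def
      by (intro exI[of _ 0] exI[of _ M] exI[of _ H1]) (auto simp: M_def a_def)
  next
    case False
    then have "d \<le> n" using Suc.prems(3) by simp
    then obtain k q s where IH: "smult (poly.coeff F d ^ Suc k) H1 = q * F + s" "\<forall>i. poly.coeff q i \<in> A" "\<forall>i. poly.coeff s i \<in> A"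
      "\<forall>i\<ge>d. poly.coeff s i = 0" "\<forall>i>n - d. poly.coeff q i = 0"
      using Suc.IH[of H1] cH1 zH1 by blast
    define q' where "q' = q + smult (poly.coeff F d ^ Suc k) M"
    have "smult (poly.coeff F d ^ Suc (Suc k)) H = smult (poly.coeff F d ^ Suc k) (H1 + M * F)"
      unfolding H1_def by (simp add: mult.commute)
    also have "\<dots> = q' * F + s" unfolding q'_def smult_add_right IH(1) by (simp add: algebra_simps)
    finally have 1: "smult (poly.coeff F d ^ Suc (Suc k)) H = q' * F + s" .
    have pw: "poly.coeff F d ^ m \<in> A" for m by (induction m) (auto intro: A F)
    have 2: "poly.coeff q' i \<in> A" for i unfolding q'_def using IH(2) cM pw A by (simp del: power_Suc)
    have 3: "poly.coeff q' i = 0" if "i > Suc n - d" for i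
      using that IH(5) unfolding q'_def M_def by (auto simp: coeff_monom)
    have 4: "poly.coeff q' (Suc n - d) = poly.coeff F d ^ Suc k * a"
      using IH(5) \<open>d \<le> n\<close> unfolding q'_def M_def by (simp add: Suc_diff_le)
    show ?thesis
      by (rule exI[of _ "Suc k"], rule exI[of _ q'], rule exI[of _ s]) (use 1 2 3 4 IH in \<open>auto simp: a_def\<close>)
  qed
qed

text \<open>Modulo \<open>P\<close>, a polynomial \<open>F\<close> of least degree with \<open>F(x)\<close> in \<open>Q - P\<close> would divide the annihilating polynomial \<open>H\<close> of
  least degree, and the quotient would annihilate \<open>x\<close> as well.\<close>
lemma elimination:
  fixes P Q C A :: "'r::comm_ring_1 set"
  assumes C: "\<And>a b. a \<in> C \<Longrightarrow> b \<in> C \<Longrightarrow> a + b \<in> C" "\<And>a b. a \<in> C \<Longrightarrow> b \<in> C \<Longrightarrow> a * b \<in> C"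
    and A: "0 \<in> A" "1 \<in> A" "\<And>a b. a \<in> A \<Longrightarrow> b \<in> A \<Longrightarrow> a + b \<in> A" "\<And>a b. a \<in> A \<Longrightarrow> b \<in> A \<Longrightarrow> a * b \<in> A"
      "\<And>a. a \<in> A \<Longrightarrow> - a \<in> A" "A \<subseteq> C"
    and P: "0 \<in> P" "\<And>a b. a \<in> P \<Longrightarrow> b \<in> P \<Longrightarrow> a + b \<in> P" "\<And>a r. a \<in> P \<Longrightarrow> r \<in> C \<Longrightarrow> r * a \<in> P"
      "\<And>a b. a \<in> C \<Longrightarrow> b \<in> C \<Longrightarrow> a * b \<in> P \<Longrightarrow> a \<in> P \<or> b \<in> P"
    and Q: "\<And>a b. a \<in> Q \<Longrightarrow> b \<in> Q \<Longrightarrow> a + b \<in> Q" "\<And>a r. a \<in> Q \<Longrightarrow> r \<in> C \<Longrightarrow> r * a \<in> Q"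
    and PQ: "P \<subseteq> Q" "A \<inter> Q \<subseteq> P" and x: "x \<in> C"
    and H: "\<And>i. poly.coeff H i \<in> A" "poly H x \<in> P" "lead_coeff H \<notin> P"
    and F: "\<And>i. poly.coeff F i \<in> A" "poly F x \<in> Q"
  shows "poly F x \<in> P"
proof (rule ccontr)
  assume "poly F x \<notin> P"
  have m1: "- 1 \<in> C" using A by blast
  have Pm: "- a \<in> P" if "a \<in> P" for a using P(3)[OF that m1] by simp
  have Qm: "- a \<in> Q" if "a \<in> Q" for a using Q(2)[OF that m1] by simp
  have Pd: "a - b \<in> P" if "a \<in> P" "b \<in> P" for a b using P(2)[OF that(1) Pm[OF that(2)]] by simp
  have Qd: "a - b \<in> Q" if "a \<in> Q" "b \<in> Q" for a b using Q(1)[OF that(1) Qm[OF that(2)]] by simp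
  have diff: "u - y \<in> A" if "u \<in> A" "y \<in> A" for u y using A(3)[OF that(1) A(5)[OF that(2)]] by simp
  have inC: "poly G x \<in> C" if "\<And>i. poly.coeff G i \<in> A" for G
    using that
  proof (induction G)
    case 0
    then show ?case using A by auto
  next
    case (pCons a G)
    have "poly.coeff G i \<in> A" for i using pCons.prems[of "Suc i"] by simp
    then have "poly G x \<in> C" using pCons.IH by blast
    moreover have "a \<in> C" using pCons.prems[of 0] A by auto
    ultimately show ?case using C x by simp
  qed
  have xp: "x ^ m \<in> C" for m using A by (induction m) (auto intro: C x)
  define good where "good G d \<longleftrightarrow> (\<forall>i. poly.coeff G i \<in> A) \<and> (\<forall>i>d. poly.coeff G i = 0) \<and> poly G x \<in> Q - P" for G d
  have "good F (degree F)" unfolding good_def using F \<open>poly F x \<notin> P\<close> by (auto simp: coeff_eq_0)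
  then have exd: "\<exists>d. \<exists>G. good G d" by blast
  define d where "d = (LEAST d. \<exists>G. good G d)"
  obtain G where G: "good G d" unfolding d_def using LeastI_ex[OF exd] by blast
  have mind: "\<not> good G' d'" if "d' < d" for G' d' using not_less_Least that unfolding d_def by blast
  have GA: "\<And>i. poly.coeff G i \<in> A" "\<And>i. i > d \<Longrightarrow> poly.coeff G i = 0" "poly G x \<in> Q" "poly G x \<notin> P"
    using G unfolding good_def by auto
  have small: "poly G' x \<in> P" if "\<And>i. poly.coeff G' i \<in> A" "\<And>i. i \<ge> d \<Longrightarrow> poly.coeff G' i = 0" "poly G' x \<in> Q" for G'
  proof (cases "d = 0")
    case True
    then have "G' = 0" using that(2) by (simp add: poly_eq_iff)
    then show ?thesis using P by simp
  next
    case False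
    then have "\<not> good G' (d - 1)" using mind by simp
    moreover have "poly.coeff G' i = 0" if "i > d - 1" for i using that \<open>\<And>i. i \<ge> d \<Longrightarrow> poly.coeff G' i = 0\<close> by simp
    ultimately show ?thesis using that unfolding good_def by blast
  qed
  define c where "c = poly.coeff G d"
  have cA: "c \<in> A" "c \<in> C" using GA(1) A unfolding c_def by auto
  \<comment> \<open>Otherwise dropping the top term leaves a polynomial of smaller degree whose
    value is still in \<open>Q\<close> but not in \<open>P\<close>.\<close>
  have cP: "c \<notin> P"
  proof
    assume "c \<in> P"
    define G' where "G' = G - monom c d"
    have cx: "c * x ^ d \<in> P" using P(3)[OF \<open>c \<in> P\<close> xp] by (simp add: mult.commute)
    then have "poly G' x \<in> Q" using GA(3) Qd PQ unfolding G'_def by (auto simp: poly_monom)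
    then have "poly G' x \<in> P"
      by (intro small) (use GA cA A diff in \<open>auto simp: G'_def c_def le_less\<close>)
    then have "poly G' x + c * x ^ d \<in> P" using cx P by blast
    then show False using GA(4) unfolding G'_def by (simp add: poly_monom)
  qed
  \<comment> \<open>A constant \<open>G\<close> would be an element of \<open>A\<close> in
    \<open>Q\<close>, hence in \<open>P\<close>.\<close>
  have d0: "d > 0"
  proof (rule ccontr)
    assume "\<not> d > 0"
    then have "G = [:c:]" using GA(2) unfolding c_def by (intro poly_eqI) (auto simp: coeff_pCons split: nat.split)
    then have "poly G x = c" by simp
    then show False using GA(3,4) cA PQ by auto
  qed
  define hgood where "hgood K n \<longleftrightarrow> (\<forall>i. poly.coeff K i \<in> A) \<and> (\<forall>i>n. poly.coeff K i = 0) \<and> poly K x \<in> P \<and> poly.coeff K n \<notin> P" for K n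
  have "hgood H (degree H)" unfolding hgood_def using H by (auto simp: coeff_eq_0)
  then have exn: "\<exists>n. \<exists>K. hgood K n" by blast
  define n where "n = (LEAST n. \<exists>K. hgood K n)"
  obtain K where K: "hgood K n" unfolding n_def using LeastI_ex[OF exn] by blast
  have minn: "\<not> hgood K' n'" if "n' < n" for K' n' using not_less_Least that unfolding n_def by blast
  have KA: "\<And>i. poly.coeff K i \<in> A" "\<And>i. i > n \<Longrightarrow> poly.coeff K i = 0" "poly K x \<in> P" "poly.coeff K n \<notin> P"
    using K unfolding hgood_def by auto
  define a where "a = poly.coeff K n"
  have aA: "a \<in> A" "a \<in> C" using KA(1) A unfolding a_def by auto
  show False
  proof (cases "n < d")
    case True
    \<comment> \<open>The annihilating polynomial \<open>K\<close> has the smaller degree and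
      cancels the top term of \<open>G\<close>, so \<open>a * poly G x\<close> falls into
      \<open>P\<close> by minimality of \<open>d\<close>.\<close>
    define G' where "G' = smult a G - monom c (d - n) * K"
    have cM: "poly.coeff (monom c (d - n) * K) i = (if d - n \<le> i then c * poly.coeff K (i - (d - n)) else 0)" for i
      by (simp add: coeff_monom_mult)
    have val: "poly G' x = a * poly G x - (c * x ^ (d - n)) * poly K x" unfolding G'_def by (simp add: poly_monom)
    have kP: "(c * x ^ (d - n)) * poly K x \<in> P" using P(3)[OF KA(3)] C(2)[OF cA(2) xp] by blast
    have "poly G' x \<in> P"
    proof (rule small)
      show "poly.coeff G' i \<in> A" for i unfolding G'_def using cM GA(1) KA(1) cA aA A diff by simp
      show "poly.coeff G' i = 0" if "i \<ge> d" for i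
      proof (cases "i = d")
        case True
        then show ?thesis unfolding G'_def using cM \<open>n < d\<close> by (simp add: a_def c_def mult.commute)
      next
        case False
        then have "i > d" "i - (d - n) > n" using that \<open>n < d\<close> by auto
        then show ?thesis unfolding G'_def using cM GA(2) KA(2) by simp
      qed
      show "poly G' x \<in> Q" unfolding val using Qd Q(2)[OF GA(3) aA(2)] kP PQ by blast
    qed
    then have "a * poly G x \<in> P" using P(2)[OF _ kP, of "poly G' x"] unfolding val by simp
    then show False using P(4)[OF aA(2) inC[OF GA(1)]] KA(4) GA(4) unfolding a_def by blast
  next
    case False
    then have dn: "d \<le> n" by simp
    obtain k q s where ps: "smult (c ^ Suc k) K = q * G + s" "\<forall>i. poly.coeff q i \<in> A" "\<forall>i. poly.coeff s i \<in> A"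
      "\<forall>i\<ge>d. poly.coeff s i = 0" "\<forall>i>n - d. poly.coeff q i = 0" "poly.coeff q (n - d) = c ^ k * a"
      using pseudo_division[OF A(1-5) GA(1,2) KA(1,2) dn] unfolding c_def a_def by blast
    have cp: "c ^ m \<in> C" for m using A cA by (induction m) (auto intro: C)
    have cpP: "c ^ m \<notin> P" for m
    proof (induction m)
      case 0
      then show ?case using P(3)[of 1 c] cP cA by auto
    next
      case (Suc m)
      then show ?case using P(4)[OF cA(2) cp] cP by auto
    qed
    have "poly (smult (c ^ Suc k) K) x = poly (q * G + s) x" using ps(1) by simp
    then have e: "c ^ Suc k * poly K x = poly q x * poly G x + poly s x" by simp
    have qC: "poly q x \<in> C" using inC ps(2) by blast
    have lP: "c ^ Suc k * poly K x \<in> P" by (rule P(3)[OF KA(3) cp])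
    have sval: "poly s x = c ^ Suc k * poly K x - poly q x * poly G x" using e by (simp add: algebra_simps)
    have "poly s x \<in> Q" unfolding sval using Qd lP PQ Q(2)[OF GA(3) qC] by blast
    then have sP: "poly s x \<in> P" using small[of s] ps(3,4) by blast
    have "poly q x * poly G x = c ^ Suc k * poly K x - poly s x" using e by (simp add: algebra_simps)
    then have "poly q x * poly G x \<in> P" using Pd[OF lP sP] by simp
    then have "poly q x \<in> P" using P(4)[OF qC inC[OF GA(1)]] GA(4) by blast
    moreover have "c ^ k * a \<notin> P" using P(4)[OF cp aA(2)] cpP KA(4) unfolding a_def by blast
    ultimately have "hgood q (n - d)" unfolding hgood_def using ps by metis
    then show False using minn[of "n - d"] d0 False by simp
  qed
qed

section \<open>The height of the toric ideal\<close>

lemma poly_mapping_sum_single: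
  "p = (\<Sum>\<alpha>\<in>keys p. single \<alpha> (lookup p \<alpha>))"
  by (intro poly_mapping_eqI) (auto simp: lookup_sum lookup_single when_def in_keys_iff)

lemma edge_map_add: "edge_map (p + q) = edge_map p + edge_map q"
  unfolding edge_map_def
  by (rule setsum_keys_plus_distrib[of "\<lambda>\<alpha> c. single (edge_mono \<alpha>) c"]) (simp_all add: single_add)

lemma edge_map_0 [simp]: "edge_map 0 = 0"
  by (simp add: edge_map_def)

lemma edge_map_diff: "edge_map (p - q) = edge_map p - edge_map q"
  using edge_map_add[of "p - q" q] by simp

lemma edge_map_sum: "edge_map (sum h S) = (\<Sum>x\<in>S. edge_map (h x))"
  by (induction S rule: infinite_finite_induct) (auto simp: edge_map_add)

lemma edge_map_single: "edge_map (single \<alpha> c) = single (edge_mono \<alpha>) c"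
  by (cases "c = 0") (auto simp: edge_map_def)

lemma edge_map_mult: "edge_map (p * q) = edge_map p * edge_map q"
proof -
  have "p * q = (\<Sum>\<alpha>\<in>keys p. \<Sum>\<beta>\<in>keys q.
      single (\<alpha> + \<beta>) (lookup p \<alpha> * lookup q \<beta>))"
    by (subst poly_mapping_sum_single[of p], subst poly_mapping_sum_single[of q])
      (simp add: sum_product mult_single)
  then show ?thesis
    unfolding edge_map_def[of p] edge_map_def[of q]
    by (simp add: edge_map_sum edge_map_single edge_mono_add sum_product mult_single)
qed

lemma lookup_edge_map:
  "lookup (edge_map p) b = (\<Sum>\<alpha>\<in>keys p. (lookup p \<alpha> when edge_mono \<alpha> = b))"
  unfolding edge_map_def by (simp add: lookup_sum lookup_single)

lemma edge_polys_0: "0 \<in> edge_polys T" and edge_polys_1: "1 \<in> edge_polys T"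
  unfolding edge_polys_def by auto

lemma edge_polys_single: "keys \<alpha> \<subseteq> T \<Longrightarrow> single \<alpha> c \<in> edge_polys T"
  unfolding edge_polys_def by auto

lemma edge_polys_add: "p \<in> edge_polys T \<Longrightarrow> q \<in> edge_polys T \<Longrightarrow> p + q \<in> edge_polys T"
  unfolding edge_polys_def using keys_add[of p q] by blast

lemma edge_polys_uminus: "p \<in> edge_polys T \<Longrightarrow> - p \<in> edge_polys T"
  unfolding edge_polys_def by (simp add: in_keys_iff)

lemma edge_polys_mult: "p \<in> edge_polys T \<Longrightarrow> q \<in> edge_polys T \<Longrightarrow> p * q \<in> edge_polys T"
proof -
  assume pq: "p \<in> edge_polys T" "q \<in> edge_polys T"
  have "keys \<gamma> \<subseteq> T" if "\<gamma> \<in> keys (p * q)" for \<gamma>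
  proof -
    obtain a b where ab: "\<gamma> = a + b" "a \<in> keys p" "b \<in> keys q"
      using keys_mult[of p q] \<open>\<gamma> \<in> _\<close> by blast
    then show ?thesis using pq keys_add[of a b] unfolding edge_polys_def by blast
  qed
  then show ?thesis unfolding edge_polys_def by blast
qed

lemma edge_polys_mono: "T \<subseteq> T' \<Longrightarrow> edge_polys T \<subseteq> edge_polys T'"
  unfolding edge_polys_def by blast

lemma edge_polys_sum: "(\<And>x. x \<in> S \<Longrightarrow> h x \<in> edge_polys T) \<Longrightarrow> sum h S \<in> edge_polys T"
  by (induction S rule: infinite_finite_induct) (auto intro: edge_polys_0 edge_polys_add)

section \<open>Ideals of the edge polynomial ring\<close>

lemma edge_poly_ring_simps [simp]:
  "carrier (edge_poly_ring T) = edge_polys T" "x \<otimes>\<^bsub>edge_poly_ring T\<^esub> y = x * y" "\<one>\<^bsub>edge_poly_ring T\<^esub> = 1"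
  "\<zero>\<^bsub>edge_poly_ring T\<^esub> = 0" "x \<oplus>\<^bsub>edge_poly_ring T\<^esub> y = x + y"
  by (simp_all add: edge_poly_ring_def)

lemma cring_edge_poly_ring: "cring (edge_poly_ring T :: (('v set \<Rightarrow>\<^sub>0 nat) \<Rightarrow>\<^sub>0 'k::field) ring)"
proof (rule cringI)
  show "abelian_group (edge_poly_ring T :: (('v set \<Rightarrow>\<^sub>0 nat) \<Rightarrow>\<^sub>0 'k::field) ring)"
  proof (rule abelian_groupI)
    show "\<exists>y\<in>carrier (edge_poly_ring T). y \<oplus>\<^bsub>edge_poly_ring T\<^esub> x = \<zero>\<^bsub>edge_poly_ring T\<^esub>"
      if "x \<in> carrier (edge_poly_ring T)" for x :: "('v set \<Rightarrow>\<^sub>0 nat) \<Rightarrow>\<^sub>0 'k"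
      using edge_polys_uminus[of x T] that by (intro bexI[of _ "- x"]) auto
  qed (auto simp: edge_polys_add edge_polys_0 ac_simps)
  show "comm_monoid (edge_poly_ring T :: (('v set \<Rightarrow>\<^sub>0 nat) \<Rightarrow>\<^sub>0 'k::field) ring)"
    by (rule comm_monoidI) (auto simp: edge_polys_mult edge_polys_1 mult.assoc mult.commute)
qed (auto simp: distrib_right)

lemma ideal_edge_poly_ringI:
  assumes "I \<subseteq> edge_polys T" "0 \<in> I" "\<And>a b. a \<in> I \<Longrightarrow> b \<in> I \<Longrightarrow> a + b \<in> I"
    "\<And>a r. a \<in> I \<Longrightarrow> r \<in> edge_polys T \<Longrightarrow> r * a \<in> I"
  shows "ideal I (edge_poly_ring T)"
proof (rule idealI)
  interpret cring "edge_poly_ring T" by (rule cring_edge_poly_ring)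
  show "ring (edge_poly_ring T)" by (rule ring_axioms)
  show "subgroup I (add_monoid (edge_poly_ring T))"
  proof (rule add.subgroupI)
    show "I \<subseteq> carrier (edge_poly_ring T)" "I \<noteq> {}" using assms(1,2) by auto
    fix a assume a: "a \<in> I"
    have "- 1 \<in> edge_polys T" using edge_polys_uminus edge_polys_1 by blast
    then have m: "- a \<in> I" using assms(4)[OF a, of "- 1"] by simp
    have "\<ominus>\<^bsub>edge_poly_ring T\<^esub> a = - a"
      using a assms(1) m by (intro minus_equality) auto
    then show "\<ominus>\<^bsub>edge_poly_ring T\<^esub> a \<in> I" using m by simp
  qed (use assms(3) in auto)
qed (use assms(4) in \<open>auto simp: mult.commute\<close>)

lemma primeideal_edge_polyD:
  assumes "primeideal P (edge_poly_ring T)"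
  shows "P \<subseteq> edge_polys T" "0 \<in> P" "a \<in> P \<Longrightarrow> b \<in> P \<Longrightarrow> a + b \<in> P"
    "a \<in> P \<Longrightarrow> r \<in> edge_polys T \<Longrightarrow> r * a \<in> P"
    "a \<in> edge_polys T \<Longrightarrow> b \<in> edge_polys T \<Longrightarrow> a * b \<in> P \<Longrightarrow> a \<in> P \<or> b \<in> P"
proof -
  interpret primeideal P "edge_poly_ring T" by (rule assms)
  show "P \<subseteq> edge_polys T" using a_subset by simp
  show "0 \<in> P" using additive_subgroup.zero_closed[OF is_additive_subgroup] by simp
  show "a \<in> P \<Longrightarrow> b \<in> P \<Longrightarrow> a + b \<in> P" using additive_subgroup.a_closed[OF is_additive_subgroup, of a b] by simp
  show "a \<in> P \<Longrightarrow> r \<in> edge_polys T \<Longrightarrow> r * a \<in> P" using I_l_closed[of a r] by simp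
  show "a \<in> edge_polys T \<Longrightarrow> b \<in> edge_polys T \<Longrightarrow> a * b \<in> P \<Longrightarrow> a \<in> P \<or> b \<in> P"
    using I_prime[of a b] by simp
qed

text \<open>The kernel of a ring homomorphism into a domain: the linear order on the vertices orders
  the exponents and thereby excludes zero divisors in the target.\<close>

lemma primeideal_toric:
  "primeideal (toric_ideal T :: (('v::linorder set \<Rightarrow>\<^sub>0 nat) \<Rightarrow>\<^sub>0 'k::field) set) (edge_poly_ring T)"
proof (rule primeidealI)
  show "ideal (toric_ideal T :: (('v::linorder set \<Rightarrow>\<^sub>0 nat) \<Rightarrow>\<^sub>0 'k::field) set) (edge_poly_ring T)"
    by (rule ideal_edge_poly_ringI)
      (auto simp: toric_ideal_def edge_polys_0 edge_polys_add edge_polys_mult edge_map_add edge_map_mult)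
  show "cring (edge_poly_ring T)" by (rule cring_edge_poly_ring)
  have "edge_map (1 :: ('v set \<Rightarrow>\<^sub>0 nat) \<Rightarrow>\<^sub>0 'k) = 1"
    using edge_map_single[of 0 1] by simp
  then have "1 \<notin> (toric_ideal T :: (('v::linorder set \<Rightarrow>\<^sub>0 nat) \<Rightarrow>\<^sub>0 'k::field) set)"
    unfolding toric_ideal_def by auto
  then show "carrier (edge_poly_ring T) \<noteq> (toric_ideal T :: (('v::linorder set \<Rightarrow>\<^sub>0 nat) \<Rightarrow>\<^sub>0 'k::field) set)"
    using edge_polys_1 by auto
qed (auto simp: toric_ideal_def edge_map_mult)

definition edge_var :: "'v set \<Rightarrow> (('v set \<Rightarrow>\<^sub>0 nat) \<Rightarrow>\<^sub>0 'k::field)" where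
  "edge_var e = single (single e 1) 1"

lemma edge_var_power: "edge_var e ^ n = single (single e n) 1"
  by (induction n) (auto simp: edge_var_def mult_single single_add[symmetric])

text \<open>Collecting powers of \<open>e\<close> brings elements of the ring over
  \<open>insert e T\<close> into the univariate form that \<open>elimination\<close>
  handles.\<close>

lemma edge_poly_univariate:
  assumes "p \<in> edge_polys (insert e T)"
  obtains F where "poly F (edge_var e) = p" "\<And>i. poly.coeff F i \<in> edge_polys T"
proof -
  define F where "F = (\<Sum>\<alpha>\<in>keys p. monom (single
    (\<alpha> - single e (lookup \<alpha> e)) (lookup p \<alpha>)) (lookup \<alpha> e))"
  have split: "\<alpha> - single e (lookup \<alpha> e) + single e (lookup \<alpha> e) = \<alpha>"
    for \<alpha> :: "'a set \<Rightarrow>\<^sub>0 nat"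
    by (intro poly_mapping_eqI) (auto simp: lookup_add lookup_minus lookup_single when_def)
  have "poly F (edge_var e) = (\<Sum>\<alpha>\<in>keys p. single \<alpha> (lookup p \<alpha>))"
    unfolding F_def by (simp add: poly_sum poly_monom edge_var_power mult_single split)
  then have "poly F (edge_var e) = p" using poly_mapping_sum_single[of p] by simp
  moreover have "poly.coeff F i \<in> edge_polys T" for i
  proof -
    have "keys (\<alpha> - single e (lookup \<alpha> e)) \<subseteq> T" if "\<alpha> \<in> keys p" for \<alpha>
    proof -
      have "keys \<alpha> \<subseteq> insert e T" using assms that unfolding edge_polys_def by auto
      moreover have "x \<noteq> e \<and> x \<in> keys \<alpha>"
        if "x \<in> keys (\<alpha> - single e (lookup \<alpha> e))" for x
        using that by (cases "x = e") (auto simp: in_keys_iff lookup_minus lookup_single when_def)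
      ultimately show ?thesis by blast
    qed
    then show ?thesis unfolding F_def coeff_sum
      by (intro edge_polys_sum) (auto simp: coeff_monom intro: edge_polys_0 edge_polys_single)
  qed
  ultimately show ?thesis using that by blast
qed

text \<open>A strictly smaller prime leaves room for one more independent variable. If each further
  variable satisfied a nontrivial relation over \<open>T\<close> modulo \<open>P\<close>, then
  \<open>elimination\<close>, applied to the variables one at a time, would give
  \<open>Q \<subseteq> P\<close>.\<close>

lemma independent_extend:
  fixes P Q :: "(('v set \<Rightarrow>\<^sub>0 nat) \<Rightarrow>\<^sub>0 'k::field) set"
  assumes P: "primeideal P (edge_poly_ring E)" and Q: "primeideal Q (edge_poly_ring E)" and PQ: "P \<subset> Q"
    and T: "finite E" "T \<subseteq> E" "edge_polys T \<inter> Q \<subseteq> {0}"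
  shows "\<exists>e\<in>E - T. edge_polys (insert e T) \<inter> P \<subseteq> {0}"
proof (rule ccontr)
  assume neg: "\<not> ?thesis"
  note p = primeideal_edge_polyD[OF P] and q = primeideal_edge_polyD[OF Q]
  have H: "\<exists>H. (\<forall>i. poly.coeff H i \<in> edge_polys T) \<and> poly H (edge_var e) \<in> P \<and> lead_coeff H \<notin> P" if eT: "e \<in> E - T" for e
  proof -
    obtain h where h: "h \<in> edge_polys (insert e T)" "h \<in> P" "h \<noteq> 0" using neg eT by blast
    obtain H where H: "poly H (edge_var e) = h" "\<And>i. poly.coeff H i \<in> edge_polys T"
      using edge_poly_univariate[OF h(1)] by metis
    have "H \<noteq> 0" using H(1) h(3) by auto
    then have "lead_coeff H \<noteq> 0" by simp
    then have "lead_coeff H \<notin> P" using T(3) H(2)[of "degree H"] PQ by blast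
    then show ?thesis using H h(2) by blast
  qed
  have "edge_polys (T \<union> S) \<inter> Q \<subseteq> P" if "finite S" "S \<subseteq> E - T" for S
    using that
  proof (induction S rule: finite_induct)
    case empty
    then show ?case using T(3) p(2) by auto
  next
    case (insert e S)
    then have IH: "edge_polys (T \<union> S) \<inter> Q \<subseteq> P" by blast
    show ?case
    proof
      fix f assume f: "f \<in> edge_polys (T \<union> insert e S) \<inter> Q"
      then have "f \<in> edge_polys (insert e (T \<union> S))" by simp
      then obtain F where F: "poly F (edge_var e) = f" "\<And>i. poly.coeff F i \<in> edge_polys (T \<union> S)"
        using edge_poly_univariate by metis
      obtain H where H: "\<And>i. poly.coeff H i \<in> edge_polys T" "poly H (edge_var e) \<in> P" "lead_coeff H \<notin> P"
        using H[of e] insert by blast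
      have H': "poly.coeff H i \<in> edge_polys (T \<union> S)" for i using H(1) edge_polys_mono[of T "T \<union> S"] by blast
      have e: "edge_var e \<in> edge_polys E" using insert unfolding edge_var_def by (intro edge_polys_single) auto
      have sub: "edge_polys (T \<union> S) \<subseteq> edge_polys E" using insert T(2) by (intro edge_polys_mono) auto
      have "poly F (edge_var e) \<in> P"
        by (rule elimination[OF edge_polys_add edge_polys_mult edge_polys_0 edge_polys_1 edge_polys_add edge_polys_mult
              edge_polys_uminus sub p(2,3,4,5) q(3,4) _ IH e H' H(2,3) F(2)])
          (use PQ f F(1) in auto)
      then show "f \<in> P" using F by simp
    qed
  qed
  from this[of "E - T"] have "edge_polys E \<inter> Q \<subseteq> P" using T by (simp add: Un_absorb1 Un_Diff_cancel)
  then show False using PQ q(1) by blast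
qed

text \<open>Descending a chain of primes from the toric ideal, each step adds a variable to the
  independent set \<open>S\<close>, and there are only \<open>card E\<close> variables.\<close>

lemma prime_height_toric:
  fixes E :: "'v::linorder set set"
  assumes "finite E" "S \<subseteq> E" "edge_polys S \<inter> (toric_ideal E :: (('v set \<Rightarrow>\<^sub>0 nat) \<Rightarrow>\<^sub>0 'k::field) set) \<subseteq> {0}"
  shows "ideal_height (edge_poly_ring E) (toric_ideal E :: (('v set \<Rightarrow>\<^sub>0 nat) \<Rightarrow>\<^sub>0 'k) set) \<le> enat (card E - card S)"
proof -
  let ?I = "toric_ideal E :: (('v set \<Rightarrow>\<^sub>0 nat) \<Rightarrow>\<^sub>0 'k) set"
  have "n \<le> card E - card S" if Q: "Q n = ?I" "\<forall>i\<le>n. primeideal (Q i) (edge_poly_ring E)" "\<forall>i<n. Q i \<subset> Q (Suc i)" for n Q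
  proof -
    have "\<exists>T\<subseteq>E. card T = card S + k \<and> edge_polys T \<inter> Q (n - k) \<subseteq> {0}" if "k \<le> n" for k
      using that
    proof (induction k)
      case 0
      then show ?case using assms Q(1) by auto
    next
      case (Suc k)
      then obtain T where T: "T \<subseteq> E" "card T = card S + k" "edge_polys T \<inter> Q (n - k) \<subseteq> {0}" by auto
      have k: "Suc (n - Suc k) = n - k" using Suc by simp
      have lt: "n - Suc k < n" using Suc by simp
      have "Q (n - Suc k) \<subset> Q (n - k)" using Q(3)[rule_format, OF lt] k by simp
      then obtain e where e: "e \<in> E - T" "edge_polys (insert e T) \<inter> Q (n - Suc k) \<subseteq> {0}"
        using independent_extend[of "Q (n - Suc k)" E "Q (n - k)" T] Q(2) assms(1) T by auto
      have "finite T" using T assms finite_subset by blast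
      then show ?case using e T by (intro exI[of _ "insert e T"]) auto
    qed
    from this[of n] obtain T where "T \<subseteq> E" "card T = card S + n" by auto
    then have "card S + n \<le> card E" using card_mono[OF assms(1), of T] by simp
    then show ?thesis by simp
  qed
  then have "prime_height (edge_poly_ring E) ?I \<le> enat (card E - card S)"
    unfolding prime_height_def by (intro Sup_least) auto
  moreover have "ideal_height (edge_poly_ring E) ?I \<le> prime_height (edge_poly_ring E) ?I"
    unfolding ideal_height_def by (rule Inf_lower) (use primeideal_toric in blast)
  ultimately show ?thesis by (rule order_trans[rotated])
qed

section \<open>Complete intersections\<close>

definition comp_sum :: "('a \<Rightarrow>\<^sub>0 nat) set \<Rightarrow> (('a \<Rightarrow>\<^sub>0 nat) \<Rightarrow>\<^sub>0 'k::field) \<Rightarrow> 'k" where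
  "comp_sum K p = (\<Sum>u\<in>keys p. (lookup p u when u \<in> K))"

lemma comp_sum_add: "comp_sum K (p + q) = comp_sum K p + comp_sum K q"
  unfolding comp_sum_def
  by (rule setsum_keys_plus_distrib[of "\<lambda>u c. c when u \<in> K"]) (simp_all add: when_add_distrib)

lemma comp_sum_0 [simp]: "comp_sum K 0 = 0"
  by (simp add: comp_sum_def)

lemma comp_sum_diff: "comp_sum K (p - q) = comp_sum K p - comp_sum K q"
  using comp_sum_add[of K "p - q" q] by simp

lemma comp_sum_sum: "comp_sum K (sum h S) = (\<Sum>x\<in>S. comp_sum K (h x))"
  by (induction S rule: infinite_finite_induct) (auto simp: comp_sum_add)

lemma comp_sum_single: "comp_sum K (single u c) = (c when u \<in> K)"
  by (cases "c = 0") (auto simp: comp_sum_def)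

text \<open>The combinations on the right form an ideal containing the generators, and
  \<open>genideal\<close> is the intersection of all such ideals.\<close>

lemma genideal_combination:
  assumes "set gs \<subseteq> edge_polys T" "p \<in> genideal (edge_poly_ring T) (set gs)"
  obtains r where "\<And>l. r l \<in> edge_polys T" "p = (\<Sum>l<length gs. r l * gs ! l)"
proof -
  define J where "J = {\<Sum>l<length gs. r l * gs ! l | r. \<forall>l. r l \<in> edge_polys T}"
  have "ideal J (edge_poly_ring T)"
  proof (rule ideal_edge_poly_ringI)
    have "gs ! l \<in> edge_polys T" if "l < length gs" for l using assms(1) that by auto
    then show "J \<subseteq> edge_polys T" unfolding J_def by (auto intro!: edge_polys_sum edge_polys_mult)
    show "0 \<in> J" unfolding J_def by (auto intro!: exI[of _ "\<lambda>_. 0"] edge_polys_0)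
    show "a + b \<in> J" if ab: "a \<in> J" "b \<in> J" for a b
    proof -
      obtain r where r: "\<forall>l. r l \<in> edge_polys T" "a = (\<Sum>l<length gs. r l * gs ! l)"
        using ab(1) unfolding J_def by blast
      obtain s where s: "\<forall>l. s l \<in> edge_polys T" "b = (\<Sum>l<length gs. s l * gs ! l)"
        using ab(2) unfolding J_def by blast
      have "a + b = (\<Sum>l<length gs. (r l + s l) * gs ! l)" using r s by (simp add: sum.distrib distrib_right)
      moreover have "\<forall>l. r l + s l \<in> edge_polys T" using r s edge_polys_add by blast
      ultimately show ?thesis unfolding J_def by (auto intro!: exI[of _ "\<lambda>l. r l + s l"])
    qed
    show "q * a \<in> J" if qa: "a \<in> J" "q \<in> edge_polys T" for a q
    proof -
      obtain r where r: "\<forall>l. r l \<in> edge_polys T" "a = (\<Sum>l<length gs. r l * gs ! l)"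
        using qa(1) unfolding J_def by blast
      have "q * a = (\<Sum>l<length gs. (q * r l) * gs ! l)" using r by (simp add: sum_distrib_left mult.assoc)
      moreover have "\<forall>l. q * r l \<in> edge_polys T" using r qa edge_polys_mult by blast
      ultimately show ?thesis unfolding J_def by (auto intro!: exI[of _ "\<lambda>l. q * r l"])
    qed
  qed
  moreover have "set gs \<subseteq> J"
  proof
    fix g assume "g \<in> set gs"
    then obtain i where i: "i < length gs" "g = gs ! i" by (auto simp: in_set_conv_nth)
    have "(\<Sum>l<length gs. (if l = i then 1 else 0) * gs ! l) = (\<Sum>l<length gs. if l = i then gs ! l else 0)"
      by (intro sum.cong) auto
    then have "g = (\<Sum>l<length gs. (if l = i then 1 else 0) * gs ! l)" using i by (simp add: sum.delta)
    then show "g \<in> J" unfolding J_def using edge_polys_0 edge_polys_1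
      by (auto intro!: exI[of _ "\<lambda>l. if l = i then 1 else 0"])
  qed
  ultimately have "p \<in> J" using assms(2) unfolding genideal_def by auto
  then show ?thesis using that unfolding J_def by blast
qed

context ugraph
begin

text \<open>Multiples of one edge variable lie in one component of their fibre, and over a whole fibre the
  coefficients of an element of the toric ideal sum up to zero.\<close>
lemma comp_sum_mult:
  assumes K: "K = share\<^sup>* `` {c}" "c \<in> mon"
    and g: "g \<in> (toric_ideal E :: (('v set \<Rightarrow>\<^sub>0 nat) \<Rightarrow>\<^sub>0 'k::field) set)" and r: "r \<in> edge_polys E"
  shows "comp_sum K (r * g) = lookup r 0 * comp_sum K g"
proof -
  have gm: "\<beta> \<in> mon" if "\<beta> \<in> keys g" for \<beta>
    using g that unfolding toric_ideal_def edge_polys_def mon_def by auto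
  have single: "comp_sum K (single \<alpha> d * g) = (d * comp_sum K g when \<alpha> = 0)" if \<alpha>: "\<alpha> \<in> mon" for \<alpha> d
  proof -
    have "single \<alpha> d * g = (\<Sum>\<beta>\<in>keys g. single (\<alpha> + \<beta>) (d * lookup g \<beta>))"
      by (subst poly_mapping_sum_single[of g]) (simp add: sum_distrib_left mult_single)
    then have *: "comp_sum K (single \<alpha> d * g)
        = d * (\<Sum>\<beta>\<in>keys g. (lookup g \<beta> when \<alpha> + \<beta> \<in> K))"
      by (simp add: comp_sum_sum comp_sum_single sum_distrib_left mult_when)
    show ?thesis
    proof (cases "\<alpha> = 0")
      case True
      then show ?thesis using * by (simp add: comp_sum_def)
    next
      case False
      then obtain e where e: "e \<in> keys \<alpha>" by fastforce
      have "(\<Sum>\<beta>\<in>keys g. (lookup g \<beta> when \<alpha> + \<beta> \<in> K)) = 0"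
      proof (cases "\<exists>\<beta>\<in>keys g. \<alpha> + \<beta> \<in> K")
        case True
        then obtain b where b: "b \<in> keys g" "\<alpha> + b \<in> K" by blast
        have "\<alpha> + \<beta> \<in> K \<longleftrightarrow> edge_mono \<beta> = edge_mono b" if "\<beta> \<in> keys g" for \<beta>
        proof
          assume "\<alpha> + \<beta> \<in> K"
          then have "edge_mono (\<alpha> + \<beta>) = edge_mono (\<alpha> + b)"
            using b share_degree K by (metis Image_singleton_iff)
          then show "edge_mono \<beta> = edge_mono b" by (simp add: edge_mono_add)
        next
          assume d: "edge_mono \<beta> = edge_mono b"
          have "e \<in> keys (\<alpha> + b)" "e \<in> keys (\<alpha> + \<beta>)"
            using e by (auto simp: in_keys_iff lookup_add)
          then have "(\<alpha> + b, \<alpha> + \<beta>) \<in> share" using gm[OF b(1)] gm[OF that] \<alpha> d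
            unfolding share_def by (auto simp: mon_add edge_mono_add)
          then show "\<alpha> + \<beta> \<in> K" using b K by (auto intro: rtrancl_into_rtrancl)
        qed
        then have "(\<Sum>\<beta>\<in>keys g. (lookup g \<beta> when \<alpha> + \<beta> \<in> K))
            = lookup (edge_map g) (edge_mono b)"
          unfolding lookup_edge_map by (intro sum.cong refl) auto
        also have "\<dots> = 0" using g unfolding toric_ideal_def by simp
        finally show ?thesis .
      next
        case False
        then show ?thesis by (intro sum.neutral) auto
      qed
      then show ?thesis using * False by simp
    qed
  qed
  have "r * g = (\<Sum>\<alpha>\<in>keys r. single \<alpha> (lookup r \<alpha>) * g)"
    by (subst poly_mapping_sum_single[of r]) (simp add: sum_distrib_right)
  then have "comp_sum K (r * g)
      = (\<Sum>\<alpha>\<in>keys r. (lookup r \<alpha> * comp_sum K g when \<alpha> = 0))"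
    using r single unfolding comp_sum_sum edge_polys_def mon_def by (simp add: comp_sum_sum)
  also have "\<dots> = lookup r 0 * comp_sum K g"
    by (cases "0 \<in> keys r") (auto simp: when_def in_keys_iff)
  finally show ?thesis .
qed

end

text \<open>\<open>f\<close> is dual to \<open>z - z'\<close> within a minimal system of binomials:
  it is zero on all the others. A binomial whose degree does not dominate that of \<open>z\<close>
  is generated by the others, which gives the second conclusion; the strict inequality at a single
  vertex \<open>v\<close> witnesses that the degree is not dominating.\<close>

theorem complete_intersection_dual:
  fixes E :: "'v::linorder set set"
  assumes "ugraph E" and ci: "complete_intersection TYPE('k::field) E" and zz: "ugraph.minimal_pair E z z'"
  obtains f :: "'v set \<Rightarrow> real" where "ugraph.weight E f z \<noteq> ugraph.weight E f z'"
    "\<And>x y v. x \<in> ugraph.mon E \<Longrightarrow> y \<in> ugraph.mon E \<Longrightarrow> edge_mono x = edge_mono y \<Longrightarrow> vdeg x v < vdeg z v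
      \<Longrightarrow> ugraph.weight E f x = ugraph.weight E f y"
proof -
  interpret ugraph E by fact
  let ?I = "toric_ideal E :: (('v set \<Rightarrow>\<^sub>0 nat) \<Rightarrow>\<^sub>0 'k) set"
  obtain gs :: "(('v set \<Rightarrow>\<^sub>0 nat) \<Rightarrow>\<^sub>0 'k) list" where gs: "set gs \<subseteq> edge_polys E"
    "genideal (edge_poly_ring E) (set gs) = ?I" "enat (length gs) = ideal_height (edge_poly_ring E) ?I"
    using ci unfolding complete_intersection_def by blast
  have gsI: "g \<in> ?I" if "g \<in> set gs" for g using gs that unfolding gs(2)[symmetric] genideal_def by auto
  \<comment> \<open>Algebraic independence of the edge variables in \<open>S\<close> modulo the
    toric ideal, in terms of monomials.\<close>
  define indep where "indep S \<longleftrightarrow> inj_on edge_mono {u. keys u \<subseteq> S}" for S :: "'v set set"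
  have "\<exists>S. S \<subseteq> E \<and> indep S \<and> (\<forall>S'. S' \<subseteq> E \<and> indep S' \<longrightarrow> card S' \<le> card S)"
  proof -
    define A where "A = {S. S \<subseteq> E \<and> indep S}"
    have fin: "finite A" unfolding A_def using finite_E by simp
    have "{} \<in> A" unfolding A_def indep_def by auto
    then have "Max (card ` A) \<in> card ` A" using fin by (intro Max_in) auto
    then obtain S where "S \<in> A" "card S = Max (card ` A)" by auto
    moreover have "card S' \<le> Max (card ` A)" if "S' \<in> A" for S' using fin that by simp
    ultimately show ?thesis unfolding A_def by auto
  qed
  then obtain S where S: "S \<subseteq> E" "indep S" "\<And>S'. S' \<subseteq> E \<Longrightarrow> indep S' \<Longrightarrow> card S' \<le> card S" by blast
  have finS: "finite S" using S finite_E finite_subset by blast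
  have "edge_polys S \<inter> ?I \<subseteq> {0}"
  proof
    fix p assume p: "p \<in> edge_polys S \<inter> ?I"
    have "lookup p \<alpha> = 0" for \<alpha>
    proof (rule ccontr)
      assume "lookup p \<alpha> \<noteq> 0"
      then have a: "\<alpha> \<in> keys p" by (simp add: in_keys_iff)
      have "lookup (edge_map p) (edge_mono \<alpha>) = (\<Sum>\<beta>\<in>keys p. (lookup p \<beta> when \<beta> = \<alpha>))"
        unfolding lookup_edge_map using S(2) p a unfolding indep_def inj_on_def edge_polys_def
        by (intro sum.cong refl) (auto simp: when_def)
      also have "\<dots> = lookup p \<alpha>" using a by (simp add: when_def)
      finally show False using p \<open>lookup p \<alpha> \<noteq> 0\<close> unfolding toric_ideal_def by simp
    qed
    then show "p \<in> {0}" by (simp add: poly_mapping_eqI)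
  qed
  then have len: "length gs \<le> card E - card S"
    using prime_height_toric[OF finite_E S(1)] gs(3) by (metis enat_ord_simps(1))
  \<comment> \<open>A representative of each component of \<open>share\<close>, with
    \<open>z\<close> and \<open>z'\<close> prescribed for their own components.\<close>
  define rep where "rep u = (if (z, u) \<in> share\<^sup>* then z else if (z', u) \<in> share\<^sup>* then z'
    else SOME w. (u, w) \<in> share\<^sup>*)" for u
  have z: "z \<in> mon" "z' \<in> mon" "edge_mono z = edge_mono z'" "(z, z') \<notin> share\<^sup>*"
    using zz unfolding minimal_pair_def by auto
  have ssym: "(u, w) \<in> share\<^sup>* \<Longrightarrow> (w, u) \<in> share\<^sup>*" for u w
  proof -
    have "sym share" unfolding share_def sym_def by auto
    then have "sym (share\<^sup>*)" by (rule sym_rtrancl)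
    then show "(u, w) \<in> share\<^sup>* \<Longrightarrow> (w, u) \<in> share\<^sup>*" by (meson symD)
  qed
  have rep1: "(u, rep u) \<in> share\<^sup>*" for u
    unfolding rep_def using ssym someI[of "\<lambda>w. (u, w) \<in> share\<^sup>*" u] by auto
  have rep2: "rep u = rep w" if "(u, w) \<in> share\<^sup>*" for u w
  proof -
    have "(v, u) \<in> share\<^sup>* \<longleftrightarrow> (v, w) \<in> share\<^sup>*" for v using that ssym rtrancl_trans by metis
    moreover have "(u, v) \<in> share\<^sup>* \<longleftrightarrow> (w, v) \<in> share\<^sup>*" for v using that ssym rtrancl_trans by metis
    ultimately show ?thesis unfolding rep_def by presburger
  qed
  have rep3: "rep u \<in> mon \<and> edge_mono (rep u) = edge_mono u" if "u \<in> mon" for u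
    using share_degree[OF rep1 that] .
  have repz: "rep z = z" "rep z' = z'" using z(4) unfolding rep_def by auto
  \<comment> \<open>One component in every fibre serves as base point; in the fibre of
    \<open>z\<close> it is that of \<open>z'\<close>.\<close>
  define root where "root b = (if b = edge_mono z then z' else rep (SOME u. u \<in> mon \<and> edge_mono u = b))"
    for b :: "'v \<Rightarrow>\<^sub>0 nat"
  have root: "root (edge_mono u) \<in> mon \<and> edge_mono (root (edge_mono u)) = edge_mono u \<and> rep (root (edge_mono u)) = root (edge_mono u)"
    if "u \<in> mon" for u
  proof (cases "edge_mono u = edge_mono z")
    case True
    then show ?thesis using z repz unfolding root_def by auto
  next
    case False
    define w where "w = (SOME w. w \<in> mon \<and> edge_mono w = edge_mono u)"
    have "w \<in> mon \<and> edge_mono w = edge_mono u" unfolding w_def using that by (rule_tac someI[of _ u]) auto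
    then show ?thesis using rep3[of w] rep2[OF rep1[of w]] False unfolding root_def w_def[symmetric] by auto
  qed
  \<comment> \<open>Each \<open>c\<close> in \<open>G\<close> stands for the minimal binomial \<open>c - root\<close>; the choices above make \<open>z - z'\<close> one of them.\<close>
  define G where "G = {c \<in> mon. rep c = c \<and> c \<noteq> root (edge_mono c)}"
  have zG: "z \<in> G" unfolding G_def root_def using z repz by auto
  have bound: "card F \<le> length gs" if F: "finite F" "F \<subseteq> G" for F
  proof (rule ccontr)
    assume "\<not> card F \<le> length gs"
    then have lt: "length gs < card F" by simp
    define p :: "('v set \<Rightarrow>\<^sub>0 nat) \<Rightarrow> (('v set \<Rightarrow>\<^sub>0 nat) \<Rightarrow>\<^sub>0 'k)" where
      "p c = single c 1 - single (root (edge_mono c)) 1" for c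
    have "\<exists>r. (\<forall>l. r l \<in> edge_polys E) \<and> p c = (\<Sum>l<length gs. r l * gs ! l)" if c: "c \<in> F" for c
    proof -
      have cm: "c \<in> mon" using c F unfolding G_def by auto
      have "p c \<in> edge_polys E" unfolding p_def diff_conv_add_uminus using cm root[OF cm]
        by (intro edge_polys_add edge_polys_uminus edge_polys_single) (auto simp: mon_def)
      moreover have "edge_map (p c) = 0" unfolding p_def using root[OF cm] by (simp add: edge_map_diff edge_map_single)
      ultimately have "p c \<in> genideal (edge_poly_ring E) (set gs)" unfolding gs(2) toric_ideal_def by simp
      then show ?thesis using genideal_combination[OF gs(1)] by metis
    qed
    then obtain r where r: "\<And>c l. c \<in> F \<Longrightarrow> r c l \<in> edge_polys E" "\<And>c. c \<in> F \<Longrightarrow> p c = (\<Sum>l<length gs. r c l * gs ! l)"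
      by metis
    \<comment> \<open>With more binomials than generators, some nontrivial combination of the
      binomials is written in the generators with coefficients that have no constant term. By
      \<open>comp_sum_mult\<close> every component sum of it vanishes, but over the component of
      \<open>d\<close> it equals \<open>mu d\<close>.\<close>
    obtain mu where mu: "\<exists>c\<in>F. mu c \<noteq> 0" "\<forall>l<length gs. (\<Sum>c\<in>F. mu c * lookup (r c l) 0) = 0"
      using homogeneous_system_solution[OF F(1) lt, of "\<lambda>c l. lookup (r c l) 0"] by blast
    obtain d where d: "d \<in> F" "mu d \<noteq> 0" using mu(1) by blast
    have dG: "d \<in> mon" "rep d = d" "d \<noteq> root (edge_mono d)" using d F unfolding G_def by auto
    define K where "K = share\<^sup>* `` {d}"
    have pc: "comp_sum K (p c) = (if c = d then 1 else 0)" if c: "c \<in> F" for c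
    proof -
      have cG: "c \<in> mon" "rep c = c" using c F unfolding G_def by auto
      have "c \<in> K \<longleftrightarrow> c = d" unfolding K_def using rep2[of d c] cG dG by auto
      moreover have "root (edge_mono c) \<notin> K"
      proof
        assume k: "root (edge_mono c) \<in> K"
        then have "root (edge_mono c) = d" using rep2[of d "root (edge_mono c)"] root[OF cG(1)] dG unfolding K_def by auto
        moreover from this have "edge_mono c = edge_mono d" using root[OF cG(1)] by metis
        ultimately show False using dG by metis
      qed
      ultimately show ?thesis unfolding p_def by (simp add: comp_sum_diff comp_sum_single)
    qed
    have "(\<Sum>c\<in>F. mu c * comp_sum K (p c)) = (\<Sum>c\<in>F. mu c * (\<Sum>l<length gs. lookup (r c l) 0 * comp_sum K (gs ! l)))"
    proof (intro sum.cong refl)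
      fix c assume c: "c \<in> F"
      have "comp_sum K (p c) = (\<Sum>l<length gs. comp_sum K (r c l * gs ! l))" using r(2)[OF c] by (simp add: comp_sum_sum)
      also have "\<dots> = (\<Sum>l<length gs. lookup (r c l) 0 * comp_sum K (gs ! l))"
        by (intro sum.cong refl comp_sum_mult[OF K_def dG(1)] gsI r(1)[OF c]) auto
      finally show "mu c * comp_sum K (p c) = mu c * (\<Sum>l<length gs. lookup (r c l) 0 * comp_sum K (gs ! l))" by simp
    qed
    also have "\<dots> = (\<Sum>l<length gs. \<Sum>c\<in>F. mu c * lookup (r c l) 0 * comp_sum K (gs ! l))"
      by (subst sum.swap) (simp add: sum_distrib_left mult.assoc)
    also have "\<dots> = (\<Sum>l<length gs. (\<Sum>c\<in>F. mu c * lookup (r c l) 0) * comp_sum K (gs ! l))"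
      by (simp add: sum_distrib_right)
    also have "\<dots> = 0" using mu(2) by (intro sum.neutral) simp
    finally have "(\<Sum>c\<in>F. mu c * comp_sum K (p c)) = 0" .
    moreover have "(\<Sum>c\<in>F. mu c * comp_sum K (p c)) = (\<Sum>c\<in>F. if c = d then mu c else 0)" using pc by (intro sum.cong) auto
    ultimately show False using d F by simp
  qed
  have finG: "finite G"
  proof (rule ccontr)
    assume "infinite G"
    then obtain F where "F \<subseteq> G" "finite F" "card F = Suc (length gs)" using infinite_arbitrarily_large by metis
    then show False using bound[of F] by simp
  qed
  have cardG: "card G \<le> card E - card S" using bound[OF finG] len by simp
  define G' where "G' = G - {z}"
  obtain cl where cl: "set cl = G'" "length cl = card G'"
    using finG unfolding G'_def by (metis finite_Diff finite_distinct_list distinct_card)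
  obtain sl where sl: "set sl = S" "length sl = card S"
    using finS by (metis finite_distinct_list distinct_card)
  \<comment> \<open>The equations for \<open>f\<close>: zero on all binomials except
    \<open>z - z'\<close>, and zero on the variables in \<open>S\<close>. There are
    \<open>card G - 1 + card S\<close> of them, fewer than the \<open>card E\<close>
    unknowns.\<close>
  define eqs :: "('v set \<Rightarrow> int) list" where
    "eqs = map (\<lambda>c e. int (lookup c e) - int (lookup (root (edge_mono c)) e)) cl
       @ map (\<lambda>s e. if e = s then 1 else 0) sl"
  have "card G > 0" using finG zG card_gt_0_iff by blast
  moreover have "card G' = card G - 1" unfolding G'_def using zG finG by simp
  ultimately have "length eqs < card E" unfolding eqs_def using cl sl cardG by simp
  then obtain f0 :: "'v set \<Rightarrow> int" where f0: "\<exists>e\<in>E. f0 e \<noteq> 0" "\<forall>l<length eqs. (\<Sum>e\<in>E. f0 e * (eqs ! l) e) = 0"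
    using homogeneous_system_solution[OF finite_E, of "length eqs" "\<lambda>e l. (eqs ! l) e"] by blast
  have eq: "(\<Sum>e\<in>E. f0 e * q e) = 0" if "q \<in> set eqs" for q using f0(2) that by (auto simp: in_set_conv_nth)
  define f where "f e = real_of_int (f0 e)" for e
  have fG: "weight f c = weight f (root (edge_mono c))" if "c \<in> G'" for c
  proof -
    have "(\<Sum>e\<in>E. f0 e * (int (lookup c e) - int (lookup (root (edge_mono c)) e))) = 0"
      by (rule eq) (use that cl in \<open>auto simp: eqs_def\<close>)
    then have "real_of_int (\<Sum>e\<in>E. f0 e * (int (lookup c e) - int (lookup (root (edge_mono c)) e))) = 0"
      by simp
    then have "(\<Sum>e\<in>E. f e * (real (lookup c e) - real (lookup (root (edge_mono c)) e))) = 0"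
      unfolding f_def by simp
    then show ?thesis unfolding weight_def by (simp add: algebra_simps sum_subtractf)
  qed
  have fS: "f e = 0" if "e \<in> S" for e
  proof -
    have "(\<Sum>x\<in>E. f0 x * (if x = e then 1 else 0)) = 0"
      by (rule eq) (use that sl in \<open>auto simp: eqs_def\<close>)
    then show ?thesis using that S(1) finite_E unfolding f_def by (auto simp: if_distrib[of "(*) _"] cong: if_cong)
  qed
  \<comment> \<open>\<open>D\<close> is a property of degrees that passes to summands. It is used
    for the degrees below that of \<open>z\<close> at one vertex, and for all degrees.\<close>
  have main: "\<forall>y\<in>mon. edge_mono x = edge_mono y \<longrightarrow> weight f x = weight f y"
    if "x \<in> mon" "D (edge_mono x)"
      and down: "\<And>a b. D (a + b) \<Longrightarrow> D b" and DG: "\<And>c. c \<in> G \<Longrightarrow> D (edge_mono c) \<Longrightarrow> weight f c = weight f (root (edge_mono c))"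
    for x D
    using that(1,2)
  proof (induction x rule: edge_mono_induct)
    case (1 x)
    have st: "weight f p = weight f q" if pq: "(p, q) \<in> share" "edge_mono p = edge_mono x" for p q
    proof -
      obtain e p' q' where s: "e \<in> E" "p' \<in> mon" "q' \<in> mon" "p = single e 1 + p'"
        "q = single e 1 + q'" "edge_mono p' = edge_mono q'" using share_split[OF pq(1)] by metis
      have x: "edge_mono x = edge_mono (single e 1) + edge_mono p'" using pq(2) s by (simp add: edge_mono_add)
      then have "weight f p' = weight f q'" using 1(2)[OF s(1,2) x s(2)] down 1 s by metis
      then show ?thesis using s by (simp add: weight_add)
    qed
    have ch: "weight f u = weight f w" if "(u, w) \<in> share\<^sup>*" "u \<in> mon" "edge_mono u = edge_mono x" for u w
      using that(1)
    proof (induction rule: rtrancl_induct)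
      case (step p q)
      then show ?case using st[OF step(2)] share_degree[OF step(1) that(2)] that(3) by simp
    qed simp
    have nf: "weight f u = weight f (root (edge_mono x))" if u: "u \<in> mon" "edge_mono u = edge_mono x" for u
    proof -
      have "weight f u = weight f (rep u)" using ch[OF rep1 u] .
      moreover have "weight f (rep u) = weight f (root (edge_mono x))"
      proof (cases "rep u = root (edge_mono x)")
        case False
        then have "rep u \<in> G" unfolding G_def using rep3[OF u(1)] rep2[OF rep1[of u]] u by auto
        then show ?thesis using DG rep3[OF u(1)] u 1 by metis
      qed simp
      ultimately show ?thesis by simp
    qed
    show ?case using nf 1 by metis
  qed (use that in auto)
  have part2: "weight f x = weight f y" if xy: "x \<in> mon" "y \<in> mon" "edge_mono x = edge_mono y" "vdeg x v < vdeg z v" for x y v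
  proof -
    have "weight f c = weight f (root (edge_mono c))" if "c \<in> G" "vdeg c v < vdeg z v" for c
    proof -
      have "c \<in> G'" using that unfolding G'_def by auto
      then show ?thesis by (rule fG)
    qed
    then have "\<forall>y\<in>mon. edge_mono x = edge_mono y \<longrightarrow> weight f x = weight f y"
      by (intro main[of x "\<lambda>b. lookup b v < vdeg z v"]) (use xy in \<open>auto simp only: lookup_add\<close>)
    then show ?thesis using xy by blast
  qed
  have part1: "weight f z \<noteq> weight f z'"
  proof
    assume eqz: "weight f z = weight f z'"
    have "weight f c = weight f (root (edge_mono c))" if "c \<in> G" for c
    proof (cases "c = z")
      case True
      then show ?thesis using eqz by (simp add: root_def)
    next
      case False
      then have "c \<in> G'" using that unfolding G'_def by auto
      then show ?thesis by (rule fG)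
    qed
    then have "\<forall>y\<in>mon. edge_mono x = edge_mono y \<longrightarrow> weight f x = weight f y" if "x \<in> mon" for x
      using that by (intro main[of x "\<lambda>_. True"] TrueI)
    then have all: "weight f x = weight f y" if "x \<in> mon" "y \<in> mon" "edge_mono x = edge_mono y" for x y
      using that by blast
    \<comment> \<open>By maximality of \<open>S\<close>, two distinct monomials over
      \<open>insert e S\<close> have equal degree. Their exponents of \<open>e\<close> differ, since
      otherwise cancelling \<open>e\<close> would contradict the independence of \<open>S\<close>.
      As \<open>f\<close> is zero on \<open>S\<close> and its weight is constant on fibres,
      \<open>f e = 0\<close>.\<close>
    have "f e = 0" if e: "e \<in> E" for e
    proof (cases "e \<in> S")
      case False
      have "\<not> indep (insert e S)"
        using S(3)[of "insert e S"] S(1) e False finS by auto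
      then obtain u w where uw: "keys u \<subseteq> insert e S" "keys w \<subseteq> insert e S"
        "edge_mono u = edge_mono w" "u \<noteq> w" unfolding indep_def inj_on_def by blast
      have wt: "weight f t = f e * real (lookup t e)" if "keys t \<subseteq> insert e S" for t
      proof -
        have "f x * real (lookup t x) = 0" if "x \<in> E - {e}" for x
        proof (cases "x \<in> S")
          case False
          then have "x \<notin> keys t" using \<open>keys t \<subseteq> insert e S\<close> that by blast
          then show ?thesis by (simp add: in_keys_iff)
        qed (simp add: fS)
        then have "(\<Sum>x\<in>E - {e}. f x * real (lookup t x)) = 0" by (rule sum.neutral[rule_format])
        then show ?thesis unfolding weight_def using finite_E e by (simp add: sum.remove[of E e])
      qed
      have "u \<in> mon" "w \<in> mon" using uw e S unfolding mon_def by auto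
      then have "f e * real (lookup u e) = f e * real (lookup w e)"
        using all[of u w] uw(3) wt[OF uw(1)] wt[OF uw(2)] by simp
      moreover have "lookup u e \<noteq> lookup w e"
      proof
        assume l: "lookup u e = lookup w e"
        define s where "s = single e (lookup u e)"
        have us: "u = s + (u - s)" "w = s + (w - s)" unfolding s_def using l
          by (auto intro!: poly_mapping_eqI simp: lookup_add lookup_minus lookup_single when_def)
        have "keys (t - s) \<subseteq> S"
          if t: "keys t \<subseteq> insert e S" "lookup t e = lookup u e" for t
        proof
          fix x assume x: "x \<in> keys (t - s)"
          then have "x \<noteq> e" using t(2) unfolding s_def by (auto simp: in_keys_iff lookup_minus)
          moreover have "x \<in> keys t" using x by (auto simp: in_keys_iff lookup_minus)
          ultimately show "x \<in> S" using t(1) by blast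
        qed
        then have "keys (u - s) \<subseteq> S" "keys (w - s) \<subseteq> S"
          using uw(1,2) l by simp_all
        moreover have "edge_mono (u - s) = edge_mono (w - s)"
          using uw(3) us edge_mono_add[of s "u - s"] edge_mono_add[of s "w - s"] by simp
        ultimately have "u - s = w - s" using S(2) unfolding indep_def inj_on_def by blast
        then show False using us uw(4) by metis
      qed
      ultimately show ?thesis by simp
    qed (use fS in auto)
    then show False using f0(1) unfolding f_def by auto
  qed
  show thesis using that part1 part2 by blast
qed

section \<open>Dumbbells\<close>

definition touch :: "'v set set \<Rightarrow> 'v set \<Rightarrow> 'v set \<Rightarrow> bool" where
  "touch E X Y \<longleftrightarrow> (\<exists>u\<in>X. \<exists>v\<in>Y. u = v \<or> {u, v} \<in> E)"

lemma touch_sym: "touch E X Y \<Longrightarrow> touch E Y X"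
  unfolding touch_def by (metis insert_commute)

lemma touch_mono: "touch E X Y \<Longrightarrow> X \<subseteq> X' \<Longrightarrow> Y \<subseteq> Y' \<Longrightarrow> touch E X' Y'"
  unfolding touch_def by blast

lemma last_exit:
  assumes "walk_from E X p us q" "p \<in> N" "q \<notin> N"
  obtains r ws where "r \<in> N" "walk_from E X r ws q" "set ws \<inter> N = {}" "ws \<noteq> []"
proof -
  have "\<exists>r ws. r \<in> N \<and> walk_from E X r ws q \<and> set ws \<inter> N = {} \<and> ws \<noteq> []"
    using assms
  proof (induction us arbitrary: p)
    case (Cons c us)
    show ?case
    proof (cases "\<exists>n\<in>set (c # us). n \<in> N")
      case True
      show ?thesis
      proof (cases "c \<in> N")
        case True
        then show ?thesis using Cons by auto
      next
        case False
        then obtain vs n ws where sp: "us = vs @ n # ws" "n \<in> N" "\<forall>w\<in>set ws. w \<notin> N"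
          using True split_list_last_prop[of us "\<lambda>n. n \<in> N"] by auto
        have "walk_from E X c ((vs @ [n]) @ ws) q" using Cons.prems(1) sp by simp
        then obtain b where "walk_from E X c (vs @ [n]) b" "walk_from E X b ws q"
          using walk_from_append by metis
        moreover from this(1) have "b = n" using walk_from_ends by fastforce
        moreover have "ws \<noteq> []" using calculation sp(2) Cons.prems(3) by (cases ws) auto
        ultimately show ?thesis using sp by blast
      qed
    next
      case False
      then show ?thesis using Cons.prems by (intro exI[of _ p] exI[of _ "c # us"]) auto
    qed
  qed auto
  then show ?thesis using that by blast
qed

lemma count_list_pos: "n \<le> count_list l v \<Longrightarrow> 0 < n \<Longrightarrow> v \<in> set l"
  using count_list_0_iff[of l v] by auto

context ugraph
begin

lemma potential_zero_alt: "potential E f X (\<lambda>_. 0) \<Longrightarrow> walk_from E X a xs b \<Longrightarrow> alt_sum f a xs = 0"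
  using alt_sum_potential by fastforce

lemma minimal_move_walk:
  assumes "walk_from E X a xs a" "even (length xs)" "alt_sum f a xs \<noteq> 0"
  obtains z w where "minimal_pair z w" "weight f z \<noteq> weight f w" "\<And>v. vdeg z v \<le> count_list xs v"
proof -
  have "weight f (half_walk True a xs) \<noteq> weight f (half_walk False a xs)"
    using weight_half_walk[OF assms(1), of f] assms(3) by simp
  then show ?thesis
    using minimal_move[OF half_walk_mon[OF assms(1)] half_walk_mon[OF assms(1)] even_closed_halves(1)[OF assms(1,2)]]
      even_closed_halves(2)[OF assms(1,2)] that by metis
qed

text \<open>On a fibre the number of edges between \<open>x\<close> and \<open>A\<close> has constant parity. The halves of the dumbbell differ in this
  number, so some minimal binomial changes it by at least two.\<close>
lemma dumbbell:
  assumes x: "x \<notin> A" and w1: "walk_from E X x (ys @ [x]) x" "even (length ys)" "set ys \<subseteq> A"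
    and w2: "odd_closed E X x zs" "set zs \<inter> A = {}"
    and sep: "\<forall>u\<in>A. \<forall>v\<in>set zs. v \<noteq> x \<longrightarrow> {u, v} \<notin> E"
  obtains z w where "minimal_pair z w" "\<And>v. vdeg z v \<le> count_list (ys @ x # zs) v" "2 \<le> vdeg z x"
    "\<forall>y. (\<forall>u\<in>A. {x, u} \<in> E \<longrightarrow> u = y) \<longrightarrow> 2 \<le> vdeg z y"
proof -
  \<comment> \<open>The indicator of the edges between \<open>x\<close> and \<open>A\<close>; its
    weight counts crossings with multiplicity.\<close>
  define jw where "jw e = (if \<exists>u\<in>A. e = {x, u} then 1 else 0 :: real)" for e
  define S where "S = insert x (set ys \<union> set zs)"
  have SA: "S \<subseteq> A \<union> insert x (set zs)" unfolding S_def using w1(3) by auto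
  have xA: "{p, q} \<noteq> {x, u}" if "p \<in> A" "q \<in> A" for p q u using that x by (auto simp: doubleton_eq_iff)
  have pA: "potential E jw A (\<lambda>_. 0)" unfolding potential_def jw_def using xA by auto
  have pZ: "potential E jw (insert x (set zs)) (\<lambda>_. 0)"
    unfolding potential_def jw_def using w2(2) x by (auto simp: doubleton_eq_iff)
  have w2': "walk_from E X x zs x" "odd (length zs)" using w2(1) unfolding odd_closed_def by auto
  have "walk_from E (insert x (set zs)) x zs x" by (rule walk_from_restrict[OF w2'(1)]) simp
  then have a2: "alt_sum jw x zs = 0" using potential_zero_alt[OF pZ] by blast
  have "ys \<noteq> []" using w1(1) no_loop by auto
  then obtain c ys' where ys: "ys = c # ys'" by (cases ys) auto
  have cx: "{x, c} \<in> E" "walk_from E X c (ys' @ [x]) x" using w1(1) ys by auto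
  then obtain d where d: "walk_from E X c ys' d" "{d, x} \<in> E" using walk_from_append by force
  have wA: "walk_from E A c ys' d" using w1(3) ys by (intro walk_from_restrict[OF d(1)]) auto
  have "alt_sum jw x (ys @ [x]) = jw {x, c} - (alt_sum jw c ys' + (-1) ^ length ys' * jw {d, x})"
    unfolding ys using alt_sum_append[OF d(1), of jw "[x]"] by simp
  moreover have "alt_sum jw c ys' = 0" using potential_zero_alt[OF pA wA] .
  moreover have "jw {x, c} = 1" using w1(3) ys unfolding jw_def by auto
  moreover have "jw {d, x} = 1" using walk_from_ends[OF wA] unfolding jw_def by (auto simp: insert_commute)
  moreover have "odd (length ys')" using w1(2) ys by simp
  ultimately have a1: "alt_sum jw x (ys @ [x]) = 2" by simp
  have W: "walk_from E X x ((ys @ [x]) @ zs) x" by (rule walk_from_appendI[OF w1(1) w2'(1)])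
  \<comment> \<open>Only the first and the last edge of the walk through \<open>A\<close> cross, and
    both fall into the same half because \<open>ys\<close> has even length.\<close>
  have "alt_sum jw x ((ys @ [x]) @ zs) = 2"
    using alt_sum_append[OF w1(1), of jw zs] a1 a2 by simp
  moreover have "even (length ((ys @ [x]) @ zs))" using w1(2) w2'(2) by simp
  ultimately obtain z w where zw: "minimal_pair z w" "weight jw z \<noteq> weight jw w" "\<And>v. vdeg z v \<le> count_list ((ys @ [x]) @ zs) v"
    using minimal_move_walk[OF W] by (metis zero_neq_numeral)
  have m: "z \<in> mon" "w \<in> mon" "edge_mono z = edge_mono w" using zw(1) unfolding minimal_pair_def by auto
  define D where "D = {e\<in>E. \<exists>u\<in>A. e = {x, u}}"
  define N where "N t = (\<Sum>e\<in>D. lookup t e)" for t :: "'v set \<Rightarrow>\<^sub>0 nat"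
  have finD: "finite D" unfolding D_def using finite_E by simp
  have N: "weight jw t = real (N t)" for t
    unfolding weight_def N_def D_def jw_def using finite_E
    by (simp add: sum.inter_filter if_distrib[of "\<lambda>c. c * _"] if_distrib[of real] cong: if_cong)
  have sup: "v \<in> S" if "vdeg z v > 0" for v
  proof -
    have "v \<in> set ((ys @ [x]) @ zs)" using count_list_pos[OF zw(3) that] .
    then show ?thesis unfolding S_def by auto
  qed
  define B where "B = A \<inter> \<Union>E"
  have finB: "finite B" unfolding B_def using finite_E finite_edge by auto
  \<comment> \<open>Summing degrees over \<open>A\<close> counts crossing edges once and edges
    inside \<open>A\<close> twice; no other edge of the support meets \<open>A\<close>.\<close>
  have par: "even (\<Sum>v\<in>B. vdeg t v) = even (N t)" if t: "t \<in> mon" "\<And>v. vdeg t v > 0 \<Longrightarrow> v \<in> S" for t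
  proof -
    have "(\<Sum>v\<in>B. vdeg t v) = (\<Sum>v\<in>B. \<Sum>e\<in>E. if v \<in> e then lookup t e else 0)"
      using finite_E by (simp add: vdeg_eq[OF t(1)] sum.inter_filter)
    also have "\<dots> = (\<Sum>e\<in>E. \<Sum>v\<in>B. if v \<in> e then lookup t e else 0)" by (rule sum.swap)
    also have "\<dots> = (\<Sum>e\<in>E. (if e \<in> D then lookup t e else 0) + 2 * (if e \<subseteq> A then lookup t e else 0))"
    proof (rule sum.cong[OF refl])
      fix e assume e: "e \<in> E"
      obtain p q where pq: "p \<noteq> q" "e = {p, q}" using edgeE[OF e] by metis
      have "(\<Sum>v\<in>B. if v \<in> e then lookup t e else 0) = (\<Sum>v\<in>e \<inter> A. lookup t e)"
        using finB e pq by (intro sum.mono_neutral_cong_right) (auto simp: B_def)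
      also have "\<dots> = card (e \<inter> A) * lookup t e" by simp
      also have "\<dots> = (if e \<in> D then lookup t e else 0) + 2 * (if e \<subseteq> A then lookup t e else 0)"
      proof (cases "lookup t e = 0")
        case False
        have "vdeg t v > 0" if "v \<in> e" for v
          unfolding vdeg_eq[OF t(1)] using that e False finite_E by (intro sum_pos2[of _ e]) auto
        then have pS: "p \<in> S" "q \<in> S" using t(2) pq by auto
        have key: "b = x" if "a \<in> A" "b \<notin> A" "{a, b} \<in> E" "b \<in> S" for a b
          using sep that SA by blast
        consider "p \<in> A" "q \<in> A" | "p \<in> A" "q \<notin> A" | "p \<notin> A" "q \<in> A" | "p \<notin> A" "q \<notin> A" by blast
        then show ?thesis
        proof cases
          case 1
          then have "e \<notin> D" "e \<subseteq> A" "e \<inter> A = {p, q}" using xA pq unfolding D_def by auto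
          then show ?thesis using pq by simp
        next
          case 2
          then have "q = x" using key[of p q] e pq pS by auto
          then have "e \<in> D" "\<not> e \<subseteq> A" "e \<inter> A = {p}" using 2 e pq unfolding D_def by (auto simp: insert_commute)
          then show ?thesis by simp
        next
          case 3
          have "{q, p} \<in> E" using e pq by (simp add: insert_commute)
          then have "p = x" using key[of q p] pS 3 by auto
          then have "e \<in> D" "\<not> e \<subseteq> A" "e \<inter> A = {q}" using 3 e pq unfolding D_def by auto
          then show ?thesis by simp
        next
          case 4
          then have "e \<notin> D" "\<not> e \<subseteq> A" "e \<inter> A = {}" using pq unfolding D_def by (auto simp: doubleton_eq_iff)
          then show ?thesis by simp
        qed
      qed simp
      finally show "(\<Sum>v\<in>B. if v \<in> e then lookup t e else 0)
        = (if e \<in> D then lookup t e else 0) + 2 * (if e \<subseteq> A then lookup t e else 0)" .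
    qed
    also have "\<dots> = (\<Sum>e\<in>E. if e \<in> D then lookup t e else 0) + 2 * (\<Sum>e\<in>E. if e \<subseteq> A then lookup t e else 0)"
      by (simp add: sum.distrib sum_distrib_left)
    also have "(\<Sum>e\<in>E. if e \<in> D then lookup t e else 0) = N t"
      unfolding N_def using finite_E by (intro sum.mono_neutral_cong_right) (auto simp: D_def)
    finally show ?thesis by simp
  qed
  have "N z \<noteq> N w" using zw(2) N by simp
  moreover have "even (N z) = even (N w)" using par[of z] par[of w] m sup by simp
  \<comment> \<open>Of two distinct numbers of equal parity, the larger is at least two.\<close>
  ultimately have "2 \<le> N z \<or> 2 \<le> N w" by (cases "N z"; cases "N w") (auto, presburger+)
  then obtain t where t: "t \<in> mon" "edge_mono t = edge_mono z" "2 \<le> N t" using m by metis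
  have Nle: "N t \<le> vdeg z v" if "\<And>e. e \<in> D \<Longrightarrow> v \<in> e" for v
  proof -
    have "N t \<le> vdeg t v" unfolding N_def vdeg_eq[OF t(1)] using that finite_E
      by (intro sum_mono2) (auto simp: D_def)
    then show ?thesis using t(2) by simp
  qed
  show thesis
  proof (rule that[OF zw(1)])
    show "vdeg z v \<le> count_list (ys @ x # zs) v" for v using zw(3)[of v] by simp
    have "x \<in> e" if "e \<in> D" for e using that unfolding D_def by auto
    then show "2 \<le> vdeg z x" using t(3) Nle[of x] by simp
    show "\<forall>y. (\<forall>u\<in>A. {x, u} \<in> E \<longrightarrow> u = y) \<longrightarrow> 2 \<le> vdeg z y"
    proof (intro allI impI)
      fix y assume u: "\<forall>u\<in>A. {x, u} \<in> E \<longrightarrow> u = y"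
      have "y \<in> e" if "e \<in> D" for e using that u unfolding D_def by auto
      then show "2 \<le> vdeg z y" using t(3) Nle[of y] by simp
    qed
  qed
qed

text \<open>Here \<open>r\<close> is the last vertex in or next to the first walk on the way to the second one.\<close>
lemma nontouching_dumbbell:
  assumes c: "conn E X" and xs: "odd_closed E X a xs" and ys: "odd_closed E X b ys" and nt: "\<not> touch E (set xs) (set ys)"
  obtains r z w where "minimal_pair z w" "\<And>v. vdeg z v > 0 \<Longrightarrow> v \<in> X" "r \<in> X" "r \<notin> set xs" "\<exists>y\<in>set xs. {r, y} \<in> E"
    "2 \<le> vdeg z r" "\<forall>y. (\<forall>u\<in>set xs. {r, u} \<in> E \<longrightarrow> u = y) \<longrightarrow> 2 \<le> vdeg z y"
proof -
  define A where "A = set xs"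
  \<comment> \<open>The closed neighbourhood of the first walk. After the last vertex
    \<open>r\<close> in it, the way to the second walk has no further edge to \<open>A\<close>, as
    \<open>dumbbell\<close> demands.\<close>
  define N where "N = A \<union> {v. \<exists>u\<in>A. {u, v} \<in> E}"
  have aA: "a \<in> A" "b \<in> set ys" using odd_closed_nonempty[OF xs] odd_closed_nonempty[OF ys] unfolding A_def by auto
  have AX: "A \<subseteq> X" "a \<in> X" "b \<in> X" using xs ys walk_from_ends unfolding odd_closed_def A_def by metis+
  have ysN: "v \<notin> N" if "v \<in> set ys" for v using nt that unfolding touch_def N_def A_def by auto
  obtain us where us: "walk_from E X a us b" using c AX unfolding conn_def by blast
  obtain r ws where r: "r \<in> N" "walk_from E X r ws b" "set ws \<inter> N = {}" "ws \<noteq> []"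
    using last_exit[OF us, of N] aA ysN unfolding N_def by blast
  have rA: "r \<notin> A"
  proof
    assume rA: "r \<in> A"
    obtain c ws' where ws: "ws = c # ws'" using r(4) by (cases ws) auto
    then have "{r, c} \<in> E" using r(2) by simp
    then have "c \<in> N" using rA unfolding N_def by blast
    then show False using r(3) ws by auto
  qed
  then obtain y where y: "y \<in> A" "{y, r} \<in> E" using r(1) unfolding N_def by blast
  have rX: "r \<in> X" using r(2) walk_from_ends by metis
  obtain xs' where xs': "odd_closed E X y xs'" "mset xs' = mset xs"
    using odd_closed_rotate[OF xs, of y] y unfolding A_def by blast
  have sx: "set xs' = A" using xs'(2) unfolding A_def by (metis set_mset_mset)
  have W1: "walk_from E X r ((y # xs') @ [r]) r"
  proof -
    have "walk_from E X y (xs' @ [r]) r" using xs'(1) y rX unfolding odd_closed_def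
      by (intro walk_from_appendI[of E X y xs' y]) (use AX(1) in auto)
    then show ?thesis using y rX by (simp add: insert_commute)
  qed
  define zs where "zs = ws @ ys @ rev_walk r ws"
  have W2: "odd_closed E X r zs"
    unfolding odd_closed_def zs_def using r(2) ys walk_from_rev[OF r(2)] unfolding odd_closed_def
    by (auto intro!: walk_from_appendI)
  have szs: "set zs \<subseteq> insert r (set ws \<union> set ys)" unfolding zs_def using set_rev_walk[of r ws] by auto
  have zN: "v \<notin> N" if "v \<in> set zs" "v \<noteq> r" for v using szs that ysN r(3) by auto
  have zA: "set zs \<inter> A = {}" using zN rA unfolding N_def by blast
  have sep: "\<forall>u\<in>A. \<forall>v\<in>set zs. v \<noteq> r \<longrightarrow> {u, v} \<notin> E" using zN unfolding N_def by blast
  have ev: "even (length (y # xs'))" using xs'(1) unfolding odd_closed_def by simp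
  have sA: "set (y # xs') \<subseteq> A" using sx y by auto
  obtain z w where zw: "minimal_pair z w" "\<And>v. vdeg z v \<le> count_list ((y # xs') @ r # zs) v" "2 \<le> vdeg z r"
    "\<forall>y. (\<forall>u\<in>A. {r, u} \<in> E \<longrightarrow> u = y) \<longrightarrow> 2 \<le> vdeg z y"
    using dumbbell[OF rA W1 ev sA W2 zA sep] by metis
  have "v \<in> X" if "vdeg z v > 0" for v
  proof -
    have "v \<in> set ((y # xs') @ r # zs)" using count_list_pos[OF zw(2) that] .
    moreover have "set zs \<subseteq> X" using W2 walk_from_ends unfolding odd_closed_def by metis
    ultimately show ?thesis using sA AX rX by auto
  qed
  moreover have "\<exists>y\<in>set xs. {r, y} \<in> E" using y unfolding A_def by (metis insert_commute)
  ultimately show ?thesis using that[OF zw(1) _ rX _ _ zw(3)] zw(4) rA unfolding A_def by blast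
qed

end

text \<open>What the graph theory needs of the complete intersection property: every minimal
  binomial has a dual edge weighting. Neither the field nor the polynomial ring occurs in this
  form.\<close>

locale ci_graph = ugraph +
  assumes dual: "minimal_pair z w \<Longrightarrow> \<exists>f. weight f z \<noteq> weight f w \<and>
    (\<forall>x\<in>mon. \<forall>y\<in>mon. \<forall>v. edge_mono x = edge_mono y \<longrightarrow> vdeg x v < vdeg z v \<longrightarrow> weight f x = weight f y)"
begin

text \<open>The halves of an even closed walk form a binomial whose degree counts the visits, so the
  duality turns into a statement on walks.\<close>

lemma killer:
  assumes "minimal_pair z w"
  obtains f where "weight f z \<noteq> weight f w"
    "\<And>X a xs v. walk_from E X a xs a \<Longrightarrow> even (length xs) \<Longrightarrow> count_list xs v < vdeg z v \<Longrightarrow> alt_sum f a xs = 0"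
proof -
  obtain f where f: "weight f z \<noteq> weight f w"
    "\<And>x y v. x \<in> mon \<Longrightarrow> y \<in> mon \<Longrightarrow> edge_mono x = edge_mono y \<Longrightarrow> vdeg x v < vdeg z v \<Longrightarrow> weight f x = weight f y"
    using dual[OF assms] by blast
  have "alt_sum f a xs = 0" if w: "walk_from E X a xs a" "even (length xs)" "count_list xs v < vdeg z v" for X a xs v
    using weight_half_walk[OF w(1), of f] even_closed_halves[OF w(1,2)] w(3)
      f(2)[OF half_walk_mon[OF w(1)] half_walk_mon[OF w(1)], of True False v] by simp
  then show ?thesis using that f(1) by blast
qed

lemma no_potential:
  assumes "minimal_pair z w" "weight f z \<noteq> weight f w" "potential E f X g" "\<And>v. vdeg z v > 0 \<Longrightarrow> v \<in> X"
  shows False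
  using assms weight_potential_eq unfolding minimal_pair_def by metis

text \<open>A dumbbell of nontouching walks gives a minimal degree with an entry \<open>2\<close> at
  \<open>r\<close>; its dual weighting then has a potential on the whole of \<open>X\<close>, which
  contains the support.\<close>

lemma touch_in_biconnected:
  assumes c: "conn E X" "\<And>x. conn E (X - {x})" and xs: "odd_closed E X a xs" and ys: "odd_closed E X b ys"
  shows "touch E (set xs) (set ys)"
proof (rule ccontr)
  assume "\<not> touch E (set xs) (set ys)"
  then obtain r z w where z: "minimal_pair z w" "\<And>v. vdeg z v > 0 \<Longrightarrow> v \<in> X" "2 \<le> vdeg z r"
    using nontouching_dumbbell[OF c(1) xs ys] by metis
  obtain f where f: "weight f z \<noteq> weight f w"
    "\<And>X a xs v. walk_from E X a xs a \<Longrightarrow> even (length xs) \<Longrightarrow> count_list xs v < vdeg z v \<Longrightarrow> alt_sum f a xs = 0"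
    using killer[OF z(1)] by blast
  obtain g where "potential E f X g"
    using potential_exists_once[OF c(2)[of r], of f] f(2)[of X _ _ r] z(3) by fastforce
  then show False using no_potential[OF z(1) f(1) _ z(2)] by blast
qed

end

section \<open>Blocks and odd holes\<close>

definition bicon :: "'v set set \<Rightarrow> 'v set \<Rightarrow> bool" where
  "bicon E X \<longleftrightarrow> 2 \<le> card X \<and> conn E X \<and> (\<forall>x. conn E (X - {x}))"

text \<open>These are the vertex sets of the odd chordless cycles.\<close>
definition odd_hole :: "'v set set \<Rightarrow> 'v set \<Rightarrow> bool" where
  "odd_hole E C \<longleftrightarrow> has_odd E C \<and> (\<forall>S. S \<subset> C \<longrightarrow> \<not> has_odd E S)"

text \<open>Used when a vertex of a path is deleted: each remaining piece stays connected and keeps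
  its end of the path.\<close>

lemma conn_prefix_suffix:
  assumes "walk_from E Z z ps y" "z # ps = us @ v # ws"
  shows "conn E (set us)" "us \<noteq> [] \<Longrightarrow> z \<in> set us" "conn E (set ws)" "ws \<noteq> [] \<Longrightarrow> y \<in> set ws"
proof -
  have "conn E (set us) \<and> (us \<noteq> [] \<longrightarrow> z \<in> set us)"
  proof (cases us)
    case Nil
    then show ?thesis by (simp add: conn_def)
  next
    case (Cons a us')
    then have ps: "ps = us' @ v # ws" "a = z" using assms(2) by auto
    then obtain b where "walk_from E Z z us' b" using assms(1) walk_from_append by metis
    then show ?thesis using conn_walk_set Cons ps by fastforce
  qed
  then show "conn E (set us)" "us \<noteq> [] \<Longrightarrow> z \<in> set us" by auto
  have "walk_from E Z v ws y"
  proof (cases us)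
    case Nil
    then show ?thesis using assms by auto
  next
    case (Cons a us')
    then have "ps = (us' @ [v]) @ ws" using assms(2) by auto
    then obtain b where b: "walk_from E Z z (us' @ [v]) b" "walk_from E Z b ws y" using assms(1) walk_from_append by metis
    then have "b = v" using walk_from_ends by fastforce
    then show ?thesis using b by simp
  qed
  then have "conn E (set ws) \<and> (ws \<noteq> [] \<longrightarrow> y \<in> set ws)"
  proof (cases ws)
    case Nil
    then show ?thesis by (simp add: conn_def)
  next
    case (Cons c ws')
    then have w: "walk_from E Z c ws' y" using \<open>walk_from E Z v ws y\<close> by auto
    then have "y \<in> set ws" using walk_from_ends[OF w] Cons by (auto split: if_splits)
    then show ?thesis using conn_walk_set[OF w] Cons by simp
  qed
  then show "conn E (set ws)" "ws \<noteq> [] \<Longrightarrow> y \<in> set ws" by auto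
qed

lemma conn_join:
  assumes "conn E X" "conn E Y" "x \<in> X" "y \<in> Y" "{x, y} \<in> E"
  shows "conn E (X \<union> Y)"
proof -
  have "conn E (insert y X \<union> Y)" using assms by (intro conn_union conn_insert[of E X x y]) auto
  then show ?thesis using assms(4) by (simp add: insert_absorb)
qed

lemma conn_neighbour:
  assumes "conn E X" "x \<in> X" "y \<in> X" "x \<noteq> y"
  obtains c where "c \<in> X" "{x, c} \<in> E" 
proof -
  obtain xs where xs: "walk_from E X x xs y" using assms unfolding conn_def by blast
  then obtain c xs' where "xs = c # xs'" using assms(4) by (cases xs) auto
  then show ?thesis using xs that walk_from_ends by fastforce
qed

lemma odd_hole_exists:
  assumes "has_odd E X"
  obtains C where "C \<subseteq> X" "odd_hole E C" "finite C"
proof -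
  obtain a xs where w: "walk_from E X a xs a" "odd (length xs)" using assms unfolding has_odd_def odd_closed_def by blast
  have "a \<in> set xs" using odd_closed_nonempty w unfolding odd_closed_def by metis
  then have "walk_from E (set xs) a xs a" using walk_from_restrict[OF w(1)] by auto
  then have h: "has_odd E (set xs)" using w(2) unfolding has_odd_def odd_closed_def by blast
  define F where "F = {S. S \<subseteq> set xs \<and> has_odd E S}"
  have fF: "finite F" unfolding F_def by simp
  have "set xs \<in> F" using h unfolding F_def by simp
  then obtain C where C: "C \<in> F" "\<And>S. S \<in> F \<Longrightarrow> S \<subseteq> C \<Longrightarrow> S = C" using finite_has_minimal[OF fF] by (metis empty_iff)
  then have "odd_hole E C" unfolding odd_hole_def F_def by blast
  moreover have "C \<subseteq> X" "finite C" using C walk_from_ends[OF w(1)] finite_subset unfolding F_def by auto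
  ultimately show ?thesis using that by blast
qed

context ugraph
begin

text \<open>A shortest odd closed walk repeats no vertex, since at a repetition one of the two parts
  would be a shorter odd one. By minimality of \<open>C\<close> it visits all of
  \<open>C\<close>.\<close>

lemma odd_hole_cycle:
  assumes C: "odd_hole E C" and v: "v \<in> C"
  obtains t where "walk_from E C v (t @ [v]) v" "distinct (v # t)" "insert v (set t) = C" "even (length t)" "t \<noteq> []"
proof -
  have ex: "\<exists>n. \<exists>a xs. odd_closed E C a xs \<and> length xs = n" using C unfolding odd_hole_def has_odd_def by blast
  define n where "n = (LEAST n. \<exists>a xs. odd_closed E C a xs \<and> length xs = n)"
  obtain a xs where xs: "odd_closed E C a xs" "length xs = n" unfolding n_def using LeastI_ex[OF ex] by blast
  have least: "n \<le> length ys" if "odd_closed E C b ys" for b ys unfolding n_def using that by (intro Least_le) blast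
  have w: "walk_from E C a xs a" "odd (length xs)" using xs unfolding odd_closed_def by auto
  have "distinct xs"
  proof (rule ccontr)
    assume "\<not> distinct xs"
    then obtain us vs ws y where d: "xs = us @ [y] @ vs @ [y] @ ws" using not_distinct_decomp by blast
    then have "walk_from E C a ((us @ [y]) @ (vs @ [y]) @ ws) a" using w(1) by simp
    then obtain b c where b: "walk_from E C a (us @ [y]) b" "walk_from E C b (vs @ [y]) c" "walk_from E C c ws a"
      using walk_from_append by metis
    have "b = y" "c = y" using walk_from_ends[OF b(1)] walk_from_ends[OF b(2)] by auto
    then have cl: "walk_from E C y (vs @ [y]) y" "walk_from E C a ((us @ [y]) @ ws) a" using b walk_from_appendI by metis+
    have "odd (length (vs @ [y])) \<or> odd (length ((us @ [y]) @ ws))" using w(2) d by auto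
    then have "n \<le> length (vs @ [y]) \<or> n \<le> length ((us @ [y]) @ ws)" using cl least unfolding odd_closed_def by blast
    then show False using xs(2) d by auto
  qed
  have "a \<in> set xs" using odd_closed_nonempty xs by metis
  then have "walk_from E (set xs) a xs a" using walk_from_restrict[OF w(1)] by auto
  then have "has_odd E (set xs)" using w(2) unfolding has_odd_def odd_closed_def by blast
  then have sxs: "set xs = C" using C walk_from_ends[OF w(1)] unfolding odd_hole_def by blast
  obtain ys where ys: "odd_closed E C v ys" "mset ys = mset xs" using odd_closed_rotate[OF xs(1), of v] v sxs by blast
  have "ys \<noteq> []" using ys(1) unfolding odd_closed_def by auto
  moreover have "last ys = v" using ys(1) walk_from_ends[of E C v ys v] calculation unfolding odd_closed_def by auto
  ultimately obtain t where t: "ys = t @ [v]" by (metis append_butlast_last_id)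
  have "distinct ys" using ys(2) \<open>distinct xs\<close> by (metis mset_eq_imp_distinct_iff)
  moreover have "set ys = C" using ys(2) sxs by (metis set_mset_mset)
  moreover have "t \<noteq> []" using ys(1) t no_loop unfolding odd_closed_def by auto
  ultimately show ?thesis using that[of t] ys(1) t unfolding odd_closed_def by auto
qed

lemma odd_hole_closed:
  assumes "odd_hole E C" "v \<in> C"
  obtains xs where "odd_closed E C v xs" "set xs = C" "distinct xs"
proof -
  obtain t where "walk_from E C v (t @ [v]) v" "distinct (v # t)" "insert v (set t) = C" "even (length t)" "t \<noteq> []"
    using odd_hole_cycle assms by metis
  then show ?thesis by (intro that[of "t @ [v]"]) (auto simp: odd_closed_def)
qed

lemma odd_hole_conn:
  assumes "odd_hole E C"
  shows "conn E C" "conn E (C - {x})" "finite C" "3 \<le> card C" "odd (card C)"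
proof -
  obtain a where a: "a \<in> C" using assms walk_from_ends unfolding odd_hole_def has_odd_def odd_closed_def by metis
  have cyc: "\<exists>t. walk_from E C v (t @ [v]) v \<and> distinct (v # t) \<and> insert v (set t) = C \<and> even (length t) \<and> t \<noteq> []" if "v \<in> C" for v
    using odd_hole_cycle[OF assms that] by metis
  obtain t where t: "walk_from E C a (t @ [a]) a" "distinct (a # t)" "insert a (set t) = C" "even (length t)" "t \<noteq> []"
    using cyc[OF a] by blast
  have "insert a (set (t @ [a])) = C" using t(3) by auto
  then show c: "conn E C" using conn_walk_set[OF t(1)] by metis
  show "finite C" using t(3) by auto
  have card: "card C = Suc (length t)" using t(2,3) distinct_card by fastforce
  then show "odd (card C)" using t(4) by simp
  have "length t \<noteq> 0" "length t \<noteq> 1" using t(4,5) by auto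
  then show "3 \<le> card C" using card by linarith
  show "conn E (C - {x})"
  proof (cases "x \<in> C")
    case True
    obtain t where t: "walk_from E C x (t @ [x]) x" "distinct (x # t)" "insert x (set t) = C" using cyc[OF True] by blast
    have "conn E (set (t @ [x]) - {x})"
    proof -
      obtain b where "walk_from E C x t b" using t(1) walk_from_append by metis
      then have "conn E (set t)" using conn_prefix_suffix(3)[of E C x t b "[]" x t] by simp
      moreover have "set (t @ [x]) - {x} = set t" using t(2) by auto
      ultimately show ?thesis by simp
    qed
    moreover have "C - {x} = set (t @ [x]) - {x}" using t(3) by auto
    ultimately show ?thesis by simp
  qed (use c in simp)
qed

lemma odd_hole_bicon: "odd_hole E C \<Longrightarrow> bicon E C"
  unfolding bicon_def using odd_hole_conn[of C] by auto

text \<open>A chord splits the cycle into two closed walks, one of them odd, and each omits a vertex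
  of \<open>C\<close>, against minimality.\<close>

lemma odd_hole_neighbours:
  assumes "odd_hole E C" "walk_from E C v (t @ [v]) v" "distinct (v # t)" "insert v (set t) = C" "even (length t)"
    and u: "u \<in> C" "{v, u} \<in> E"
  shows "u = hd t \<or> u = last t"
proof (rule ccontr)
  assume neg: "\<not> ?thesis"
  have "u \<noteq> v" using u no_loop by auto
  then have "u \<in> set t" using u assms(4) by auto
  then obtain as bs where t: "t = as @ u # bs" by (meson split_list)
  have ne: "as \<noteq> []" "bs \<noteq> []" using neg t by auto
  have "walk_from E C v ((as @ [u]) @ (bs @ [v])) v" using assms(2) t by simp
  then obtain b where b: "walk_from E C v (as @ [u]) b" "walk_from E C b (bs @ [v]) v" using walk_from_append by metis
  then have bu: "b = u" using walk_from_ends by fastforce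
  have vC: "v \<in> C" using assms(4) by auto
  have w1: "walk_from E C v ((as @ [u]) @ [v]) v" using bu u vC
    by (intro walk_from_appendI[OF b(1)]) (auto simp: insert_commute)
  have w2: "walk_from E C v (u # bs @ [v]) v" using b(2) bu u vC by simp
  have "even (length as + length bs + 1)" using assms(5) t by simp
  then consider "odd (length ((as @ [u]) @ [v]))" | "odd (length (u # bs @ [v]))" by fastforce
  then show False
  proof cases
    case 1
    define S where "S = insert v (set ((as @ [u]) @ [v]))"
    have "walk_from E S v ((as @ [u]) @ [v]) v" by (rule walk_from_restrict[OF w1]) (simp add: S_def)
    then have "has_odd E S" using 1 unfolding has_odd_def odd_closed_def by blast
    moreover have "hd bs \<notin> S" "hd bs \<in> C" using assms(3,4) t ne(2) unfolding S_def by (cases bs; auto)+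
    then have "S \<subset> C" using assms(4) t u vC unfolding S_def by auto
    ultimately show False using assms(1) unfolding odd_hole_def by blast
  next
    case 2
    define S where "S = insert v (set (u # bs @ [v]))"
    have "walk_from E S v (u # bs @ [v]) v" by (rule walk_from_restrict[OF w2]) (simp add: S_def)
    then have "has_odd E S" using 2 unfolding has_odd_def odd_closed_def by blast
    moreover have "hd as \<notin> S" "hd as \<in> C" using assms(3,4) t ne(1) unfolding S_def by (cases as; auto)+
    then have "S \<subset> C" using assms(4) t u vC unfolding S_def by auto
    ultimately show False using assms(1) unfolding odd_hole_def by blast
  qed
qed

text \<open>If an odd closed walk survives the removal of \<open>y\<close>, then \<open>y\<close>
  can be avoided. Otherwise the rest is two-coloured and \<open>y\<close> has neighbours in both
  classes; a round trip from \<open>u\<close> that enters \<open>y\<close> from one class and leaves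
  into the other is odd.\<close>

lemma odd_closed_once:
  assumes b: "bicon E X" and o: "has_odd E X" and u: "u \<in> X" "y \<noteq> u"
  obtains xs where "odd_closed E X u xs" "count_list xs y \<le> 1"
proof (cases "has_odd E (X - {y})")
  case True
  then obtain xs where xs: "odd_closed E (X - {y}) u xs"
    using odd_closed_at[of E "X - {y}" u] b u unfolding bicon_def by (metis Diff_iff singletonD)
  then have "y \<notin> set xs" using walk_from_ends unfolding odd_closed_def by (metis Diff_iff singletonI subsetD)
  moreover have "odd_closed E X u xs" using xs walk_from_mono[of E "X - {y}" u xs u X] unfolding odd_closed_def by auto
  ultimately show ?thesis using that[of xs] by (simp add: count_list_0_iff)
next
  case False
  then obtain s :: "'v \<Rightarrow> real" where s: "\<And>v. s v = 1 \<or> s v = -1"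
    "\<And>u v. u \<in> X - {y} \<Longrightarrow> v \<in> X - {y} \<Longrightarrow> {u, v} \<in> E \<Longrightarrow> s v = - s u" using two_colouring by metis
  have s0: "s v \<noteq> 0" for v using s(1)[of v] by auto
  have yX: "y \<in> X" using False o by (metis Diff_empty Diff_insert0)
  have "\<exists>r q. r \<in> X - {y} \<and> q \<in> X - {y} \<and> {y, r} \<in> E \<and> {y, q} \<in> E \<and> s r \<noteq> s q"
  proof (rule ccontr)
    assume neg: "\<not> ?thesis"
    \<comment> \<open>The only candidate for the colour of \<open>y\<close>, with \<open>1\<close>
      as default if \<open>y\<close> has no neighbour in \<open>X\<close>.\<close>
    define k where "k = (if \<exists>r\<in>X - {y}. {y, r} \<in> E then - s (SOME r. r \<in> X - {y} \<and> {y, r} \<in> E) else 1)"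
    have k: "k = - s r" if r: "r \<in> X - {y}" "{y, r} \<in> E" for r
    proof -
      have "(SOME r. r \<in> X - {y} \<and> {y, r} \<in> E) \<in> X - {y} \<and> {y, SOME r. r \<in> X - {y} \<and> {y, r} \<in> E} \<in> E"
        using someI[of "\<lambda>r. r \<in> X - {y} \<and> {y, r} \<in> E" r] r by blast
      then have "s (SOME r. r \<in> X - {y} \<and> {y, r} \<in> E) = s r" using neg r by blast
      then show ?thesis unfolding k_def using r by auto
    qed
    have "k \<noteq> 0" unfolding k_def using s0 by simp
    have "\<not> has_odd E X"
    proof (rule colouring_no_odd[of X "s(y := k)"])
      show "(s(y := k)) v \<noteq> 0" for v using s0 \<open>k \<noteq> 0\<close> by simp
      show "(s(y := k)) v = - (s(y := k)) u" if uv: "u \<in> X" "v \<in> X" "{u, v} \<in> E" for u v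
      proof -
        have "u \<noteq> v" "{v, u} \<in> E" using uv no_loop by (auto simp: insert_commute)
        then show ?thesis using uv s(2)[of u v] k[of u] k[of v] by (cases "u = y"; cases "v = y") auto
      qed
    qed
    then show False using o by blast
  qed
  then obtain r q where rq: "r \<in> X - {y}" "q \<in> X - {y}" "{y, r} \<in> E" "{y, q} \<in> E" "s r \<noteq> s q" by blast
  have cX: "conn E (X - {y})" using b unfolding bicon_def by blast
  have u': "u \<in> X - {y}" using u by auto
  obtain us where us: "walk_from E (X - {y}) u us r" using cX u' rq(1) unfolding conn_def by blast
  obtain ws where ws: "walk_from E (X - {y}) q ws u" using cX u' rq(2) unfolding conn_def by blast
  define xs where "xs = us @ y # q # ws"
  have "walk_from E X r (y # q # ws) u"
    using walk_from_mono[OF ws, of X] rq yX by (auto simp: insert_commute)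
  then have W: "walk_from E X u xs u" unfolding xs_def by (intro walk_from_appendI[OF walk_from_mono[OF us]]) auto
  have ps: "potential E (\<lambda>_. 0) (X - {y}) s" using s(2) unfolding potential_def by fastforce
  have z: "alt_sum (\<lambda>_. 0) c ys = 0" for c and ys :: "'v list" by (induction ys arbitrary: c) auto
  have "s u = (-1) ^ length us * s r" "s q = (-1) ^ length ws * s u"
    using alt_sum_potential[OF ps us] alt_sum_potential[OF ps ws] z by auto
  then have "odd (length us) \<noteq> odd (length ws)" using rq(5) by (auto split: if_splits simp: minus_one_power_iff)
  then have "odd (length xs)" unfolding xs_def by auto
  moreover have "y \<notin> set us" "y \<notin> set ws" "y \<noteq> q" using walk_from_ends[OF us] walk_from_ends[OF ws] rq by auto
  then have "count_list xs y \<le> 1" unfolding xs_def by (simp add: count_list_0_iff)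
  ultimately show ?thesis using that W unfolding odd_closed_def by blast
qed

end

section \<open>Blocks as maximal biconnected vertex sets\<close>

locale vgraph = ugraph E for E :: "'v set set" +
  fixes V :: "'v set"
  assumes finite_V: "finite V" and edge_V: "e \<in> E \<Longrightarrow> e \<subseteq> V"
begin

definition blk :: "'v set \<Rightarrow> bool" where
  "blk X \<longleftrightarrow> X \<subseteq> V \<and> bicon E X \<and> (\<forall>Y. X \<subseteq> Y \<and> Y \<subseteq> V \<and> bicon E Y \<longrightarrow> Y = X)"

lemma blkD:
  assumes "blk X"
  shows "X \<subseteq> V" "bicon E X" "conn E X" "conn E (X - {x})" "finite X" "2 \<le> card X"
  using assms finite_subset[OF _ finite_V] unfolding blk_def bicon_def by auto

lemma blk_exists:
  assumes "bicon E X" "X \<subseteq> V"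
  obtains Y where "blk Y" "X \<subseteq> Y"
proof -
  define F where "F = {Y. X \<subseteq> Y \<and> Y \<subseteq> V \<and> bicon E Y}"
  have "finite F" unfolding F_def using finite_V by (auto intro: finite_subset[of _ "Pow V"])
  moreover have "X \<in> F" using assms unfolding F_def by auto
  ultimately obtain Y where "Y \<in> F" "\<And>Z. Z \<in> F \<Longrightarrow> Y \<subseteq> Z \<Longrightarrow> Z = Y" using finite_has_maximal[of F] by (metis empty_iff)
  then have "blk Y" "X \<subseteq> Y" unfolding F_def blk_def by auto
  then show ?thesis by (rule that)
qed

text \<open>The union of two blocks with two common vertices stays connected after the removal of
  any vertex, against maximality.\<close>

lemma blk_inter:
  assumes "blk X" "blk Y" "X \<noteq> Y" "u \<in> X" "u \<in> Y" "v \<in> X" "v \<in> Y"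
  shows "u = v"
proof (rule ccontr)
  assume uv: "u \<noteq> v"
  note X = blkD[OF assms(1)] and Y = blkD[OF assms(2)]
  have "bicon E (X \<union> Y)" unfolding bicon_def
  proof (intro conjI allI)
    show "2 \<le> card (X \<union> Y)" using X(5,6) Y(5) card_mono[of "X \<union> Y" X] by simp
    show "conn E (X \<union> Y)" using X(3) Y(3) assms by (intro conn_union) auto
    show "conn E (X \<union> Y - {x})" for x
    proof -
      have "(X - {x}) \<inter> (Y - {x}) \<noteq> {}" using assms uv by blast
      then have "conn E ((X - {x}) \<union> (Y - {x}))" using X(4) Y(4) by (intro conn_union) auto
      then show ?thesis by (simp add: Un_Diff)
    qed
  qed
  then have "X \<union> Y = X" "X \<union> Y = Y" using assms(1,2) X(1) Y(1) unfolding blk_def by (metis Un_least Un_upper1, metis Un_least Un_upper2)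
  then show False using assms(3) by simp
qed

text \<open>Otherwise a path inside \<open>Z\<close> from \<open>z\<close> to \<open>z'\<close> is
  an ear that can be added to the block \<open>X\<close>.\<close>

lemma blk_attach:
  assumes X: "blk X" and Z: "conn E Z" "Z \<inter> X = {}" "z \<in> Z" "z' \<in> Z"
    and ab: "a \<in> X" "b \<in> X" "{a, z} \<in> E" "{b, z'} \<in> E"
  shows "a = b"
proof (rule ccontr)
  assume nab: "a \<noteq> b"
  note x = blkD[OF X]
  obtain ps0 where "walk_from E Z z ps0 z'" using Z unfolding conn_def by blast
  \<comment> \<open>The path has no repetitions, so that removing one of its vertices leaves two
    pieces, attached to \<open>X\<close> at \<open>a\<close> and at \<open>b\<close>.\<close>
  then obtain ps where ps: "walk_from E Z z ps z'" "distinct (z # ps)" using walk_from_distinct by metis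
  define P where "P = insert z (set ps)"
  have PZ: "P \<subseteq> Z" "z \<in> P" "z' \<in> P" using walk_from_ends[OF ps(1)] Z unfolding P_def by (auto split: if_splits)
  have cP: "conn E P" unfolding P_def by (rule conn_walk_set[OF ps(1)])
  have PV: "P \<subseteq> V"
  proof
    fix p assume p: "p \<in> P"
    show "p \<in> V"
    proof (cases "p = z")
      case True
      then show ?thesis using edge_V[OF ab(3)] by auto
    next
      case False
      then obtain c where "{p, c} \<in> E" using conn_neighbour[OF cP p PZ(2)] by metis
      then show ?thesis using edge_V by blast
    qed
  qed
  have "bicon E (X \<union> P)" unfolding bicon_def
  proof (intro conjI allI)
    show "2 \<le> card (X \<union> P)" 
    proof -
      have "finite (X \<union> P)" using x(5) unfolding P_def by simp
      then show ?thesis using x(6) card_mono[of "X \<union> P" X] by simp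
    qed
    show "conn E (X \<union> P)" using conn_join[OF x(3) cP ab(1) PZ(2) ab(3)] .
    show "conn E (X \<union> P - {v})" for v
    proof (cases "v \<in> P")
      case False
      then have e: "X \<union> P - {v} = (X - {v}) \<union> P" by auto
      show ?thesis
      proof (cases "v = a")
        case True
        then have "b \<in> X - {v}" using nab ab(2) by auto
        then show ?thesis unfolding e by (rule conn_join[OF x(4) cP _ PZ(3) ab(4)])
      next
        case False
        then have "a \<in> X - {v}" using ab(1) by auto
        then show ?thesis unfolding e by (rule conn_join[OF x(4) cP _ PZ(2) ab(3)])
      qed
    next
      case True
      then have "v \<in> set (z # ps)" unfolding P_def by simp
      then obtain us ws where sp: "z # ps = us @ v # ws" by (meson split_list)
      note cps = conn_prefix_suffix[OF ps(1) sp]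
      have "v \<notin> X" using True PZ Z by auto
      moreover have "P = set us \<union> {v} \<union> set ws" unfolding P_def using arg_cong[OF sp, of set] by auto
      moreover have "v \<notin> set us" "v \<notin> set ws" using ps(2) unfolding sp by auto
      ultimately have e: "X \<union> P - {v} = (X \<union> set us) \<union> set ws" by auto
      have c1: "conn E (X \<union> set us)"
        using conn_join[OF x(3) cps(1) ab(1) _ ab(3)] cps(2) x(3) by (cases "us = []") auto
      show ?thesis unfolding e
        using conn_join[OF c1 cps(3) _ _ ab(4)] ab(2) cps(4) c1 by (cases "ws = []") auto
    qed
  qed
  then have "X \<union> P = X" using X x(1) PV unfolding blk_def by (metis Un_least Un_upper1)
  then show False using PZ Z by blast
qed

text \<open>An edge from \<open>X - Y\<close> to \<open>Y - X\<close> would attach the connected set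
  \<open>Y - {x}\<close> to \<open>X\<close> both at \<open>x\<close> and at another vertex.\<close>

lemma blk_linked_vertex:
  assumes "blk X" "blk Y" "X \<noteq> Y" "x \<in> X" "x \<in> Y"
  shows "linked X Y x x"
proof -
  have i: "X \<inter> Y = {x}" using blk_inter[OF assms(1-3)] assms(4,5) by blast
  note Y = blkD[OF assms(2)]
  have "{u, v} \<notin> E" if uv: "u \<in> X - Y" "v \<in> Y - X" for u v
  proof
    assume e: "{u, v} \<in> E"
    have "v \<noteq> x" using uv assms by auto
    then obtain c where c: "c \<in> Y" "{x, c} \<in> E" using conn_neighbour[OF Y(3) assms(5), of v] uv by auto
    then have "c \<noteq> x" using no_loop by auto
    have "u = x"
      by (rule blk_attach[OF assms(1) Y(4)[of x], of v c]) (use uv i c \<open>c \<noteq> x\<close> \<open>v \<noteq> x\<close> e assms(4) in auto)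
    then show False using uv assms by auto
  qed
  then show ?thesis unfolding linked_def using i assms by auto
qed

lemma blk_linked_edge:
  assumes "blk X" "blk Y" "X \<inter> Y = {}" "a \<in> X" "b \<in> Y" "{a, b} \<in> E"
  shows "linked X Y a b"
proof -
  have "u = a \<and> v = b" if uv: "u \<in> X" "v \<in> Y" "{u, v} \<in> E" for u v
  proof
    show "u = a" by (rule blk_attach[OF assms(1) blkD(3)[OF assms(2)], of v b]) (use uv assms in auto)
    show "v = b" by (rule blk_attach[OF assms(2) blkD(3)[OF assms(1)], of u a])
      (use uv assms in \<open>auto simp: insert_commute\<close>)
  qed
  then show ?thesis unfolding linked_def using assms by blast
qed

lemma odd_hole_V: "odd_hole E C \<Longrightarrow> C \<subseteq> V"
proof
  fix v assume C: "odd_hole E C" and v: "v \<in> C"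
  obtain t where "walk_from E C v (t @ [v]) v" "t \<noteq> []" using odd_hole_cycle[OF C v] by metis
  then have "\<exists>c. {v, c} \<in> E" by (cases t) auto
  then show "v \<in> V" using edge_V by blast
qed

lemma odd_hole_blk:
  assumes "odd_hole E C"
  obtains X where "blk X" "C \<subseteq> X" "has_odd E X"
proof -
  obtain X where X: "blk X" "C \<subseteq> X" using blk_exists[OF odd_hole_bicon[OF assms] odd_hole_V[OF assms]] by metis
  have "has_odd E C" using assms unfolding odd_hole_def by blast
  then have "has_odd E X" using has_odd_mono X(2) by metis
  then show ?thesis using that X by blast
qed

end

section \<open>Linked blocks\<close>

text \<open>Splitting an odd closed walk at a return to \<open>a\<close> leaves a shorter odd
  part.\<close>

lemma odd_closed_first_return:
  assumes "odd_closed E X a xs"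
  obtains ys where "odd_closed E X a (ys @ [a])" "a \<notin> set ys"
proof -
  have "\<exists>ys. odd_closed E X a (ys @ [a]) \<and> a \<notin> set ys"
    using assms
  proof (induction "length xs" arbitrary: xs rule: less_induct)
    case less
    have w: "walk_from E X a xs a" "odd (length xs)" using less.prems unfolding odd_closed_def by auto
    then have ne: "xs \<noteq> []" by auto
    then have "last xs = a" using walk_from_ends[OF w(1)] by simp
    then obtain ys where ys: "xs = ys @ [a]" using ne by (metis append_butlast_last_id)
    show ?case
    proof (cases "a \<in> set ys")
      case False
      then show ?thesis using less.prems ys by blast
    next
      case True
      then obtain us vs where uv: "ys = us @ a # vs" by (meson split_list)
      then have xs: "xs = (us @ [a]) @ (vs @ [a])" using ys by simp
      then obtain b where b: "walk_from E X a (us @ [a]) b" "walk_from E X b (vs @ [a]) a" using w(1) walk_from_append by metis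
      have "b = a" using walk_from_ends[OF b(1)] by simp
      moreover have "odd (length (us @ [a])) \<or> odd (length (vs @ [a]))" using w(2) xs by auto
      moreover have "length (us @ [a]) < length xs" "length (vs @ [a]) < length xs" using xs by auto
      ultimately show ?thesis using less.hyps b unfolding odd_closed_def by metis
    qed
  qed
  then show ?thesis using that by blast
qed

context ugraph
begin

text \<open>The two arcs between \<open>y\<close> and \<open>y'\<close> have different parity. The
  arc with an odd number of edges closes up with \<open>x\<close> to an odd walk; the other has a
  positive even number of edges, hence an inner vertex \<open>d\<close>, which is missed.\<close>

lemma odd_hole_two_neighbours:
  assumes D: "odd_hole E D" and x: "x \<notin> D" and y: "y \<in> D" "y' \<in> D" "y \<noteq> y'" "{x, y} \<in> E" "{x, y'} \<in> E"
  obtains d where "d \<in> D" "has_odd E (insert x (D - {d}))"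
proof -
  obtain t where t: "walk_from E D y (t @ [y]) y" "distinct (y # t)" "insert y (set t) = D" "even (length t)"
    using odd_hole_cycle[OF D y(1)] by metis
  have "y' \<in> set t" using y t(3) by auto
  then obtain as bs where ab: "t = as @ y' # bs" by (meson split_list)
  have "walk_from E D y ((as @ [y']) @ (bs @ [y])) y" using t(1) ab by simp
  then obtain b where b: "walk_from E D y (as @ [y']) b" "walk_from E D b (bs @ [y]) y" using walk_from_append by metis
  then have b': "b = y'" using walk_from_ends by fastforce
  have arc: "has_odd E (insert x (D - {d}))"
    if w: "walk_from E D p us q" "d \<notin> insert p (set us)" "odd (length us)" "{x, p} \<in> E" "{x, q} \<in> E" for p us q d
  proof -
    have q: "q \<in> insert p (set us)" "insert p (set us) \<subseteq> D" using walk_from_ends[OF w(1)] by (auto split: if_splits)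
    have "walk_from E (insert x (D - {d})) p us q" by (rule walk_from_restrict[OF w(1)]) (use w(2) q in auto)
    then have "walk_from E (insert x (D - {d})) p (us @ [x]) x"
      using w(2,5) q by (intro walk_from_appendI) (auto simp: insert_commute)
    then have "walk_from E (insert x (D - {d})) x (p # us @ [x]) x" using w(4) by simp
    moreover have "odd (length (p # us @ [x]))" using w(3) by simp
    ultimately show ?thesis unfolding has_odd_def odd_closed_def by blast
  qed
  have "odd (length as) \<noteq> odd (length bs)" using t(4) ab by auto
  then show ?thesis
  proof (cases "odd (length as)")
    case True
    then have ne: "as \<noteq> []" "even (length bs)" using \<open>odd (length as) \<noteq> odd (length bs)\<close> by auto
    then have h: "hd as \<in> D" "hd as \<notin> insert y' (set (bs @ [y]))" using t(2,3) ab by (cases as; auto)+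
    have "has_odd E (insert x (D - {hd as}))"
      using arc[of y' "bs @ [y]" y "hd as"] b(2) b' h y ne by auto
    then show ?thesis using that h by blast
  next
    case False
    then have ne: "bs \<noteq> []" using \<open>odd (length as) \<noteq> odd (length bs)\<close> by auto
    then have h: "hd bs \<in> D" "hd bs \<notin> insert y (set (as @ [y']))" using t(2,3) ab by (cases bs; auto)+
    have "has_odd E (insert x (D - {hd bs}))"
      using arc[of y "as @ [y']" y' "hd bs"] b(1) b' h y False by auto
    then show ?thesis using that h by blast
  qed
qed

lemma odd_hole_subset: "odd_hole E C \<Longrightarrow> odd_hole E C' \<Longrightarrow> C \<subseteq> C' \<Longrightarrow> C = C'"
  unfolding odd_hole_def by blast

end

locale cgraph = vgraph E V + ci_graph E for E :: "'v set set" and V :: "'v set"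
begin

definition kills :: "('v set \<Rightarrow> real) \<Rightarrow> ('v set \<Rightarrow>\<^sub>0 nat) \<Rightarrow> bool" where
  "kills f z \<longleftrightarrow> (\<forall>X a xs v. walk_from E X a xs a \<longrightarrow> even (length xs) \<longrightarrow> count_list xs v < vdeg z v \<longrightarrow> alt_sum f a xs = 0)"

abbreviation vsupp :: "('v set \<Rightarrow>\<^sub>0 nat) \<Rightarrow> 'v set" where
  "vsupp z \<equiv> {v. 0 < vdeg z v}"

lemma killsD: "kills f z \<Longrightarrow> walk_from E X a xs a \<Longrightarrow> even (length xs) \<Longrightarrow> count_list xs v < vdeg z v \<Longrightarrow> alt_sum f a xs = 0"
  unfolding kills_def by blast

lemma kills_exists:
  assumes "minimal_pair z w"
  obtains f where "weight f z \<noteq> weight f w" "kills f z"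
proof -
  obtain f where f: "weight f z \<noteq> weight f w"
    "\<And>X a xs v. walk_from E X a xs a \<Longrightarrow> even (length xs) \<Longrightarrow> count_list xs v < vdeg z v \<Longrightarrow> alt_sum f a xs = 0"
    using killer[OF assms] by blast
  have "kills f z" unfolding kills_def using f(2) by blast
  then show ?thesis using that f(1) by blast
qed

lemma no_potential_on:
  assumes "minimal_pair z w" "weight f z \<noteq> weight f w" "vsupp z \<subseteq> X"
  shows "\<not> potential E f X g"
  using no_potential[OF assms(1,2), of X g] assms(3) by blast

text \<open>With an entry of at least \<open>2\<close> at \<open>r\<close>, all even closed walks
  that visit \<open>r\<close> at most once are annihilated, and the block stays connected without
  \<open>r\<close>: this is the setting of \<open>potential_exists_once\<close>.\<close>

lemma blk_potential:
  assumes "blk X" "2 \<le> vdeg z r"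
    and f: "kills f z"
  obtains g where "potential E f X g"
proof -
  have "\<exists>g. potential E f X g"
  proof (rule potential_exists_once[of X r])
    show "conn E (X - {r})" using blkD(4)[OF assms(1)] .
    show "alt_sum f a xs = 0" if "walk_from E X a xs a" "even (length xs)" "count_list xs r \<le> 1" for a xs
      using killsD[OF f that(1,2), of r] that(3) assms(2) by simp
  qed
  then show ?thesis using that by blast
qed

text \<open>If the bound fails at \<open>v\<close>, the even closed walk around \<open>xs\<close>,
  across the link, around \<open>ys\<close> and back is annihilated by the dual weighting. This
  forces the potentials of the two blocks to agree at the link, so that they glue. A bridge is
  crossed twice, which accounts for the extra visit at \<open>a\<close> and at
  \<open>b\<close>.\<close>

lemma linked_degree:
  assumes X: "blk X1" "blk X2" "linked X1 X2 a b"
    and z: "minimal_pair z w" "vsupp z \<subseteq> X1 \<union> X2" "2 \<le> vdeg z r"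
    and O: "odd_closed E X1 a xs" "odd_closed E X2 b ys"
  shows "vdeg z v \<le> count_list xs v + count_list ys v + (if a \<noteq> b \<and> v \<in> {a, b} then 1 else 0)"
proof (rule ccontr)
  assume neg: "\<not> ?thesis"
  obtain f where f: "weight f z \<noteq> weight f w"
    "kills f z"
    using kills_exists[OF z(1)] by blast
  obtain g1 where g1: "potential E f X1 g1" using blk_potential[OF X(1) z(3) f(2)] by blast
  obtain g2 where g2: "potential E f X2 g2" using blk_potential[OF X(2) z(3) f(2)] by blast
  have w: "walk_from E X1 a xs a" "odd (length xs)" "walk_from E X2 b ys b" "odd (length ys)"
    using O unfolding odd_closed_def by auto
  have s: "alt_sum f a xs = 2 * g1 a" "alt_sum f b ys = 2 * g2 b"
    using alt_sum_potential[OF g1 w(1)] alt_sum_potential[OF g2 w(3)] w by auto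
  have wU: "walk_from E (X1 \<union> X2) a xs a" "walk_from E (X1 \<union> X2) b ys b"
    using walk_from_mono[OF w(1)] walk_from_mono[OF w(3)] by auto
  have m: "a \<in> X1" "b \<in> X2" using linked_mem[OF X(3)] by auto
  have "if a = b then g1 a = g2 a else f {a, b} = g1 a + g2 b"
    using X(3)
  proof (cases rule: linked_cases)
    case 1
    have "walk_from E (X1 \<union> X2) a (xs @ ys) a" using wU 1(1) walk_from_appendI by metis
    then have "alt_sum f a (xs @ ys) = 0" using killsD[OF f(2), of _ a "xs @ ys" v] w neg 1(1) by simp
    then show ?thesis using alt_sum_append[OF w(1), of f ys] s w(2) 1(1) by simp
  next
    case 2
    have "walk_from E (X1 \<union> X2) b (ys @ [a]) a"
      using 2(3) m by (intro walk_from_appendI[OF wU(2)]) (auto simp: insert_commute)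
    then have "walk_from E (X1 \<union> X2) a (b # ys @ [a]) a" using 2(3) m by simp
    then have "walk_from E (X1 \<union> X2) a (xs @ b # ys @ [a]) a" by (rule walk_from_appendI[OF wU(1)])
    moreover have "count_list (xs @ b # ys @ [a]) v < vdeg z v" using neg 2(1) by (auto split: if_splits)
    ultimately have "alt_sum f a (xs @ b # ys @ [a]) = 0" using killsD[OF f(2)] w by simp
    moreover have "alt_sum f b (ys @ [a]) = 2 * g2 b - f {a, b}"
      using alt_sum_append[OF w(3), of f "[a]"] s w(4) by (simp add: insert_commute)
    ultimately have "2 * g1 a - (2 * f {a, b} - 2 * g2 b) = 0"
      using alt_sum_append[OF w(1), of f "b # ys @ [a]"] s w(2) by simp
    then show ?thesis using 2(1) by simp
  qed
  then obtain g where "potential E f (X1 \<union> X2) g"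
    using potential_glue[OF X(3) g1 subset_refl m(2) g2] by blast
  then show False using no_potential_on[OF z(1) f(1) z(2)] by blast
qed

text \<open>Apply \<open>linked_degree\<close> to odd closed walks that visit \<open>v\<close> at
  most once; off the link, \<open>v\<close> belongs to at most one of the blocks.\<close>

lemma linked_degree_le_1:
  assumes X: "blk X1" "blk X2" "linked X1 X2 a b" "has_odd E X1" "has_odd E X2"
    and z: "minimal_pair z w" "vsupp z \<subseteq> X1 \<union> X2" "2 \<le> vdeg z r" and v: "v \<noteq> a" "v \<noteq> b"
  shows "vdeg z v \<le> 1"
proof -
  have m: "a \<in> X1" "b \<in> X2" using linked_mem[OF X(3)] by auto
  obtain xs where xs: "odd_closed E X1 a xs" "count_list xs v \<le> 1"
    using odd_closed_once[OF blkD(2)[OF X(1)] X(4) m(1) v(1)] by blast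
  obtain ys where ys: "odd_closed E X2 b ys" "count_list ys v \<le> 1"
    using odd_closed_once[OF blkD(2)[OF X(2)] X(5) m(2) v(2)] by blast
  have "set xs \<subseteq> X1" "set ys \<subseteq> X2" using xs ys walk_from_ends unfolding odd_closed_def by metis+
  moreover have "v \<notin> X1 \<inter> X2" using X(3) by (cases rule: linked_cases) (use v in auto)
  ultimately have "v \<notin> set xs \<or> v \<notin> set ys" by blast
  then have "count_list xs v + count_list ys v \<le> 1" using xs(2) ys(2) by (auto simp: count_list_0_iff)
  then show ?thesis using linked_degree[OF X(1-3) z xs(1) ys(1), of v] v by simp
qed

lemma linked_no_edge:
  assumes "linked X1 X2 a b" "u \<in> X1 - {b}" "v \<in> X2" "v \<noteq> b"
  shows "{u, v} \<notin> E" "v \<notin> X1"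
  using assms(1) by (cases rule: linked_cases; use assms in blast)+

text \<open>A dumbbell with its waist at \<open>b\<close>: one bell lies in \<open>X1\<close>,
  reached either at \<open>b\<close> itself or across the bridge, the other is
  \<open>xs\<close>.\<close>

lemma link_dumbbell:
  assumes L: "linked X1 X2 a b" and o: "conn E X1" "has_odd E X1" and xs: "odd_closed E X2 b xs"
  obtains z w where "minimal_pair z w" "2 \<le> vdeg z b" "vsupp z \<subseteq> X1 \<union> set xs"
proof -
  define A where "A = X1 - {b}"
  define X where "X = X1 \<union> X2"
  have m: "a \<in> X1" "b \<in> X2" using linked_mem[OF L] by auto
  obtain us where us: "odd_closed E X1 a us" using odd_closed_at[OF o m(1)] by blast
  have "\<exists>ys. walk_from E X b (ys @ [b]) b \<and> even (length ys) \<and> set ys \<subseteq> A"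
    using L
  proof (cases rule: linked_cases)
    case 1
    obtain ys where ys: "odd_closed E X1 a (ys @ [a])" "a \<notin> set ys" using odd_closed_first_return[OF us] by blast
    then have w: "walk_from E X1 b (ys @ [b]) b" using 1(1) unfolding odd_closed_def by simp
    have "walk_from E X b (ys @ [b]) b" by (rule walk_from_mono[OF w]) (simp add: X_def)
    moreover have "set ys \<subseteq> A" using walk_from_ends[OF w] ys(2) 1(1) unfolding A_def by auto
    ultimately show ?thesis using ys(1) unfolding odd_closed_def by auto
  next
    case 2
    have w: "walk_from E X1 a us a" "odd (length us)" using us unfolding odd_closed_def by auto
    have wX: "walk_from E X a us a" by (rule walk_from_mono[OF w(1)]) (simp add: X_def)
    have "walk_from E X a (us @ [b]) b" by (rule walk_from_appendI[OF wX]) (use 2(3) m in \<open>auto simp: X_def\<close>)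
    then have "walk_from E X b ((a # us) @ [b]) b" using 2(3) m by (simp add: X_def insert_commute)
    moreover have "b \<notin> X1" using 2(2) m by blast
    then have "set (a # us) \<subseteq> A" using walk_from_ends[OF w(1)] m unfolding A_def by auto
    moreover have "even (length (a # us))" using w(2) by simp
    ultimately show ?thesis by blast
  qed
  then obtain ys where ys: "walk_from E X b (ys @ [b]) b" "even (length ys)" "set ys \<subseteq> A" by blast
  have xw: "walk_from E X2 b xs b" "odd (length xs)" using xs unfolding odd_closed_def by auto
  have xs': "odd_closed E X b xs" unfolding odd_closed_def
    using walk_from_mono[OF xw(1), of X] xw(2) by (simp add: X_def)
  have sx: "set xs \<subseteq> X2" using walk_from_ends[OF xw(1)] by auto
  have d: "set xs \<inter> A = {}" using sx linked_mem[OF L] linked_no_edge(2)[OF L] unfolding A_def by blast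
  have sep: "\<forall>u\<in>A. \<forall>v\<in>set xs. v \<noteq> b \<longrightarrow> {u, v} \<notin> E" using sx linked_no_edge(1)[OF L] unfolding A_def by blast
  have bA: "b \<notin> A" unfolding A_def by simp
  obtain z w where z: "minimal_pair z w" "\<And>v. vdeg z v \<le> count_list (ys @ b # xs) v" "2 \<le> vdeg z b"
    using dumbbell[OF bA ys xs' d sep] by metis
  have bx: "b \<in> set xs" using odd_closed_nonempty[OF xs] .
  have "v \<in> X1 \<union> set xs" if "vdeg z v > 0" for v
    using count_list_pos[OF z(2) that] ys(3) bx unfolding A_def by auto
  then have "vsupp z \<subseteq> X1 \<union> set xs" by blast
  then show ?thesis using that z(1,3) by blast
qed

text \<open>By \<open>linked_degree\<close>, with an odd walk around \<open>C'\<close>, the dumbbell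
  built on \<open>C\<close> has support in \<open>X1\<close> and \<open>C \<inter> C'\<close>. The
  latter is a proper subset of a hole, hence bipartite, and the potentials glue.\<close>

lemma hole_through_link_unique:
  assumes X: "blk X1" "blk X2" "linked X1 X2 a b" "has_odd E X1"
    and C: "odd_hole E C" "C \<subseteq> X2" "b \<in> C" and C': "odd_hole E C'" "C' \<subseteq> X2" "b \<in> C'"
  shows "C = C'"
proof (rule ccontr)
  assume ne: "C \<noteq> C'"
  have m: "a \<in> X1" "b \<in> X2" using linked_mem[OF X(3)] by auto
  obtain xs where xs: "odd_closed E C b xs" "set xs = C" using odd_hole_closed[OF C(1,3)] by metis
  obtain ys where ys: "odd_closed E C' b ys" "set ys = C'" using odd_hole_closed[OF C'(1,3)] by metis
  have xs2: "odd_closed E X2 b xs" "odd_closed E X2 b ys" using xs ys walk_from_mono C(2) C'(2) unfolding odd_closed_def by metis+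
  obtain us where us: "odd_closed E X1 a us" using odd_closed_at[OF blkD(3)[OF X(1)] X(4) m(1)] by blast
  obtain z w where z: "minimal_pair z w" "2 \<le> vdeg z b" "vsupp z \<subseteq> X1 \<union> C"
    using link_dumbbell[OF X(3) blkD(3)[OF X(1)] X(4) xs2(1)] xs(2) by metis
  have sup: "vsupp z \<subseteq> X1 \<union> X2" using z(3) C(2) by blast
  have sup': "v \<in> X1 \<union> (C \<inter> C')" if v: "v \<in> vsupp z" for v
  proof (rule ccontr)
    assume n: "v \<notin> X1 \<union> (C \<inter> C')"
    then have "v \<notin> set us" "v \<notin> set ys" "v \<noteq> a" "v \<noteq> b"
      using us ys z(3) v walk_from_ends[of E X1 a us a] m C(3) C'(3) unfolding odd_closed_def by auto
    then have "vdeg z v \<le> 0"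
      using linked_degree[OF X(1-3) z(1) sup z(2) us xs2(2), of v] by (simp add: count_list_0_iff)
    then show False using v by simp
  qed
  obtain f where f: "weight f z \<noteq> weight f w"
    "kills f z"
    using kills_exists[OF z(1)] by blast
  obtain g1 where g1: "potential E f X1 g1" using blk_potential[OF X(1) z(2) f(2)] by blast
  obtain g2 where g2: "potential E f X2 g2" using blk_potential[OF X(2) z(2) f(2)] by blast
  have "C \<inter> C' \<subset> C" using ne odd_hole_subset[OF C(1) C'(1)] by blast
  then have "\<not> has_odd E (C \<inter> C')" using C(1) unfolding odd_hole_def by blast
  then obtain g where "potential E f (X1 \<union> (C \<inter> C')) g"
    using potential_glue_bip[OF X(3) g1 g2, of "C \<inter> C'"] C C' by blast
  then show False using no_potential_on[OF z(1) f(1)] sup' by blast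
qed

lemma linked_conn: "linked X1 X2 a b \<Longrightarrow> conn E X1 \<Longrightarrow> conn E X2 \<Longrightarrow> conn E (X1 \<union> X2)"
proof -
  assume L: "linked X1 X2 a b" and c: "conn E X1" "conn E X2"
  show ?thesis using L
  proof (cases rule: linked_cases)
    case 1
    then show ?thesis using c by (intro conn_union) auto
  next
    case 2
    then show ?thesis using conn_join[OF c _ _ 2(3)] linked_mem[OF L] by blast
  qed
qed

text \<open>The waist \<open>r\<close> of the dumbbell has degree at least two, so by
  \<open>linked_degree_le_1\<close> it is \<open>u\<close> or \<open>v\<close>. If
  \<open>r = u\<close>, a single neighbour of \<open>u\<close> in \<open>D1\<close> would also have
  degree two, and two neighbours would produce a second hole in \<open>X1\<close>. So
  \<open>r = v\<close>, whose only possible neighbour in \<open>D1\<close> is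
  \<open>u\<close>.\<close>

lemma nontouching_unique_hole:
  assumes X: "blk X1" "blk X2" "linked X1 X2 u v"
    and D1: "odd_hole E D1" "D1 \<subseteq> X1" "\<And>C. odd_hole E C \<Longrightarrow> C \<subseteq> X1 \<Longrightarrow> C = D1"
    and D2: "odd_hole E D2" "D2 \<subseteq> X2" and nt: "\<not> touch E D1 D2"
  shows "u \<noteq> v \<and> u \<in> D1"
proof -
  have o: "has_odd E X1" "has_odd E X2"
    using D1 D2 has_odd_mono unfolding odd_hole_def by metis+
  have m: "u \<in> X1" "v \<in> X2" using linked_mem[OF X(3)] by auto
  have dne: "\<exists>d. d \<in> D1" "\<exists>d. d \<in> D2" using odd_hole_conn(4)[OF D1(1)] odd_hole_conn(4)[OF D2(1)] by (auto simp: ex_in_conv)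
  then obtain d1 d2 where d12: "d1 \<in> D1" "d2 \<in> D2" by blast
  obtain xs where xs: "odd_closed E D1 d1 xs" "set xs = D1" using odd_hole_closed[OF D1(1) d12(1)] by metis
  obtain ys where ys: "odd_closed E D2 d2 ys" "set ys = D2" using odd_hole_closed[OF D2(1) d12(2)] by metis
  have xs': "odd_closed E (X1 \<union> X2) d1 xs" "odd_closed E (X1 \<union> X2) d2 ys"
    using xs(1) ys(1) walk_from_mono[of E D1 d1 xs d1 "X1 \<union> X2"] walk_from_mono[of E D2 d2 ys d2 "X1 \<union> X2"] D1(2) D2(2)
    unfolding odd_closed_def by blast+
  have cU: "conn E (X1 \<union> X2)" using linked_conn[OF X(3)] blkD(3) X by blast
  obtain r z w where z: "minimal_pair z w" "vsupp z \<subseteq> X1 \<union> X2" "r \<notin> D1" "\<exists>y\<in>D1. {r, y} \<in> E"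
    "2 \<le> vdeg z r" "\<forall>y. (\<forall>u\<in>D1. {r, u} \<in> E \<longrightarrow> u = y) \<longrightarrow> 2 \<le> vdeg z y"
    using nontouching_dumbbell[OF cU xs', unfolded xs(2) ys(2), OF nt] by (metis (no_types, lifting) mem_Collect_eq subsetI)
  note le1 = linked_degree_le_1[OF X o z(1,2,5)]
  have "r = u \<or> r = v" using le1[of r] z(5) by fastforce
  moreover have "r \<noteq> u"
  proof
    assume ru: "r = u"
    obtain y where y: "y \<in> D1" "{u, y} \<in> E" using z(4) ru by blast
    have "\<forall>q\<in>D1. {r, q} \<in> E \<longrightarrow> q = y"
    proof (intro ballI impI, rule ccontr)
      fix q assume q: "q \<in> D1" "{r, q} \<in> E" "q \<noteq> y"
      obtain d where d: "d \<in> D1" "has_odd E (insert u (D1 - {d}))"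
        using odd_hole_two_neighbours[OF D1(1) _ y(1) q(1)] z(3) ru y q by metis
      obtain C where C: "C \<subseteq> insert u (D1 - {d})" "odd_hole E C" using odd_hole_exists[OF d(2)] by metis
      then have "C = D1" using D1(2,3) m by blast
      then show False using C(1) d(1) z(3) ru by blast
    qed
    then have "2 \<le> vdeg z y" using z(6) by blast
    moreover have "y \<noteq> u" using y no_loop by auto
    moreover have "y \<noteq> v"
    proof
      assume yv: "y = v"
      then have "y \<in> X1 \<inter> X2" using y D1(2) m by blast
      then show False using linked_cases[OF X(3)] \<open>y \<noteq> u\<close> by (metis empty_iff singletonD)
    qed
    ultimately show False using le1[of y] by simp
  qed
  ultimately have rv: "r = v" "u \<noteq> v" by auto
  obtain y where y: "y \<in> D1" "{v, y} \<in> E" using z(4) rv by blast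
  have yv: "{y, v} \<in> E" "y \<in> X1" using y D1(2) by (auto simp: insert_commute)
  have "y = u" using X(3) by (cases rule: linked_cases) (use yv m rv in blast)+
  then show ?thesis using y rv by blast
qed

end

section \<open>Three blocks, and holes avoiding the shared vertex\<close>

context cgraph
begin

definition vdist :: "'v \<Rightarrow> 'v \<Rightarrow> nat" where
  "vdist x v = (LEAST n. \<exists>xs. walk_from E V x xs v \<and> length xs = n)"

lemma vdist_le: "walk_from E V x xs v \<Longrightarrow> vdist x v \<le> length xs"
  unfolding vdist_def by (rule Least_le) blast

lemma vdist_walk:
  assumes "conn E V" "x \<in> V" "v \<in> V"
  obtains xs where "walk_from E V x xs v" "length xs = vdist x v"
proof -
  have "\<exists>n. \<exists>xs. walk_from E V x xs v \<and> length xs = n" using assms unfolding conn_def by blast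
  from LeastI_ex[OF this] show ?thesis using that unfolding vdist_def by blast
qed

lemma vdist_edge:
  assumes "conn E V" "x \<in> V" "{u, v} \<in> E"
  shows "vdist x v \<le> Suc (vdist x u)"
proof -
  have uv: "u \<in> V" "v \<in> V" using edge_V[OF assms(3)] by auto
  obtain xs where xs: "walk_from E V x xs u" "length xs = vdist x u" using vdist_walk[OF assms(1,2) uv(1)] by metis
  have "walk_from E V x (xs @ [v]) v" by (rule walk_from_appendI[OF xs(1)]) (use uv assms in auto)
  then show ?thesis using vdist_le xs(2) by fastforce
qed

text \<open>Distances of adjacent vertices differ by at most one; if no two of them coincide on
  \<open>S\<close>, their parity is a proper colouring.\<close>

lemma vdist_inj_no_odd:
  assumes "conn E V" "x \<in> V" "inj_on (vdist x) S"
  shows "\<not> has_odd E S"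
proof (rule colouring_no_odd[of S "\<lambda>v. (-1) ^ vdist x v"])
  show "(-1::real) ^ vdist x v = - ((-1) ^ vdist x u)" if "u \<in> S" "v \<in> S" "{u, v} \<in> E" for u v
  proof -
    have "u \<noteq> v" using that no_loop by auto
    then have "vdist x u \<noteq> vdist x v" using assms(3) that unfolding inj_on_def by blast
    moreover have "{v, u} \<in> E" using that by (simp add: insert_commute)
    ultimately have "vdist x v = Suc (vdist x u) \<or> vdist x u = Suc (vdist x v)"
      using vdist_edge[OF assms(1,2) that(3)] vdist_edge[OF assms(1,2), of v u] by linarith
    then show ?thesis by auto
  qed
qed auto

text \<open>The dumbbells from \<open>X3\<close> to \<open>X1\<close> and to \<open>X2\<close> along the same path differ by the dumbbell of \<open>X1\<close> and \<open>X2\<close>.\<close>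
lemma no_three_blocks:
  assumes cV: "conn E V" and X: "blk X1" "blk X2" "blk X3" "X1 \<noteq> X2" "X3 \<noteq> X1" "X3 \<noteq> X2"
    and o: "has_odd E X1" "has_odd E X2" "has_odd E X3" and x: "x \<in> X1" "x \<in> X2"
  shows False
proof -
  have L: "linked X1 X2 x x" by (rule blk_linked_vertex[OF X(1,2,4) x])
  note c = blkD(3)[OF X(1)] blkD(3)[OF X(2)] blkD(3)[OF X(3)]
  have xV: "x \<in> V" using blkD(1)[OF X(1)] x by auto
  obtain o1 where o1: "odd_closed E X1 x o1" using odd_closed_at[OF c(1) o(1) x(1)] by blast
  obtain o2 where o2: "odd_closed E X2 x o2" using odd_closed_at[OF c(2) o(2) x(2)] by blast
  have so: "set o1 \<subseteq> X1" "set o2 \<subseteq> X2" using o1 o2 walk_from_ends unfolding odd_closed_def by metis+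
  obtain z w where z: "minimal_pair z w" "2 \<le> vdeg z x" "vsupp z \<subseteq> X1 \<union> set o2"
    using link_dumbbell[OF L c(1) o(1) o2] by metis
  have sup: "vsupp z \<subseteq> X1 \<union> X2" using z(3) so by blast
  obtain f where f: "weight f z \<noteq> weight f w" "kills f z" using kills_exists[OF z(1)] by blast
  obtain g1 where g1: "potential E f X1 g1" using blk_potential[OF X(1) z(2) f(2)] by blast
  obtain g2 where g2: "potential E f X2 g2" using blk_potential[OF X(2) z(2) f(2)] by blast
  have X3V: "X3 \<subseteq> V" "finite X3" "X3 \<noteq> {}" using blkD[OF X(3)] by auto
  \<comment> \<open>\<open>y\<close> will be a vertex of \<open>X3\<close> nearest to
    \<open>x\<close>, so that a shortest path from \<open>x\<close> to \<open>y\<close> meets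
    \<open>X3\<close> only in \<open>y\<close>.\<close>
  define k where "k = Min (vdist x ` X3)"
  have "k \<in> vdist x ` X3" unfolding k_def using X3V by (intro Min_in) auto
  then obtain y where y: "y \<in> X3" "vdist x y = k" by auto
  have kmin: "k \<le> vdist x v" if "v \<in> X3" for v unfolding k_def using X3V that by simp
  obtain qs where qs: "walk_from E V x qs y" "length qs = k"
    using vdist_walk[OF cV xV, of y] y X3V by auto
  \<comment> \<open>On a shortest path the position of a vertex is its distance from
    \<open>x\<close>.\<close>
  have pos: "v = (x # qs) ! vdist x v \<and> vdist x v \<le> k" if v: "v \<in> insert x (set qs)" for v
  proof -
    obtain i where i: "i < length (x # qs)" "(x # qs) ! i = v" using v by (metis in_set_conv_nth list.simps(15))
    have "x # qs = take i (x # qs) @ v # drop (Suc i) (x # qs)" using i by (metis id_take_nth_drop)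
    then have sp: "qs = take i qs @ drop i qs" by simp
    then obtain b where b: "walk_from E V x (take i qs) b" "walk_from E V b (drop i qs) y"
      using qs(1) walk_from_append by metis
    have "b = v" using walk_from_ends[OF b(1)] i
      by (cases i) (auto simp: last_conv_nth nth_Cons' split: if_splits)
    then have "vdist x v \<le> i" using vdist_le[OF b(1)] i by simp
    moreover have "k \<le> vdist x v + (k - i)"
    proof -
      have "v \<in> V" using b(1) \<open>b = v\<close> walk_from_ends by metis
      then obtain xs where xs: "walk_from E V x xs v" "length xs = vdist x v" using vdist_walk[OF cV xV] by metis
      then have "walk_from E V x (xs @ drop i qs) y" using b(2) \<open>b = v\<close> walk_from_appendI by metis
      then show ?thesis using vdist_le[of x "xs @ drop i qs" y] y qs(2) xs(2) by simp
    qed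
    ultimately have "vdist x v = i" using i qs(2) by simp
    then show ?thesis using i qs(2) by simp
  qed
  define T where "T = insert x (set qs) \<union> X3"
  \<comment> \<open>Distances from \<open>x\<close> are distinct along the path, which reaches
    \<open>X3\<close> only at its end, and another block shares at most one vertex with
    \<open>X3\<close>. So \<open>T\<close> meets any other block in a bipartite set.\<close>
  have bip: "\<not> has_odd E (X \<inter> T)" if Xi: "blk X" "X \<noteq> X3" for X
  proof (rule vdist_inj_no_odd[OF cV xV])
    show "inj_on (vdist x) (X \<inter> T)"
    proof (rule inj_onI)
      fix p q assume pq: "p \<in> X \<inter> T" "q \<in> X \<inter> T" "vdist x p = vdist x q"
      have yk: "y = (x # qs) ! k"
        using pos[of y] y walk_from_ends[OF qs(1)] by (auto split: if_splits)
      have path: "p = q" if "p \<in> insert x (set qs)" "q \<in> insert x (set qs)" "vdist x p = vdist x q" for p q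
        using pos[OF that(1)] pos[OF that(2)] that(3) by metis
      have mixed: "p \<in> X3" if "p \<in> insert x (set qs)" "q \<in> X3" "vdist x p = vdist x q" for p q
      proof -
        have "vdist x p = k" using pos[OF that(1)] kmin[OF that(2)] that(3) by simp
        then show ?thesis using pos[OF that(1)] yk y by simp
      qed
      show "p = q"
      proof (cases "p \<in> X3 \<or> q \<in> X3")
        case True
        then have "p \<in> X3" "q \<in> X3" using mixed[of p q] mixed[of q p] pq unfolding T_def by auto
        then show ?thesis using blk_inter[OF Xi(1) X(3) Xi(2)] pq by blast
      next
        case False
        then show ?thesis using path[of p q] pq unfolding T_def by auto
      qed
    qed
  qed
  obtain ws where ws: "odd_closed E X3 y ws" using odd_closed_at[OF c(3) o(3) y(1)] by blast
  define w3 where "w3 = qs @ ws @ rev_walk x qs"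
  have wsw: "walk_from E X3 y ws y" "odd (length ws)" using ws unfolding odd_closed_def by auto
  have w3: "walk_from E V x w3 x" "odd (length w3)"
  proof -
    have "walk_from E V y ws y" by (rule walk_from_mono[OF wsw(1) X3V(1)])
    then have "walk_from E V y (ws @ rev_walk x qs) x" by (rule walk_from_appendI[OF _ walk_from_rev[OF qs(1)]])
    then show "walk_from E V x w3 x" unfolding w3_def by (rule walk_from_appendI[OF qs(1)])
    show "odd (length w3)" unfolding w3_def using wsw(2) by simp
  qed
  have sw3: "set w3 \<subseteq> T" unfolding w3_def T_def using set_rev_walk[of x qs] walk_from_ends[OF wsw(1)] by auto
  have xT: "x \<in> T" unfolding T_def by simp
  \<comment> \<open>If neither dumbbell through \<open>X3\<close> dominates the degree of
    \<open>z\<close>, both alternating sums equal that of \<open>w3\<close>, and the potentials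
    agree at \<open>x\<close>. If one of them does, the support of \<open>z\<close> meets the other
    block only inside \<open>T\<close>.\<close>
  show False
  proof (cases "(\<exists>v. count_list (o1 @ w3) v < vdeg z v) \<and> (\<exists>v. count_list (o2 @ w3) v < vdeg z v)")
    case True
    have al: "alt_sum f x os = alt_sum f x w3" if os: "odd_closed E X x os" "X \<subseteq> V" "\<exists>v. count_list (os @ w3) v < vdeg z v" for os X
    proof -
      have w: "walk_from E X x os x" "odd (length os)" using os(1) unfolding odd_closed_def by auto
      have "walk_from E V x (os @ w3) x" by (rule walk_from_appendI[OF walk_from_mono[OF w(1) os(2)] w3(1)])
      then have "alt_sum f x (os @ w3) = 0" using killsD[OF f(2)] os(3) w(2) w3(2) by (metis even_add length_append)
      then show ?thesis using alt_sum_append[OF w(1), of f w3] w(2) by simp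
    qed
    have "alt_sum f x o1 = alt_sum f x o2"
      using al[OF o1 blkD(1)[OF X(1)]] al[OF o2 blkD(1)[OF X(2)]] True by simp
    moreover have "alt_sum f x o1 = 2 * g1 x" "alt_sum f x o2 = 2 * g2 x"
      using alt_sum_potential[OF g1, of x o1 x] alt_sum_potential[OF g2, of x o2 x] o1 o2 unfolding odd_closed_def by auto
    ultimately have "g1 x = g2 x" by simp
    then obtain g where "potential E f (X1 \<union> X2) g" using potential_glue[OF L g1 subset_refl x(2) g2] by auto
    then show False using no_potential_on[OF z(1) f(1) sup] by blast
  next
    case False
    then consider "\<And>v. vdeg z v \<le> count_list (o1 @ w3) v" | "\<And>v. vdeg z v \<le> count_list (o2 @ w3) v"
      by (meson not_le)
    then show False
    proof cases
      case 1
      have "v \<in> X1 \<union> T" if "0 < vdeg z v" for v using count_list_pos[OF 1 that] so(1) sw3 by auto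
      then have s: "vsupp z \<subseteq> X1 \<union> (X2 \<inter> T)" using sup by blast
      obtain g where "potential E f (X1 \<union> (X2 \<inter> T)) g"
        using potential_glue_bip[OF L g1 g2, of "X2 \<inter> T"] bip[OF X(2)] X(6) x xT by blast
      then show False using no_potential_on[OF z(1) f(1) s] by blast
    next
      case 2
      have "v \<in> X2 \<union> T" if "0 < vdeg z v" for v using count_list_pos[OF 2 that] so(2) sw3 by auto
      then have s: "vsupp z \<subseteq> X2 \<union> (X1 \<inter> T)" using sup by blast
      obtain g where "potential E f (X2 \<union> (X1 \<inter> T)) g"
        using potential_glue_bip[OF linked_sym[OF L] g2 g1, of "X1 \<inter> T"] bip[OF X(1)] X(5) x xT by blast
      then show False using no_potential_on[OF z(1) f(1) s] by blast
    qed
  qed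
qed

text \<open>With \<open>y\<close> as the only neighbour of \<open>x\<close> in \<open>D\<close>, the
  dumbbell of \<open>D\<close> and an odd walk in \<open>X1\<close> would give \<open>y\<close>
  degree two, against \<open>linked_degree_le_1\<close>.\<close>

lemma hole_second_neighbour:
  assumes X: "blk X1" "blk X2" "X1 \<noteq> X2" "x \<in> X1" "x \<in> X2" "has_odd E X1" "has_odd E X2"
    and D: "odd_hole E D" "D \<subseteq> X2" "x \<notin> D" and y: "y \<in> D" "{x, y} \<in> E"
  obtains y' where "y' \<in> D" "y' \<noteq> y" "{x, y'} \<in> E"
proof (rule ccontr)
  assume "\<not> thesis"
  then have uniq: "\<forall>u\<in>D. {x, u} \<in> E \<longrightarrow> u = y" using that by blast
  have L: "linked X1 X2 x x" by (rule blk_linked_vertex[OF X(1-5)])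
  obtain os where os: "odd_closed E X1 x os" using odd_closed_at[OF blkD(3)[OF X(1)] X(6,4)] by blast
  obtain ds where ds: "odd_closed E D y ds" "set ds = D" using odd_hole_closed[OF D(1) y(1)] by metis
  define U where "U = X1 \<union> X2"
  have dw: "walk_from E D y ds y" "odd (length ds)" using ds unfolding odd_closed_def by auto
  have "walk_from E U y ds y" by (rule walk_from_mono[OF dw(1)]) (use D(2) in \<open>auto simp: U_def\<close>)
  then have "walk_from E U y (ds @ [x]) x"
    by (rule walk_from_appendI) (use y D(2) X(4) in \<open>auto simp: U_def insert_commute\<close>)
  then have W1: "walk_from E U x ((y # ds) @ [x]) x" using y X(4) by (simp add: U_def)
  have ev: "even (length (y # ds))" using dw(2) by simp
  have sD: "set (y # ds) \<subseteq> D" using ds y by auto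
  have ow: "walk_from E X1 x os x" "odd (length os)" using os unfolding odd_closed_def by auto
  have W2: "odd_closed E U x os" unfolding odd_closed_def using walk_from_mono[OF ow(1), of U] ow(2) by (simp add: U_def)
  have so: "set os \<subseteq> X1" using walk_from_ends[OF ow(1)] by auto
  have dis: "set os \<inter> D = {}" using so D(2,3) blk_inter[OF X(1-3) X(4,5)] by blast
  have sep: "\<forall>u\<in>D. \<forall>v\<in>set os. v \<noteq> x \<longrightarrow> {u, v} \<notin> E"
  proof (intro ballI impI)
    fix u v assume "u \<in> D" "v \<in> set os" "v \<noteq> x"
    then have "{v, u} \<notin> E" using linked_no_edge(1)[OF L, of v u] so D(2,3) by blast
    then show "{u, v} \<notin> E" by (simp add: insert_commute)
  qed
  obtain z w where z: "minimal_pair z w" "\<And>v. vdeg z v \<le> count_list ((y # ds) @ x # os) v" "2 \<le> vdeg z x"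
    "\<forall>y. (\<forall>u\<in>D. {x, u} \<in> E \<longrightarrow> u = y) \<longrightarrow> 2 \<le> vdeg z y"
    using dumbbell[OF D(3) W1 ev sD W2 dis sep] by metis
  have "v \<in> X1 \<union> X2" if "v \<in> vsupp z" for v
    using count_list_pos[OF z(2), of v] that sD so D(2) X(4) by auto
  then have "vsupp z \<subseteq> X1 \<union> X2" by blast
  moreover have "y \<noteq> x" using y D by auto
  ultimately have "vdeg z y \<le> 1" using linked_degree_le_1[OF X(1,2) L X(6,7) z(1) _ z(3)] by blast
  then show False using z(4) uniq by fastforce
qed

text \<open>The weighting \<open>J\<close> has a potential on \<open>D\<close> and on \<open>insert x (D - {m})\<close>, but not on \<open>insert x D\<close>; it therefore detects a
  minimal binomial through both \<open>x\<close> and \<open>m\<close>.\<close>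
lemma no_two_holes_avoiding:
  assumes X: "blk X" "x \<in> X"
    and uniq: "\<And>C C'. odd_hole E C \<Longrightarrow> C \<subseteq> X \<Longrightarrow> x \<in> C \<Longrightarrow> odd_hole E C' \<Longrightarrow> C' \<subseteq> X \<Longrightarrow> x \<in> C' \<Longrightarrow> C = C'"
    and D: "odd_hole E D" "D \<subseteq> X" "x \<notin> D" "y \<in> D" "y' \<in> D" "y \<noteq> y'" "{x, y} \<in> E" "{x, y'} \<in> E"
    and D': "odd_hole E D'" "D' \<subseteq> X" "x \<notin> D'" "q \<in> D'" "q' \<in> D'" "q \<noteq> q'" "{x, q} \<in> E" "{x, q'} \<in> E"
    and m: "m \<in> D" "m \<notin> D'"
  shows False
proof -
  have inD: "\<exists>C. odd_hole E C \<and> x \<in> C \<and> C \<subseteq> insert x (D - {d})"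
    if D: "odd_hole E D" "x \<notin> D" and d: "d \<in> D" "has_odd E (insert x (D - {d}))" for D d
  proof -
    obtain C where C: "C \<subseteq> insert x (D - {d})" "odd_hole E C" using odd_hole_exists[OF d(2)] by metis
    have "x \<in> C"
    proof (rule ccontr)
      assume "x \<notin> C"
      then have "C \<subset> D" using C(1) d(1) by blast
      then show False using D(1) C(2) unfolding odd_hole_def by blast
    qed
    then show ?thesis using C by blast
  qed
  obtain d where d: "d \<in> D" "has_odd E (insert x (D - {d}))" using odd_hole_two_neighbours[OF D(1,3-8)] by metis
  obtain C where C: "odd_hole E C" "x \<in> C" "C \<subseteq> insert x (D - {d})" using inD[OF D(1,3) d] by blast
  obtain d' where d': "d' \<in> D'" "has_odd E (insert x (D' - {d'}))" using odd_hole_two_neighbours[OF D'(1,3-8)] by metis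
  obtain C' where C': "odd_hole E C'" "x \<in> C'" "C' \<subseteq> insert x (D' - {d'})" using inD[OF D'(1,3) d'] by blast
  have CX: "C \<subseteq> X" "C' \<subseteq> X" using C(3) C'(3) D(2) D'(2) X(2) by auto
  \<comment> \<open>Each of \<open>D\<close> and \<open>D'\<close> produces the unique hole through
    \<open>x\<close>; so apart from \<open>x\<close> it lies in their intersection and misses
    \<open>m\<close>.\<close>
  have "C = C'" using uniq[OF C(1) CX(1) C(2) C'(1) CX(2) C'(2)] .
  then have CDD: "C \<subseteq> insert x (D \<inter> D')" using C(3) C'(3) by blast
  have mC: "m \<notin> C" "m \<noteq> x" using CDD m D(3) by auto
  \<comment> \<open>A vertex \<open>d\<close> of \<open>D\<close> whose removal leaves an odd walk
    in \<open>insert x (D - {d})\<close> is off \<open>C\<close>; this is contradicted at the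
    end.\<close>
  have hit: "C \<subseteq> insert x (D - {d})" if dd: "d \<in> D" "has_odd E (insert x (D - {d}))" for d
  proof -
    obtain C1 where C1: "odd_hole E C1" "x \<in> C1" "C1 \<subseteq> insert x (D - {d})" using inD[OF D(1,3) dd] by blast
    then have "C1 = C" using uniq[OF C1(1) _ C1(2) C(1) CX(1) C(2)] D(2) X(2) by blast
    then show ?thesis using C1 by simp
  qed
  have oC: "has_odd E C" using C(1) unfolding odd_hole_def by blast
  have bipD: "\<not> has_odd E (D - {d})" if "d \<in> D" for d
    using D(1) that unfolding odd_hole_def by (metis Diff_subset insert_Diff insert_iff psubsetI Diff_iff singletonI)
  define Y where "Y = insert x D"
  have cY: "conn E Y" unfolding Y_def using conn_insert[OF odd_hole_conn(1)[OF D(1)] D(4), of x] D(7) by (simp add: insert_commute)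
  obtain s :: "'v \<Rightarrow> real" where s: "\<And>v. s v = 1 \<or> s v = -1"
    "\<And>u v. u \<in> D - {m} \<Longrightarrow> v \<in> D - {m} \<Longrightarrow> {u, v} \<in> E \<Longrightarrow> s v = - s u" using two_colouring[OF bipD[OF m(1)]] by metis
  \<comment> \<open>\<open>J\<close> lives on the spokes from \<open>x\<close> to
    \<open>D - {m}\<close> and takes there the colour of the outer end, which \<open>SOME\<close>
    reads off. So \<open>s\<close>, set to \<open>0\<close> at \<open>x\<close>, is a potential once
    \<open>m\<close> is removed.\<close>
  define J where "J e = (if \<exists>v\<in>D - {m}. e = {x, v} then s (SOME v. e = {x, v}) else 0)" for e
  have Jx: "J {x, v} = s v" if "v \<in> D - {m}" for v
  proof -
    have "(SOME u. {x, v} = {x, u}) = v" by (rule some_equality) (auto simp: doubleton_eq_iff)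
    then show ?thesis unfolding J_def using that by auto
  qed
  have JD: "J {u, v} = 0" if "u \<in> D" "v \<in> D" for u v
    unfolding J_def using that D(3) by (auto simp: doubleton_eq_iff)
  have pot_spoke: "potential E h (insert x S) (k(x := c))"
    if "potential E h S k" "x \<notin> S" "\<And>v. v \<in> S \<Longrightarrow> {x, v} \<in> E \<Longrightarrow> h {x, v} = c + k v" for h S k c
    unfolding potential_def
  proof (intro ballI impI)
    fix u v assume uv: "u \<in> insert x S" "v \<in> insert x S" "{u, v} \<in> E"
    have ne: "u \<noteq> v" using uv no_loop by auto
    have cm: "{u, v} = {v, u}" by auto
    consider "u = x" "v \<in> S" | "v = x" "u \<in> S" | "u \<in> S" "v \<in> S" using uv ne by blast
    then show "h {u, v} = (k(x := c)) u + (k(x := c)) v"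
    proof cases
      case 1
      then show ?thesis using that(3)[of v] uv that(2) by auto
    next
      case 2
      then have "h {x, u} = c + k u" using that(3)[of u] uv cm by auto
      then show ?thesis using 2 cm that(2) by auto
    next
      case 3
      then show ?thesis using potentialD[OF that(1) 3 uv(3)] that(2) by auto
    qed
  qed
  have pJ1: "potential E J D (\<lambda>_. 0)" unfolding potential_def using JD by auto
  have "potential E J (D - {m}) s" unfolding potential_def using JD s(2) by fastforce
  then have pJ2: "potential E J (insert x (D - {m})) (s(x := 0))" using pot_spoke[of J "D - {m}" s 0] D(3) Jx by auto
  have hoD: "has_odd E D" using D(1) unfolding odd_hole_def by blast
  \<comment> \<open>On the odd hole \<open>D\<close> such a potential would be zero, hence
    \<open>s\<close> constant along the spokes. Then the colouring would extend to \<open>x\<close>,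
    although \<open>C\<close> is odd.\<close>
  have "\<not> (\<exists>g. potential E J Y g)"
  proof
    assume "\<exists>g. potential E J Y g"
    then obtain g where g: "potential E J Y g" by blast
    have gD: "potential E J D g" using potential_subset[OF g] unfolding Y_def by auto
    have g0: "g v = 0" if "v \<in> D" for v
      using potential_unique[OF odd_hole_conn(1)[OF D(1)] hoD gD pJ1 that] .
    have sx: "s v = g x" if "v \<in> D - {m}" "{x, v} \<in> E" for v
      using Jx[OF that(1)] potentialD[OF g, of x v] that g0[of v] unfolding Y_def by auto
    have "potential E (\<lambda>_. 0) (D - {m}) s" unfolding potential_def using s(2) by fastforce
    then have p0: "potential E (\<lambda>_. 0) (insert x (D - {m})) (s(x := - g x))"
      using pot_spoke[of "\<lambda>_. 0" "D - {m}" s "- g x"] D(3) sx by auto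
    have gx: "g x \<noteq> 0"
    proof -
      have "\<exists>v. v \<in> D - {m} \<and> {x, v} \<in> E" using D(4-8) by (cases "y = m") auto
      then show ?thesis using sx s(1) by (metis one_neq_zero neg_equal_0_iff_equal)
    qed
    have "\<not> has_odd E (insert x (D - {m}))"
    proof (rule colouring_no_odd[of _ "s(x := - g x)"])
      show "(s(x := - g x)) v \<noteq> 0" for v using s(1)[of v] gx by auto
      show "(s(x := - g x)) v = - (s(x := - g x)) u"
        if "u \<in> insert x (D - {m})" "v \<in> insert x (D - {m})" "{u, v} \<in> E" for u v
        using potentialD[OF p0 that] by linarith
    qed
    moreover have "C \<subseteq> insert x (D - {m})" using CDD mC m by blast
    ultimately show False using has_odd_mono[OF oC] by blast
  qed
  then obtain a xs where ax: "walk_from E Y a xs a" "even (length xs)" "alt_sum J a xs \<noteq> 0"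
    using potential_exists[OF cY] by blast
  obtain z w where z: "minimal_pair z w" "weight J z \<noteq> weight J w" "\<And>v. vdeg z v \<le> count_list xs v"
    using minimal_move_walk[OF ax] by metis
  have zY: "vsupp z \<subseteq> Y" using count_list_pos[OF z(3)] walk_from_ends[OF ax(1)] by blast
  have zm: "z \<in> mon" "w \<in> mon" "edge_mono z = edge_mono w" using z(1) unfolding minimal_pair_def by auto
  have xz: "0 < vdeg z x"
  proof (rule ccontr)
    assume "\<not> 0 < vdeg z x"
    then have "x \<notin> vsupp z" by simp
    then have "vsupp z \<subseteq> D" using subset_insert[of x "vsupp z" D] zY unfolding Y_def by metis
    from no_potential_on[OF z(1,2) this] show False using pJ1 by blast
  qed
  have mz: "0 < vdeg z m"
  proof (rule ccontr)
    assume "\<not> 0 < vdeg z m"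
    then have "m \<notin> vsupp z" by simp
    moreover have "insert x D - {m} = insert x (D - {m})" using mC by auto
    ultimately have "vsupp z \<subseteq> insert x (D - {m})" using zY unfolding Y_def by (metis subset_Diff_insert Diff_empty)
    from no_potential_on[OF z(1,2) this] show False using pJ2 by blast
  qed
  obtain f where f: "weight f z \<noteq> weight f w" "kills f z" using kills_exists[OF z(1)] by blast
  have pot_minus: "\<exists>g. potential E f (X - {v}) g" if "0 < vdeg z v" for v
  proof (rule potential_exists)
    show "conn E (X - {v})" using blkD(4)[OF X(1)] .
    fix a xs assume w: "walk_from E (X - {v}) a xs a" "even (length xs)"
    then have "count_list xs v = 0" using walk_from_ends[OF w(1)] by (auto simp: count_list_0_iff)
    then show "alt_sum f a xs = 0" using killsD[OF f(2) w] that by metis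
  qed
  obtain g where g: "potential E f (X - {x}) g" using pot_minus[OF xz] by blast
  obtain g' where g': "potential E f (X - {m}) g'" using pot_minus[OF mz] by blast
  \<comment> \<open>A connected non-bipartite set avoiding both \<open>x\<close> and
    \<open>m\<close>; its two parts meet in a vertex of \<open>C\<close>. On it the potentials for
    the removal of \<open>x\<close> and of \<open>m\<close> coincide.\<close>
  define K where "K = D' \<union> (D - {m})"
  have "\<exists>c. c \<in> C \<and> c \<noteq> x"
  proof (rule ccontr)
    assume "\<not> ?thesis"
    then have "C \<subseteq> {x}" by blast
    then have "card C \<le> card {x}" by (intro card_mono) auto
    then show False using odd_hole_conn(4)[OF C(1)] by simp
  qed
  then obtain c where c: "c \<in> C" "c \<noteq> x" by blast
  have cK: "conn E K" unfolding K_def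
    using c CDD mC by (intro conn_union odd_hole_conn(1)[OF D'(1)] odd_hole_conn(2)[OF D(1)]) blast
  have oK: "has_odd E K" using D'(1) has_odd_mono[of E D' K] unfolding odd_hole_def K_def by blast
  have KX: "K \<subseteq> X - {x}" "K \<subseteq> X - {m}" unfolding K_def using D(2,3) D'(2,3) m by auto
  have gg': "g v = g' v" if "v \<in> K" for v
    using potential_unique[OF cK oK potential_subset[OF g KX(1)] potential_subset[OF g' KX(2)] that] .
  have DX: "D \<subseteq> X - {x}" using D(2,3) by auto
  have spoke: "f {x, v} = g' x + g v" if "v \<in> D - {m}" "{x, v} \<in> E" for v
  proof -
    have "f {x, v} = g' x + g' v" using potentialD[OF g', of x v] that X(2) mC D(2) by auto
    then show ?thesis using gg'[of v] that unfolding K_def by simp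
  qed
  \<comment> \<open>The defect of \<open>f\<close> at \<open>{x, m}\<close>. After its correction
    \<open>f\<close> has a potential on \<open>Y\<close>, so this edge is what separates
    \<open>z\<close> from \<open>w\<close>.\<close>
  define \<kappa> where "\<kappa> = f {x, m} - g' x - g m"
  define f' where "f' e = (if e = {x, m} then f e - \<kappa> else f e)" for e
  have f'D: "f' {u, v} = f {u, v}" if "u \<in> D" "v \<in> D" for u v
    unfolding f'_def using that D(3) by (auto simp: doubleton_eq_iff)
  have pf': "potential E f' Y (g(x := g' x))" unfolding Y_def
  proof (rule pot_spoke)
    show "potential E f' D g" unfolding potential_def using f'D potentialD[OF g] DX by (metis subsetD)
    show "x \<notin> D" by fact
    show "f' {x, v} = g' x + g v" if v: "v \<in> D" "{x, v} \<in> E" for v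
    proof (cases "v = m")
      case True
      then show ?thesis unfolding f'_def \<kappa>_def by simp
    next
      case False
      then have "{x, v} \<noteq> {x, m}" by (auto simp: doubleton_eq_iff)
      then show ?thesis using spoke[of v] v False unfolding f'_def by auto
    qed
  qed
  have wf': "weight f' z = weight f' w"
    using no_potential_on[OF z(1) _ zY] pf' by blast
  have xmE: "{x, m} \<in> E"
  proof (rule ccontr)
    assume n: "{x, m} \<notin> E"
    have "weight f' t = weight f t" for t unfolding weight_def f'_def using n by (intro sum.cong) auto
    then show False using wf' f(1) by simp
  qed
  have wfd: "weight f t = weight f' t + \<kappa> * real (lookup t {x, m})" for t
  proof -
    have "weight f t - weight f' t = (\<Sum>e\<in>E. if e = {x, m} then \<kappa> * real (lookup t e) else 0)"
      unfolding weight_def sum_subtractf[symmetric] f'_def by (intro sum.cong) (auto simp: algebra_simps)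
    also have "\<dots> = \<kappa> * real (lookup t {x, m})" using finite_E xmE by simp
    finally show ?thesis by simp
  qed
  have k0: "\<kappa> \<noteq> 0" and lne: "lookup z {x, m} \<noteq> lookup w {x, m}"
    using f(1) wf' wfd[of z] wfd[of w] by auto
  \<comment> \<open>The exponents of \<open>{x, m}\<close> differ within the fibre, so a monomial
    with the smaller exponent must cover \<open>m\<close> by a further edge \<open>{m, n}\<close>.
    This puts \<open>n\<close> into the support as well.\<close>
  have "\<exists>t t'. t \<in> mon \<and> t' \<in> mon \<and> edge_mono t = edge_mono z \<and> edge_mono t' = edge_mono z \<and>
      lookup t {x, m} < lookup t' {x, m}"
    using lne zm by (metis linorder_neqE_nat)
  then obtain t t' where t: "t \<in> mon" "t' \<in> mon" "edge_mono t = edge_mono z" "edge_mono t' = edge_mono z"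
    "lookup t {x, m} < lookup t' {x, m}" by blast
  define M where "M = {e\<in>E. m \<in> e}"
  have fM: "finite M" "{x, m} \<in> M" unfolding M_def using finite_E xmE by auto
  have "\<exists>e\<in>M - {{x, m}}. lookup t e > 0"
  proof (rule ccontr)
    assume "\<not> ?thesis"
    then have "(\<Sum>e\<in>M - {{x, m}}. lookup t e) = 0" by auto
    then have "vdeg t m = lookup t {x, m}"
      using sum.remove[OF fM, of "lookup t"] vdeg_eq[OF t(1), of m] unfolding M_def by simp
    moreover have "lookup t' {x, m} \<le> vdeg t' m"
      using sum.remove[OF fM, of "lookup t'"] vdeg_eq[OF t(2), of m] unfolding M_def by simp
    ultimately show False using t(3-5) by simp
  qed
  then obtain e where e: "e \<in> E" "m \<in> e" "e \<noteq> {x, m}" "lookup t e > 0" unfolding M_def by blast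
  obtain n where n: "n \<noteq> m" "e = {m, n}" using edge_memE[OF e(1,2)] by metis
  have "vdeg t n \<ge> lookup t e" unfolding vdeg_eq[OF t(1)] using e(1) n finite_E
    by (intro member_le_sum) auto
  then have nz: "0 < vdeg z n" using e(4) t(3) by simp
  have "n \<noteq> x" using n(2) e(3) by (auto simp: insert_commute)
  then have nD: "n \<in> D" using nz zY unfolding Y_def by blast
  obtain g3 where g3: "potential E f (X - {n}) g3" using pot_minus[OF nz] by blast
  obtain r :: "'v \<Rightarrow> real" where r: "\<And>v. r v = 1 \<or> r v = -1"
    "\<And>u v. u \<in> D - {n} \<Longrightarrow> v \<in> D - {n} \<Longrightarrow> {u, v} \<in> E \<Longrightarrow> r v = - r u" using two_colouring[OF bipD[OF nD]] by metis
  have pr: "potential E (\<lambda>_. 0) (D - {n}) r" unfolding potential_def using r(2) by fastforce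
  have cDn: "conn E (D - {n})" using odd_hole_conn(2)[OF D(1)] .
  have zero: "alt_sum (\<lambda>_. 0) c ys = 0" for c and ys :: "'v list" by (induction ys arbitrary: c) auto
  \<comment> \<open>An even path from \<open>m\<close> to \<open>p\<close> avoiding
    \<open>n\<close>, compared through the potential \<open>g3\<close> that exists after removing
    \<open>n\<close>, would make the defect \<open>\<kappa>\<close> zero.\<close>
  have opp: "r p = - r m" if p: "p \<in> D - {n}" "p \<noteq> m" "{x, p} \<in> E" for p
  proof (rule ccontr)
    assume np: "r p \<noteq> - r m"
    have mD: "m \<in> D - {n}" using m n by auto
    obtain us where us: "walk_from E (D - {n}) m us p" using cDn mD p(1) unfolding conn_def by blast
    have "r m = (-1) ^ length us * r p" using alt_sum_potential[OF pr us] zero by simp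
    then have ev: "even (length us)" using np r(1)[of p] by (cases "even (length us)") auto
    have s1: "D - {n} \<subseteq> X - {x}" "D - {n} \<subseteq> X - {n}" using D(2,3) by auto
    have "g m - g p = g3 m - g3 p"
      using alt_sum_potential[OF potential_subset[OF g s1(1)] us] alt_sum_potential[OF potential_subset[OF g3 s1(2)] us] ev by simp
    moreover have "f {x, m} = g3 x + g3 m" "f {x, p} = g3 x + g3 p"
      using potentialD[OF g3, of x m] potentialD[OF g3, of x p] xmE p X(2) \<open>n \<noteq> x\<close> D(2) mD by auto
    moreover have "f {x, p} = g' x + g p" using spoke[of p] p by simp
    ultimately have "f {x, m} = g' x + g m" by linarith
    then show False using k0 unfolding \<kappa>_def by simp
  qed
  \<comment> \<open>So the colouring of \<open>D - {n}\<close> extends to \<open>x\<close> when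
    \<open>m\<close> is left out, and \<open>C\<close> must pass through \<open>n\<close>. Yet the
    spokes to \<open>m\<close> and to a second neighbour \<open>p\<close> close up to an odd walk
    avoiding \<open>n\<close>, against \<open>hit\<close>.\<close>
  have "\<not> has_odd E (insert x (D - {n} - {m}))"
  proof (rule colouring_no_odd[of _ "r(x := r m)"])
    have p0: "potential E (\<lambda>_. 0) (insert x (D - {n} - {m})) (r(x := r m))"
    proof (rule pot_spoke)
      show "potential E (\<lambda>_. 0) (D - {n} - {m}) r" by (rule potential_subset[OF pr]) auto
      show "x \<notin> D - {n} - {m}" using D(3) by auto
      show "0 = r m + r v" if "v \<in> D - {n} - {m}" "{x, v} \<in> E" for v using opp[of v] that by auto
    qed
    show "(r(x := r m)) v \<noteq> 0" for v using r(1)[of v] r(1)[of m] by auto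
    show "(r(x := r m)) v = - (r(x := r m)) u"
      if "u \<in> insert x (D - {n} - {m})" "v \<in> insert x (D - {n} - {m})" "{u, v} \<in> E" for u v
      using potentialD[OF p0 that] by linarith
  qed
  then have "\<not> C \<subseteq> insert x (D - {n} - {m})" using has_odd_mono[OF oC] by blast
  then have nC: "n \<in> C" using CDD mC by blast
  obtain tt where tt: "walk_from E C x (tt @ [x]) x" "distinct (x # tt)" "insert x (set tt) = C" "even (length tt)" "tt \<noteq> []"
    using odd_hole_cycle[OF C(1,2)] by metis
  have hl: "{x, hd tt} \<in> E" "{x, last tt} \<in> E" "hd tt \<noteq> last tt"
  proof -
    obtain h tt' where h: "tt = h # tt'" using tt(5) by (cases tt) auto
    then show "{x, hd tt} \<in> E" using tt(1) by simp
    obtain b where b: "walk_from E C x tt b" "walk_from E C b [x] x" using tt(1) walk_from_append by metis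
    have "b = last tt" using walk_from_ends[OF b(1)] tt(5) by auto
    then show "{x, last tt} \<in> E" using b(2) by (simp add: insert_commute)
    have "tt' \<noteq> []" using tt(4) h by auto
    then show "hd tt \<noteq> last tt" using tt(2) h by auto
  qed
  have "\<exists>p. p \<in> set tt \<and> p \<noteq> n \<and> {x, p} \<in> E" using hl tt(5) by (metis hd_in_set last_in_set)
  then obtain p where p: "p \<in> set tt" "p \<noteq> n" "{x, p} \<in> E" by blast
  have pD: "p \<in> D - {n}" "p \<noteq> m" using p tt(2,3) CDD mC by auto
  have mD: "m \<in> D - {n}" using m n by auto
  obtain us where us: "walk_from E (D - {n}) m us p" using cDn mD pD(1) unfolding conn_def by blast
  have "r m = (-1) ^ length us * r p" using alt_sum_potential[OF pr us] zero by simp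
  then have od: "odd (length us)" using opp[OF pD p(3)] r(1)[of m] by (cases "even (length us)") auto
  define S where "S = insert x (D - {n})"
  have "walk_from E S m us p" by (rule walk_from_mono[OF us]) (auto simp: S_def)
  then have "walk_from E S m (us @ [x]) x" by (rule walk_from_appendI) (use p pD in \<open>auto simp: S_def insert_commute\<close>)
  then have "walk_from E S x (m # us @ [x]) x" using xmE by (simp add: S_def)
  then have "has_odd E S" using od unfolding has_odd_def odd_closed_def by (metis even_Suc length_Cons length_append_singleton)
  then show False using hit[OF nD] nC \<open>n \<noteq> x\<close> unfolding S_def by blast
qed

end

section \<open>The odd cycle condition\<close>

context vgraph
begin

definition odd_blocks :: "'v set set" where
  "odd_blocks = {X. blk X \<and> has_odd E X}"

definition holes :: "'v set \<Rightarrow> 'v set set" where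
  "holes X = {C. odd_hole E C \<and> C \<subseteq> X}"

definition strong :: "'v set \<Rightarrow> 'v set \<Rightarrow> bool" where
  "strong X Y \<longleftrightarrow> card (holes X) = 1 \<and> card (holes Y) = 1 \<and> touch E X Y \<or>
     (card (holes X) = 1 \<and> card (holes Y) = 2 \<or> card (holes X) = 2 \<and> card (holes Y) = 1) \<and> X \<inter> Y \<noteq> {}"

lemma strong_sym: "strong X Y \<Longrightarrow> strong Y X"
  unfolding strong_def using touch_sym by (metis inf_commute)

lemma finite_odd_blocks: "finite odd_blocks"
proof -
  have "odd_blocks \<subseteq> Pow V" unfolding odd_blocks_def using blkD(1) by blast
  then show ?thesis using finite_V finite_subset by blast
qed

lemma unique_hole:
  assumes "card (holes X) = 1" "odd_hole E D" "D \<subseteq> X" "odd_hole E C" "C \<subseteq> X"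
  shows "C = D"
proof -
  obtain H where "holes X = {H}" using assms(1) card_1_singletonE by metis
  moreover have "C \<in> holes X" "D \<in> holes X" using assms(2-5) unfolding holes_def by simp_all
  ultimately show ?thesis by simp
qed

lemma blk_linkedI:
  assumes "blk X1" "blk X2" "X1 \<noteq> X2" "touch E X1 X2"
  obtains u v where "linked X1 X2 u v" "X1 \<inter> X2 \<noteq> {} \<Longrightarrow> u = v"
proof (cases "X1 \<inter> X2 = {}")
  case True
  then obtain a b where "a \<in> X1" "b \<in> X2" "{a, b} \<in> E" using assms(4) unfolding touch_def by blast
  then show ?thesis using blk_linked_edge[OF assms(1,2) True] that True by blast
next
  case False
  then obtain x where "x \<in> X1" "x \<in> X2" by blast
  then show ?thesis using blk_linked_vertex[OF assms(1-3)] that by blast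
qed

lemma hole_in_blk:
  assumes "has_odd E X"
  obtains C where "odd_hole E C" "C \<subseteq> X"
  using odd_hole_exists[OF assms] by metis

end

context cgraph
begin

text \<open>If the holes do not touch, then at each block with a single hole the link has distinct
  ends, one of them in that hole. A shared vertex excludes this at once; if both blocks have a
  single hole, the link itself is an edge between the holes.\<close>

lemma strong_touch:
  assumes X: "blk X1" "blk X2" "X1 \<noteq> X2" "strong X1 X2"
    and C: "odd_hole E C1" "C1 \<subseteq> X1" "odd_hole E C2" "C2 \<subseteq> X2"
  shows "touch E C1 C2"
proof (rule ccontr)
  assume nt: "\<not> touch E C1 C2"
  then have nt': "\<not> touch E C2 C1" using touch_sym by blast
  have "touch E X1 X2" using X(4) unfolding strong_def touch_def by blast
  then obtain u v where L: "linked X1 X2 u v" "X1 \<inter> X2 \<noteq> {} \<Longrightarrow> u = v" using blk_linkedI[OF X(1-3)] by blast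
  have one: "u \<noteq> v \<and> u \<in> C1" if "card (holes X1) = 1"
    using nontouching_unique_hole[OF X(1,2) L(1) C(1,2) _ C(3,4) nt] unique_hole[OF that C(1,2)] by blast
  have two: "v \<noteq> u \<and> v \<in> C2" if "card (holes X2) = 1"
    using nontouching_unique_hole[OF X(2,1) linked_sym[OF L(1)] C(3,4) _ C(1,2) nt'] unique_hole[OF that C(3,4)] by blast
  show False
  proof (cases "card (holes X1) = 1 \<and> card (holes X2) = 1")
    case True
    then have uv: "u \<noteq> v" "u \<in> C1" "v \<in> C2" using one two by auto
    then have "{u, v} \<in> E" using linked_cases[OF L(1)] by metis
    then show False using nt uv unfolding touch_def by blast
  next
    case False
    then show False using X(4) one two L(2) unfolding strong_def by metis
  qed
qed

text \<open>Holes through the link vertex are unique, so \<open>X1\<close> has just one. In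
  \<open>X2\<close> there is at most one through \<open>x\<close> and at most one avoiding
  \<open>x\<close>; a hole avoiding \<open>x\<close> must be touched from \<open>x\<close>, then by
  two edges, and so yields one through \<open>x\<close>.\<close>

lemma shared_vertex_types:
  assumes X: "blk X1" "blk X2" "X1 \<noteq> X2" "x \<in> X1" "x \<in> X2" "has_odd E X1" "has_odd E X2"
    and occ: "\<And>C C'. odd_hole E C \<Longrightarrow> odd_hole E C' \<Longrightarrow> touch E C C'"
    and all: "\<And>C. odd_hole E C \<Longrightarrow> C \<subseteq> X1 \<Longrightarrow> x \<in> C"
  shows "card (holes X1) = 1 \<and> (card (holes X2) = 1 \<or> card (holes X2) = 2)"
proof -
  have L: "linked X1 X2 x x" by (rule blk_linked_vertex[OF X(1-5)])
  obtain C1 where C1: "odd_hole E C1" "C1 \<subseteq> X1" using hole_in_blk[OF X(6)] by blast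
  have "C = C1" if "odd_hole E C" "C \<subseteq> X1" for C
    using hole_through_link_unique[OF X(2,1) linked_sym[OF L] X(7) that all[OF that] C1 all[OF C1]] .
  then have "holes X1 = {C1}" unfolding holes_def using C1 by blast
  then have one: "card (holes X1) = 1" by simp
  have uniq: "C = C'" if "odd_hole E C" "C \<subseteq> X2" "x \<in> C" "odd_hole E C'" "C' \<subseteq> X2" "x \<in> C'" for C C'
    using hole_through_link_unique[OF X(1,2) L X(6) that] .
  have nb: "\<exists>y y'. y \<in> D \<and> y' \<in> D \<and> y \<noteq> y' \<and> {x, y} \<in> E \<and> {x, y'} \<in> E" if D: "odd_hole E D" "D \<subseteq> X2" "x \<notin> D" for D
  proof -
    obtain u v where uv: "u \<in> C1" "v \<in> D" "u = v \<or> {u, v} \<in> E" using occ[OF C1(1) D(1)] unfolding touch_def by blast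
    have vx: "v \<noteq> x" using uv D by auto
    have "u = x"
    proof (rule ccontr)
      assume "u \<noteq> x"
      then have "u \<in> X1 - {x}" using uv C1 by auto
      then show False using linked_no_edge[OF L, of u v] uv D(2) vx by blast
    qed
    then have xv: "{x, v} \<in> E" using uv vx by auto
    obtain y' where "y' \<in> D" "y' \<noteq> v" "{x, y'} \<in> E" using hole_second_neighbour[OF X D uv(2) xv] by metis
    then show ?thesis using uv(2) xv by blast
  qed
  have av: "D = D'" if D: "odd_hole E D" "D \<subseteq> X2" "x \<notin> D" and D': "odd_hole E D'" "D' \<subseteq> X2" "x \<notin> D'" for D D'
  proof (rule ccontr)
    assume "D \<noteq> D'"
    then obtain m where m: "m \<in> D" "m \<notin> D'" using odd_hole_subset[OF D(1) D'(1)] by blast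
    obtain y y' where y: "y \<in> D" "y' \<in> D" "y \<noteq> y'" "{x, y} \<in> E" "{x, y'} \<in> E" using nb[OF D] by blast
    obtain q q' where q: "q \<in> D'" "q' \<in> D'" "q \<noteq> q'" "{x, q} \<in> E" "{x, q'} \<in> E" using nb[OF D'] by blast
    show False by (rule no_two_holes_avoiding[OF X(2,5) uniq D y D' q m])
  qed
  obtain C2 where C2: "odd_hole E C2" "C2 \<subseteq> X2" using hole_in_blk[OF X(7)] by blast
  show ?thesis
  proof (cases "\<exists>D. odd_hole E D \<and> D \<subseteq> X2 \<and> x \<notin> D")
    case False
    then have "holes X2 = {C2}" unfolding holes_def using uniq C2 by blast
    then show ?thesis using one by simp
  next
    case True
    then obtain D where D: "odd_hole E D" "D \<subseteq> X2" "x \<notin> D" by blast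
    obtain y y' where y: "y \<in> D" "y' \<in> D" "y \<noteq> y'" "{x, y} \<in> E" "{x, y'} \<in> E" using nb[OF D] by blast
    obtain d where d: "d \<in> D" "has_odd E (insert x (D - {d}))" using odd_hole_two_neighbours[OF D(1,3) y] by metis
    obtain C where C: "C \<subseteq> insert x (D - {d})" "odd_hole E C" using odd_hole_exists[OF d(2)] by metis
    have xC: "x \<in> C"
    proof (rule ccontr)
      assume "x \<notin> C"
      then have "C \<subset> D" using C(1) d(1) by blast
      then show False using D(1) C(2) unfolding odd_hole_def by blast
    qed
    have CX: "C \<subseteq> X2" using C(1) D(2) X(5) by blast
    have "H = C \<or> H = D" if "odd_hole E H" "H \<subseteq> X2" for H
      using uniq[OF that _ C(2) CX xC] av[OF that _ D] by blast
    then have "holes X2 = {C, D}" unfolding holes_def using C(2) CX D by blast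
    moreover have "C \<noteq> D" using xC D(3) by blast
    ultimately show ?thesis using one by simp
  qed
qed

text \<open>For disjoint blocks the only edge between them has to join every pair of holes, so all
  holes pass through its ends and are unique. For a shared vertex, holes avoiding it on both sides
  could not touch, so in one of the blocks all holes contain it.\<close>

lemma odd_cycle_condition_strong:
  assumes occ: "\<And>C C'. odd_hole E C \<Longrightarrow> odd_hole E C' \<Longrightarrow> touch E C C'"
    and X: "X1 \<in> odd_blocks" "X2 \<in> odd_blocks" "X1 \<noteq> X2"
  shows "strong X1 X2"
proof -
  have B: "blk X1" "blk X2" "has_odd E X1" "has_odd E X2" using X unfolding odd_blocks_def by auto
  obtain C1 where C1: "odd_hole E C1" "C1 \<subseteq> X1" using hole_in_blk[OF B(3)] by blast
  obtain C2 where C2: "odd_hole E C2" "C2 \<subseteq> X2" using hole_in_blk[OF B(4)] by blast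
  have t: "touch E X1 X2" using touch_mono[OF occ[OF C1(1) C2(1)] C1(2) C2(2)] .
  show ?thesis
  proof (cases "X1 \<inter> X2 = {}")
    case True
    then obtain a b where ab: "a \<in> X1" "b \<in> X2" "{a, b} \<in> E" using t unfolding touch_def by blast
    have L: "linked X1 X2 a b" by (rule blk_linked_edge[OF B(1,2) True ab])
    have key: "a \<in> C \<and> b \<in> C'" if C: "odd_hole E C" "C \<subseteq> X1" "odd_hole E C'" "C' \<subseteq> X2" for C C'
    proof -
      obtain u v where uv: "u \<in> C" "v \<in> C'" "u = v \<or> {u, v} \<in> E" using occ[OF C(1,3)] unfolding touch_def by blast
      then have e: "{u, v} \<in> E" "u \<in> X1" "v \<in> X2" using C True by auto
      show ?thesis using L
      proof (cases rule: linked_cases)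
        case 1
        then show ?thesis using True by blast
      next
        case 2
        then show ?thesis using 2(4)[OF e(2,3,1)] uv by blast
      qed
    qed
    have "C = C1" if C: "odd_hole E C" "C \<subseteq> X1" for C
      by (rule hole_through_link_unique[OF B(2,1) linked_sym[OF L] B(4) C _ C1]) (use key C C1 C2 in blast)+
    then have h1: "holes X1 = {C1}" unfolding holes_def using C1 by blast
    have "C = C2" if C: "odd_hole E C" "C \<subseteq> X2" for C
      by (rule hole_through_link_unique[OF B(1,2) L B(3) C _ C2]) (use key C C1 C2 in blast)+
    then have h2: "holes X2 = {C2}" unfolding holes_def using C2 by blast
    show ?thesis unfolding strong_def using h1 h2 t by simp
  next
    case False
    then obtain x where x: "x \<in> X1" "x \<in> X2" by blast
    have L: "linked X1 X2 x x" by (rule blk_linked_vertex[OF B(1,2) X(3) x])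
    have "(\<forall>C. odd_hole E C \<and> C \<subseteq> X1 \<longrightarrow> x \<in> C) \<or> (\<forall>C. odd_hole E C \<and> C \<subseteq> X2 \<longrightarrow> x \<in> C)"
    proof (rule ccontr)
      assume "\<not> ?thesis"
      then obtain C C' where C: "odd_hole E C" "C \<subseteq> X1" "x \<notin> C" "odd_hole E C'" "C' \<subseteq> X2" "x \<notin> C'" by blast
      obtain u v where uv: "u \<in> C" "v \<in> C'" "u = v \<or> {u, v} \<in> E" using occ[OF C(1,4)] unfolding touch_def by blast
      then have "u \<in> X1 - {x}" "v \<in> X2" "v \<noteq> x" using C by auto
      then show False using linked_no_edge[OF L, of u v] uv by blast
    qed
    then consider "\<And>C. odd_hole E C \<Longrightarrow> C \<subseteq> X1 \<Longrightarrow> x \<in> C" | "\<And>C. odd_hole E C \<Longrightarrow> C \<subseteq> X2 \<Longrightarrow> x \<in> C" by blast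
    then show ?thesis
    proof cases
      case 1
      have "card (holes X1) = 1 \<and> (card (holes X2) = 1 \<or> card (holes X2) = 2)"
        by (rule shared_vertex_types[OF B(1,2) X(3) x B(3,4) occ 1])
      then show ?thesis unfolding strong_def using t False by blast
    next
      case 2
      have "card (holes X2) = 1 \<and> (card (holes X1) = 1 \<or> card (holes X1) = 2)"
        by (rule shared_vertex_types[OF B(2,1) X(3)[symmetric] x(2,1) B(4,3) occ 2])
      then show ?thesis unfolding strong_def using t False by blast
    qed
  qed
qed

text \<open>Three such blocks are pairwise disjoint by \<open>no_three_blocks\<close> and pairwise
  joined by edges. Since a connected set outside a block attaches to it at one vertex only, these
  edges form a triangle, whose block would share a vertex with \<open>X1\<close> without being equal
  to it.\<close>

lemma odd_cycle_condition_two_blocks: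
  assumes cV: "conn E V" and occ: "\<And>C C'. odd_hole E C \<Longrightarrow> odd_hole E C' \<Longrightarrow> touch E C C'"
    and X: "X1 \<in> odd_blocks" "X2 \<in> odd_blocks" "X1 \<noteq> X2" "X3 \<in> odd_blocks" "X3 \<noteq> X1" "X3 \<noteq> X2"
  shows False
proof -
  have dis: "Y1 \<inter> Y2 = {}" if Y: "Y1 \<in> odd_blocks" "Y2 \<in> odd_blocks" "Y1 \<noteq> Y2" for Y1 Y2
  proof (rule ccontr)
    assume "Y1 \<inter> Y2 \<noteq> {}"
    then obtain x where x: "x \<in> Y1" "x \<in> Y2" by blast
    obtain Y3 where Y3: "Y3 \<in> odd_blocks" "Y3 \<noteq> Y1" "Y3 \<noteq> Y2" using X by metis
    show False using no_three_blocks[OF cV, of Y1 Y2 Y3 x] Y Y3 x unfolding odd_blocks_def by blast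
  qed
  have edge: "\<exists>a b. a \<in> Y1 \<and> b \<in> Y2 \<and> {a, b} \<in> E" if Y: "Y1 \<in> odd_blocks" "Y2 \<in> odd_blocks" "Y1 \<noteq> Y2" for Y1 Y2
  proof -
    obtain C where C: "odd_hole E C" "C \<subseteq> Y1" using Y hole_in_blk unfolding odd_blocks_def by blast
    obtain C' where C': "odd_hole E C'" "C' \<subseteq> Y2" using Y hole_in_blk unfolding odd_blocks_def by blast
    show ?thesis using touch_mono[OF occ[OF C(1) C'(1)] C(2) C'(2)] dis[OF Y] unfolding touch_def by blast
  qed
  have attach: "a = a'"
    if Y: "Y1 \<in> odd_blocks" "Y2 \<in> odd_blocks" "Y3 \<in> odd_blocks" "Y1 \<noteq> Y2" "Y1 \<noteq> Y3" "Y2 \<noteq> Y3"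
      and e: "a \<in> Y1" "b \<in> Y2" "{a, b} \<in> E" "a' \<in> Y1" "c \<in> Y3" "{a', c} \<in> E" for Y1 Y2 Y3 a b a' c
  proof -
    obtain p q where pq: "p \<in> Y2" "q \<in> Y3" "{p, q} \<in> E" using edge[OF Y(2,3,6)] by blast
    have b: "blk Y1" "conn E Y2" "conn E Y3" using Y blkD(3) unfolding odd_blocks_def by auto
    have cn: "conn E (Y2 \<union> Y3)" by (rule conn_join[OF b(2,3) pq])
    have "(Y2 \<union> Y3) \<inter> Y1 = {}" using dis Y by blast
    then show ?thesis using blk_attach[OF b(1) cn, of b c a a'] e by blast
  qed
  obtain a b where ab: "a \<in> X1" "b \<in> X2" "{a, b} \<in> E" using edge[OF X(1-3)] by blast
  obtain a' c where ac: "a' \<in> X1" "c \<in> X3" "{a', c} \<in> E" using edge[OF X(1,4) X(5)[symmetric]] by blast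
  obtain b' c' where bc: "b' \<in> X2" "c' \<in> X3" "{b', c'} \<in> E" using edge[OF X(2,4) X(6)[symmetric]] by blast
  have sy: "{b, a} \<in> E" "{c, a'} \<in> E" "{c', b'} \<in> E" using ab ac bc by (auto simp: insert_commute)
  have aa: "a = a'" by (rule attach[OF X(1,2,4,3) X(5)[symmetric] X(6)[symmetric] ab ac])
  have bb: "b = b'" by (rule attach[OF X(2,1,4) X(3)[symmetric] X(6)[symmetric] X(5)[symmetric] ab(2,1) sy(1) bc])
  have cc: "c = c'" by (rule attach[OF X(4,1,2,5,6,3) ac(2,1) sy(2) bc(2,1) sy(3)])
  define T where "T = {a, b, c}"
  have "walk_from E T a [b, c, a] a" using ab ac bc aa bb cc sy unfolding T_def by auto
  then have "has_odd E T" unfolding has_odd_def odd_closed_def by (intro exI[of _ a] exI[of _ "[b, c, a]"]) auto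
  then obtain C where C: "C \<subseteq> T" "odd_hole E C" using odd_hole_exists by metis
  have "card T \<le> 3" unfolding T_def by (simp add: card_insert_if)
  then have "C = T" using card_seteq[of T C] C odd_hole_conn(4)[OF C(2)] unfolding T_def by auto
  obtain X4 where X4: "blk X4" "C \<subseteq> X4" "has_odd E X4" using odd_hole_blk[OF C(2)] by metis
  have "a \<in> X4" "b \<in> X4" using X4 \<open>C = T\<close> unfolding T_def by auto
  moreover have "X4 \<in> odd_blocks" using X4 unfolding odd_blocks_def by simp
  moreover have "b \<notin> X1" using dis[OF X(1-3)] ab by blast
  ultimately show False using dis[OF X(1), of X4] ab(1) by blast
qed

theorem odd_cycle_condition_iff:
  assumes cV: "conn E V"
  shows "(\<forall>C C'. odd_hole E C \<longrightarrow> odd_hole E C' \<longrightarrow> touch E C C') \<longleftrightarrow>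
    card odd_blocks \<le> 1 \<or> (\<exists>X1 X2. X1 \<noteq> X2 \<and> odd_blocks = {X1, X2} \<and> strong X1 X2)"
proof
  assume occ: "\<forall>C C'. odd_hole E C \<longrightarrow> odd_hole E C' \<longrightarrow> touch E C C'"
  show "card odd_blocks \<le> 1 \<or> (\<exists>X1 X2. X1 \<noteq> X2 \<and> odd_blocks = {X1, X2} \<and> strong X1 X2)"
  proof (cases "card odd_blocks \<le> 1")
    case False
    then have "\<not> (\<forall>X\<in>odd_blocks. \<forall>Y\<in>odd_blocks. X = Y)" using card_le_Suc0_iff_eq[OF finite_odd_blocks] by simp
    then obtain X1 X2 where X: "X1 \<in> odd_blocks" "X2 \<in> odd_blocks" "X1 \<noteq> X2" by blast
    have "odd_blocks = {X1, X2}" using odd_cycle_condition_two_blocks[OF cV _ X] occ X by blast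
    moreover have "strong X1 X2" using odd_cycle_condition_strong[OF _ X] occ by blast
    ultimately show ?thesis using X(3) by blast
  qed simp
next
  assume R: "card odd_blocks \<le> 1 \<or> (\<exists>X1 X2. X1 \<noteq> X2 \<and> odd_blocks = {X1, X2} \<and> strong X1 X2)"
  show "\<forall>C C'. odd_hole E C \<longrightarrow> odd_hole E C' \<longrightarrow> touch E C C'"
  proof (intro allI impI)
    fix C C' assume C: "odd_hole E C" "odd_hole E C'"
    obtain X where X: "blk X" "C \<subseteq> X" "has_odd E X" using odd_hole_blk[OF C(1)] by metis
    obtain Y where Y: "blk Y" "C' \<subseteq> Y" "has_odd E Y" using odd_hole_blk[OF C(2)] by metis
    show "touch E C C'"
    proof (cases "X = Y")
      case True
      obtain c where c: "c \<in> C" using odd_hole_conn(4)[OF C(1)] by fastforce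
      obtain c' where c': "c' \<in> C'" using odd_hole_conn(4)[OF C(2)] by fastforce
      obtain xs where xs: "odd_closed E C c xs" "set xs = C" using odd_hole_closed[OF C(1) c] by metis
      obtain ys where ys: "odd_closed E C' c' ys" "set ys = C'" using odd_hole_closed[OF C(2) c'] by metis
      have "odd_closed E X c xs" "odd_closed E X c' ys" using xs ys walk_from_mono X(2) Y(2) True unfolding odd_closed_def by metis+
      then show ?thesis using touch_in_biconnected[OF blkD(3,4)[OF X(1)]] xs(2) ys(2) by metis
    next
      case False
      have XY: "X \<in> odd_blocks" "Y \<in> odd_blocks" using X Y unfolding odd_blocks_def by auto
      then have "\<not> card odd_blocks \<le> 1" using card_le_Suc0_iff_eq[OF finite_odd_blocks] False by auto
      then obtain X1 X2 where s: "odd_blocks = {X1, X2}" "strong X1 X2" using R by blast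
      then have "strong X Y" using XY False strong_sym by auto
      then show ?thesis using strong_touch[OF X(1) Y(1) False _ C(1) X(2) C(2) Y(2)] by blast
    qed
  qed
qed

end

section \<open>Degree vectors of edge monomials\<close>

text \<open>Either some proper nonempty subset is tight, and it and its complement are matched
  separately; or all such subsets have slack, and one element may be matched arbitrarily.\<close>

lemma hall_marriage:
  assumes "finite A" "\<And>a. a \<in> A \<Longrightarrow> finite (N a)" "\<And>J. J \<subseteq> A \<Longrightarrow> card J \<le> card (\<Union>a\<in>J. N a)"
  shows "\<exists>s. inj_on s A \<and> (\<forall>a\<in>A. s a \<in> N a)"
  using assms
proof (induction "card A" arbitrary: A N rule: less_induct)
  case less
  have finU: "finite (\<Union>a\<in>J. N a)" if "J \<subseteq> A" for J using less.prems(1,2) that finite_subset by blast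
  show ?case
  proof (cases "\<exists>J. J \<subset> A \<and> J \<noteq> {} \<and> card (\<Union>a\<in>J. N a) = card J")
    case True
    then obtain J where J: "J \<subset> A" "J \<noteq> {}" "card (\<Union>a\<in>J. N a) = card J" by blast
    define M where "M = (\<Union>a\<in>J. N a)"
    have fJ: "finite J" using J less.prems(1) finite_subset by blast
    have fM: "finite M" unfolding M_def using finU J by blast
    have "\<exists>s. inj_on s J \<and> (\<forall>a\<in>J. s a \<in> N a)"
      using less.hyps[OF psubset_card_mono[OF less.prems(1) J(1)], of N] fJ less.prems(2,3) J(1) by blast
    then obtain s where s: "inj_on s J" "\<forall>a\<in>J. s a \<in> N a" by blast
    have "\<exists>t. inj_on t (A - J) \<and> (\<forall>a\<in>A - J. t a \<in> N a - M)"
    proof (rule less.hyps)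
      show "card (A - J) < card A" using J less.prems(1) by (intro psubset_card_mono) auto
      show "finite (A - J)" using less.prems(1) by simp
      show "finite (N a - M)" if "a \<in> A - J" for a using less.prems(2) that by blast
      show "card K \<le> card (\<Union>a\<in>K. N a - M)" if K: "K \<subseteq> A - J" for K
      proof -
        have fK: "finite K" using K less.prems(1) finite_subset by blast
        have "card (K \<union> J) \<le> card (\<Union>a\<in>K \<union> J. N a)" using less.prems(3)[of "K \<union> J"] K J by blast
        also have "(\<Union>a\<in>K \<union> J. N a) = (\<Union>a\<in>K. N a - M) \<union> M" unfolding M_def by blast
        also have "card \<dots> \<le> card (\<Union>a\<in>K. N a - M) + card M" by (rule card_Un_le)
        finally have "card (K \<union> J) \<le> card (\<Union>a\<in>K. N a - M) + card M" .
        moreover have "card (K \<union> J) = card K + card J" using K fK fJ by (intro card_Un_disjoint) auto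
        ultimately show ?thesis using J(3) unfolding M_def by simp
      qed
    qed
    then obtain t where t: "inj_on t (A - J)" "\<forall>a\<in>A - J. t a \<in> N a - M" by blast
    define r where "r a = (if a \<in> J then s a else t a)" for a
    have sM: "s a \<in> M" if "a \<in> J" for a using s(2) that unfolding M_def by blast
    have "inj_on r A"
    proof (rule inj_onI)
      fix p q assume pq: "p \<in> A" "q \<in> A" "r p = r q"
      have rM: "r a \<in> M \<longleftrightarrow> a \<in> J" if "a \<in> A" for a using sM t(2) that unfolding r_def by auto
      have "p \<in> J \<longleftrightarrow> q \<in> J" using rM[OF pq(1)] rM[OF pq(2)] pq(3) by simp
      then show "p = q" using pq s(1) t(1) unfolding r_def inj_on_def by (auto split: if_splits)
    qed
    moreover have "\<forall>a\<in>A. r a \<in> N a" using s t unfolding r_def by auto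
    ultimately show ?thesis by blast
  next
    case False
    show ?thesis
    proof (cases "A = {}")
      case True
      then show ?thesis by auto
    next
      case nonempty: False
      then obtain a where a: "a \<in> A" by blast
      have "card {a} \<le> card (\<Union>a\<in>{a}. N a)" using less.prems(3)[of "{a}"] a by blast
      then have "N a \<noteq> {}" by auto
      then obtain b where b: "b \<in> N a" by blast
      have "\<exists>t. inj_on t (A - {a}) \<and> (\<forall>c\<in>A - {a}. t c \<in> N c - {b})"
      proof (rule less.hyps)
        show "card (A - {a}) < card A" using a less.prems(1) by (intro psubset_card_mono) auto
        show "finite (A - {a})" using less.prems(1) by simp
        show "finite (N c - {b})" if "c \<in> A - {a}" for c using less.prems(2) that by blast
        show "card K \<le> card (\<Union>c\<in>K. N c - {b})" if K: "K \<subseteq> A - {a}" for K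
        proof (cases "K = {}")
          case nK: False
          have "K \<subset> A" using K a by blast
          then have "card K < card (\<Union>c\<in>K. N c)" using False nK less.prems(3)[of K] by (metis le_neq_implies_less psubset_imp_subset)
          moreover have "(\<Union>c\<in>K. N c) - {b} = (\<Union>c\<in>K. N c - {b})" by blast
          moreover have "card (\<Union>c\<in>K. N c) - 1 \<le> card ((\<Union>c\<in>K. N c) - {b})"
            by (simp add: card_Diff_singleton_if)
          ultimately show ?thesis by simp
        qed simp
      qed
      then obtain t where t: "inj_on t (A - {a})" "\<forall>c\<in>A - {a}. t c \<in> N c - {b}" by blast
      have "inj_on (t(a := b)) A"
      proof (rule inj_onI)
        fix p q assume pq: "p \<in> A" "q \<in> A" "(t(a := b)) p = (t(a := b)) q"
        show "p = q"
        proof (cases "p = a \<or> q = a")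
          case True
          then show ?thesis using pq t(2) by (auto split: if_splits)
        next
          case False
          then show ?thesis using pq t(1) unfolding inj_on_def by auto
        qed
      qed
      moreover have "\<forall>c\<in>A. (t(a := b)) c \<in> N c" using t b by auto
      ultimately show ?thesis by blast
    qed
  qed
qed

text \<open>\<open>n\<close> is the least positive return time; injectivity lets equal iterates be
  cancelled back to \<open>i\<close>.\<close>

lemma finite_orbit:
  assumes "finite I" "inj_on s I" "s ` I \<subseteq> I" "i \<in> I"
  obtains n where "0 < n" "(s ^^ n) i = i" "inj_on (\<lambda>k. (s ^^ k) i) {..<n}" "\<And>k. (s ^^ k) i \<in> I"
proof -
  have inI: "(s ^^ k) i \<in> I" for k using assms(3,4) by (induction k) auto
  have "\<not> inj (\<lambda>k. (s ^^ k) i)" using inI assms(1) by (metis finite_imageD finite_subset image_subsetI infinite_UNIV_nat)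
  then have "\<exists>k l. k < l \<and> (s ^^ k) i = (s ^^ l) i" unfolding inj_def by (metis linorder_neqE_nat)
  then obtain k l where kl: "k < l" "(s ^^ k) i = (s ^^ l) i" by blast
  have canc: "(s ^^ d) i = i" if "(s ^^ k) i = (s ^^ (k + d)) i" for k d
    using that
  proof (induction k)
    case (Suc k)
    then have "s ((s ^^ k) i) = s ((s ^^ (k + d)) i)" by simp
    then have "(s ^^ k) i = (s ^^ (k + d)) i" using assms(2) inI unfolding inj_on_def by blast
    then show ?case using Suc.IH by simp
  qed simp
  have ex: "\<exists>n. 0 < n \<and> (s ^^ n) i = i" using canc[of k "l - k"] kl by (intro exI[of _ "l - k"]) auto
  define n where "n = (LEAST n. 0 < n \<and> (s ^^ n) i = i)"
  have n: "0 < n" "(s ^^ n) i = i" unfolding n_def using LeastI_ex[OF ex] by auto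
  have least: "n \<le> m" if "0 < m" "(s ^^ m) i = i" for m unfolding n_def using that by (intro Least_le) auto
  have "inj_on (\<lambda>k. (s ^^ k) i) {..<n}"
  proof (rule inj_onI)
    fix p q assume pq: "p \<in> {..<n}" "q \<in> {..<n}" "(s ^^ p) i = (s ^^ q) i"
    have "False" if "p < q" "q < n" "(s ^^ p) i = (s ^^ q) i" for p q
      using least[of "q - p"] canc[of p "q - p"] that by auto
    then show "p = q" using pq by (metis lessThan_iff linorder_neqE_nat)
  qed
  then show ?thesis using that n inI by blast
qed

lemma count_list_map_distinct: "distinct ks \<Longrightarrow> count_list (map g ks) v = card {k \<in> set ks. g k = v}"
proof (induction ks)
  case (Cons k ks)
  have "{j \<in> set (k # ks). g j = v} = (if g k = v then insert k {j \<in> set ks. g j = v} else {j \<in> set ks. g j = v})" by auto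
  then show ?case using Cons by auto
qed simp

context ugraph
begin

text \<open>Walks with a common vertex concatenate to an even closed walk, of which one half is
  taken. For an edge \<open>{p, q}\<close>, the half \<open>False\<close> of each odd walk misses
  just one visit, at \<open>p\<close> and at \<open>q\<close> respectively, and the edge supplies
  both.\<close>

lemma merge_odd_closed:
  assumes "odd_closed E X a xs" "odd_closed E X b ys" "touch E (set xs) (set ys)"
  obtains u where "u \<in> mon" "\<And>v. vdeg u v = count_list xs v + count_list ys v"
proof -
  obtain p q where pq: "p \<in> set xs" "q \<in> set ys" "p = q \<or> {p, q} \<in> E" using assms(3) unfolding touch_def by blast
  obtain xs' where xs': "odd_closed E X p xs'" "mset xs' = mset xs" using odd_closed_rotate[OF assms(1), of p] pq by blast
  obtain ys' where ys': "odd_closed E X q ys'" "mset ys' = mset ys" using odd_closed_rotate[OF assms(2), of q] pq by blast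
  have cnt: "count_list xs' v = count_list xs v" "count_list ys' v = count_list ys v" for v
    using xs'(2) ys'(2) by (metis count_mset)+
  have w: "walk_from E X p xs' p" "odd (length xs')" "walk_from E X q ys' q" "odd (length ys')"
    using xs' ys' unfolding odd_closed_def by auto
  show ?thesis
  proof (cases "p = q")
    case True
    have W: "walk_from E X p (xs' @ ys') p" using w True walk_from_appendI by metis
    have "vdeg (half_walk True p (xs' @ ys')) v = count_list xs v + count_list ys v" for v
      using even_closed_halves(2)[OF W, of v] w cnt by simp
    then show ?thesis using that half_walk_mon[OF W] by blast
  next
    case False
    then have e: "{p, q} \<in> E" using pq by blast
    define u where "u = single {p, q} 1 + half_walk False p xs' + half_walk False q ys'"
    have "u \<in> mon" unfolding u_def by (intro mon_add mon_single half_walk_mon[OF w(1)] half_walk_mon[OF w(3)] e)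
    moreover have "vdeg u v = count_list xs v + count_list ys v" for v
    proof -
      have "vdeg (half_walk False p xs') v + (if v = p then 1 else 0) = count_list xs v"
        using vdeg_half_walk(2)[OF w(1), of v] w(2) cnt(1)[of v] by (auto split: if_splits)
      moreover have "vdeg (half_walk False q ys') v + (if v = q then 1 else 0) = count_list ys v"
        using vdeg_half_walk(2)[OF w(3), of v] w(4) cnt(2)[of v] by (auto split: if_splits)
      ultimately show ?thesis unfolding u_def edge_mono_add lookup_add
        using vdeg_single_edge[OF e, of v] by simp
    qed
    ultimately show ?thesis using that by blast
  qed
qed

text \<open>Each orbit of \<open>s\<close> is a closed walk. An even orbit is covered by every
  second edge; of the odd ones at most one is kept pending, as any two touch and can be merged. The
  map \<open>h\<close> allows several indices over the same vertex.\<close>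

lemma permutation_matching:
  assumes occ: "\<And>a xs b ys. odd_closed E UNIV a xs \<Longrightarrow> odd_closed E UNIV b ys \<Longrightarrow> touch E (set xs) (set ys)"
    and "finite I" "inj_on s I" "s ` I \<subseteq> I" "\<And>i. i \<in> I \<Longrightarrow> {h i, h (s i)} \<in> E"
  shows "\<exists>u\<in>mon. (\<forall>v. vdeg u v = card {i\<in>I. h i = v}) \<or>
    (\<exists>a xs. odd_closed E UNIV a xs \<and> (\<forall>v. vdeg u v + count_list xs v = card {i\<in>I. h i = v}))"
  using assms(2-5)
proof (induction "card I" arbitrary: I rule: less_induct)
  case less
  show ?case
  proof (cases "I = {}")
    case True
    then show ?thesis by (intro bexI[of _ 0]) auto
  next
    case False
    then obtain i where i: "i \<in> I" by blast
    obtain n where n: "0 < n" "(s ^^ n) i = i" "inj_on (\<lambda>k. (s ^^ k) i) {..<n}" "\<And>k. (s ^^ k) i \<in> I"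
      using finite_orbit[OF less.prems(1-3) i] by metis
    define Ob where "Ob = (\<lambda>k. (s ^^ k) i) ` {..<n}"
    define xs where "xs = map (\<lambda>k. h ((s ^^ Suc k) i)) [0..<n]"
    have walk: "walk_from E UNIV (h ((s ^^ m) i)) (map (\<lambda>k. h ((s ^^ Suc k) i)) [m..<m + d]) (h ((s ^^ (m + d)) i))" for m d
    proof (induction d arbitrary: m)
      case (Suc d)
      have "{h ((s ^^ m) i), h ((s ^^ Suc m) i)} \<in> E" using less.prems(4)[OF n(4)[of m]] by simp
      moreover have "[m..<m + Suc d] = m # [Suc m..<Suc m + d]" by (simp add: upt_rec)
      ultimately show ?case using Suc[of "Suc m"] by simp
    qed simp
    have W: "walk_from E UNIV (h i) xs (h i)" using walk[of 0 n] n(2) unfolding xs_def by simp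
    have len: "length xs = n" unfolding xs_def by simp
    have img: "(\<lambda>k. (s ^^ Suc k) i) ` {..<n} = Ob"
    proof -
      have "(s ^^ Suc k) i \<in> Ob" if "k < n" for k
      proof (cases "Suc k = n")
        case True
        then have "(s ^^ Suc k) i = (s ^^ 0) i" using n(2) by simp
        then show ?thesis unfolding Ob_def using n(1) by blast
      next
        case False
        then show ?thesis unfolding Ob_def using that by (intro imageI) auto
      qed
      then have sub: "(\<lambda>k. (s ^^ Suc k) i) ` {..<n} \<subseteq> Ob" by blast
      have "inj_on (\<lambda>k. (s ^^ Suc k) i) {..<n}"
        using n(3) less.prems(2) n(4) unfolding inj_on_def by auto
      then have "card ((\<lambda>k. (s ^^ Suc k) i) ` {..<n}) = n" by (simp add: card_image)
      moreover have "card Ob = n" unfolding Ob_def using n(3) by (simp add: card_image)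
      ultimately show ?thesis using sub by (intro card_seteq) (auto simp: Ob_def)
    qed
    have inj': "inj_on (\<lambda>k. (s ^^ Suc k) i) {..<n}"
      using n(3) less.prems(2) n(4) unfolding inj_on_def by auto
    have cnt: "count_list xs v = card {j\<in>Ob. h j = v}" for v
    proof -
      have "count_list xs v = card {k \<in> set [0..<n]. h ((s ^^ Suc k) i) = v}"
        unfolding xs_def by (rule count_list_map_distinct) simp
      also have "\<dots> = card {k. k < n \<and> h ((s ^^ Suc k) i) = v}" by simp
      also have "\<dots> = card ((\<lambda>k. (s ^^ Suc k) i) ` {k. k < n \<and> h ((s ^^ Suc k) i) = v})"
        using inj' by (intro card_image[symmetric]) (auto simp: inj_on_def)
      also have "(\<lambda>k. (s ^^ Suc k) i) ` {k. k < n \<and> h ((s ^^ Suc k) i) = v} = {j\<in>Ob. h j = v}"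
        unfolding img[symmetric] by auto
      finally show ?thesis .
    qed
    have ObI: "Ob \<subseteq> I" "i \<in> Ob" unfolding Ob_def using n(1,4) by (auto intro!: image_eqI[of _ _ 0])
    define I' where "I' = I - Ob"
    have fOb: "finite Ob" unfolding Ob_def by simp
    have sI': "s ` I' \<subseteq> I'"
    proof
      fix y assume "y \<in> s ` I'"
      then obtain j where j: "j \<in> I" "j \<notin> Ob" "y = s j" unfolding I'_def by blast
      have "y \<notin> Ob"
      proof
        assume "y \<in> Ob"
        then obtain k where k: "k < n" "y = s ((s ^^ k) i)" unfolding img[symmetric] by auto
        then have "j = (s ^^ k) i" using less.prems(2) n(4) j unfolding inj_on_def by blast
        then show False using j(2) k(1) unfolding Ob_def by blast
      qed
      then show "y \<in> I'" using j less.prems(3) unfolding I'_def by blast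
    qed
    have lt: "card I' < card I" unfolding I'_def using ObI less.prems(1) by (intro psubset_card_mono) auto
    have I'I: "I' \<subseteq> I" unfolding I'_def by blast
    have fI': "finite I'" using I'I less.prems(1) finite_subset by blast
    have eI': "{h j, h (s j)} \<in> E" if "j \<in> I'" for j using less.prems(4) that I'I by blast
    obtain u where u: "u \<in> mon" "(\<forall>v. vdeg u v = card {j\<in>I'. h j = v}) \<or>
      (\<exists>a xs. odd_closed E UNIV a xs \<and> (\<forall>v. vdeg u v + count_list xs v = card {j\<in>I'. h j = v}))"
      using less.hyps[OF lt fI' inj_on_subset[OF less.prems(2) I'I] sI' eI'] by blast
    have tot: "card {j\<in>I. h j = v} = card {j\<in>I'. h j = v} + count_list xs v" for v
    proof -
      have "{j\<in>I. h j = v} = {j\<in>I'. h j = v} \<union> {j\<in>Ob. h j = v}" using ObI unfolding I'_def by blast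
      moreover have "card ({j\<in>I'. h j = v} \<union> {j\<in>Ob. h j = v}) = card {j\<in>I'. h j = v} + card {j\<in>Ob. h j = v}"
        using less.prems(1) fOb unfolding I'_def by (intro card_Un_disjoint) auto
      ultimately show ?thesis using cnt by simp
    qed
    show ?thesis
    proof (cases "even n")
      case True
      define u' where "u' = u + half_walk True (h i) xs"
      have "u' \<in> mon" unfolding u'_def using u(1) half_walk_mon[OF W] by (rule mon_add)
      moreover have "vdeg u' v = vdeg u v + count_list xs v" for v
        unfolding u'_def edge_mono_add lookup_add using even_closed_halves(2)[OF W] True len by simp
      ultimately show ?thesis using u(2) tot by (intro bexI[of _ u']) (auto simp: algebra_simps)
    next
      case False
      then have o: "odd_closed E UNIV (h i) xs" unfolding odd_closed_def using W len by simp
      from u(2) show ?thesis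
      proof
        assume "\<forall>v. vdeg u v = card {j\<in>I'. h j = v}"
        then show ?thesis using u(1) o tot by (intro bexI[of _ u]) auto
      next
        assume "\<exists>a xs. odd_closed E UNIV a xs \<and> (\<forall>v. vdeg u v + count_list xs v = card {j\<in>I'. h j = v})"
        then obtain a ys where ys: "odd_closed E UNIV a ys" "\<And>v. vdeg u v + count_list ys v = card {j\<in>I'. h j = v}" by blast
        obtain t where t: "t \<in> mon" "\<And>v. vdeg t v = count_list ys v + count_list xs v"
          using merge_odd_closed[OF ys(1) o occ[OF ys(1) o]] by metis
        have "vdeg (u + t) v = card {j\<in>I. h j = v}" for v
          unfolding edge_mono_add lookup_add tot t(2) ys(2)[symmetric] by simp
        then show ?thesis using mon_add[OF u(1) t(1)] by blast
      qed
    qed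
  qed
qed

definition nbrs :: "'v set \<Rightarrow> 'v set" where
  "nbrs X = {w. \<exists>v\<in>X. {v, w} \<in> E}"

lemma finite_nbrs: "finite (nbrs X)"
proof -
  have "nbrs X \<subseteq> \<Union>E" unfolding nbrs_def by blast
  then show ?thesis using finite_E finite_edge finite_subset by (metis finite_Union)
qed

text \<open>An edge with an end in \<open>X\<close> has its other end in \<open>nbrs X\<close>, so
  it meets \<open>nbrs X\<close> at least as often as \<open>X\<close>.\<close>

lemma vdeg_nbrs:
  assumes "u \<in> mon" "finite X"
  shows "(\<Sum>v\<in>X. vdeg u v) \<le> (\<Sum>v\<in>nbrs X. vdeg u v)"
proof -
  have exp: "(\<Sum>v\<in>Y. vdeg u v) = (\<Sum>e\<in>E. card (e \<inter> Y) * lookup u e)" if "finite Y" for Y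
  proof -
    have "(\<Sum>v\<in>Y. vdeg u v) = (\<Sum>v\<in>Y. \<Sum>e\<in>E. if v \<in> e then lookup u e else 0)"
      using finite_E by (simp add: vdeg_eq[OF assms(1)] sum.inter_filter)
    also have "\<dots> = (\<Sum>e\<in>E. \<Sum>v\<in>Y. if v \<in> e then lookup u e else 0)" by (rule sum.swap)
    also have "\<dots> = (\<Sum>e\<in>E. card (e \<inter> Y) * lookup u e)"
    proof (rule sum.cong[OF refl])
      fix e
      have "(\<Sum>v\<in>Y. if v \<in> e then lookup u e else 0) = (\<Sum>v\<in>e \<inter> Y. lookup u e)"
        using that by (intro sum.mono_neutral_cong_right) auto
      then show "(\<Sum>v\<in>Y. if v \<in> e then lookup u e else 0) = card (e \<inter> Y) * lookup u e" by simp
    qed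
    finally show ?thesis .
  qed
  have "card (e \<inter> X) \<le> card (e \<inter> nbrs X)" if e: "e \<in> E" for e
  proof -
    obtain p q where pq: "p \<noteq> q" "e = {p, q}" using edgeE[OF e] by metis
    have "p \<in> X \<Longrightarrow> q \<in> nbrs X" "q \<in> X \<Longrightarrow> p \<in> nbrs X" unfolding nbrs_def using e pq by (auto simp: insert_commute)
    then show ?thesis using pq
      by (cases "p \<in> X"; cases "q \<in> X"; cases "p \<in> nbrs X"; cases "q \<in> nbrs X") auto
  qed
  then show ?thesis unfolding exp[OF assms(2)] exp[OF finite_nbrs] by (intro sum_mono mult_right_mono) auto
qed

text \<open>An edge of the support contributes its exponent twice or not at all.\<close>

lemma even_vdeg_sum:
  assumes "u \<in> mon" "finite Y" "\<And>e. e \<in> E \<Longrightarrow> lookup u e > 0 \<Longrightarrow> e \<subseteq> Y \<or> e \<inter> Y = {}"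
  shows "even (\<Sum>v\<in>Y. vdeg u v)"
proof -
  have "(\<Sum>v\<in>Y. vdeg u v) = (\<Sum>v\<in>Y. \<Sum>e\<in>E. if v \<in> e then lookup u e else 0)"
    using finite_E by (simp add: vdeg_eq[OF assms(1)] sum.inter_filter)
  also have "\<dots> = (\<Sum>e\<in>E. \<Sum>v\<in>Y. if v \<in> e then lookup u e else 0)" by (rule sum.swap)
  finally have eq: "(\<Sum>v\<in>Y. vdeg u v) = (\<Sum>e\<in>E. \<Sum>v\<in>Y. if v \<in> e then lookup u e else 0)" .
  show ?thesis unfolding eq
  proof (rule dvd_sum)
    fix e assume e: "e \<in> E"
    have s: "(\<Sum>v\<in>Y. if v \<in> e then lookup u e else 0) = card (e \<inter> Y) * lookup u e"
    proof -
      have "(\<Sum>v\<in>Y. if v \<in> e then lookup u e else 0) = (\<Sum>v\<in>e \<inter> Y. lookup u e)"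
        using assms(2) by (intro sum.mono_neutral_cong_right) auto
      then show ?thesis by simp
    qed
    show "even (\<Sum>v\<in>Y. if v \<in> e then lookup u e else 0)" unfolding s
    proof (cases "lookup u e = 0")
      case False
      then consider "e \<inter> Y = e" | "e \<inter> Y = {}" using assms(3)[OF e] by auto
      then show "even (card (e \<inter> Y) * lookup u e)" using card_edge[OF e] by cases auto
    qed simp
  qed
qed

text \<open>Take as many copies of each vertex as its exponent says. The inequality is Hall's
  condition for the adjacency of copies; a leftover odd walk is excluded by the even total
  degree.\<close>

lemma hall_degree:
  fixes e :: "'v \<Rightarrow>\<^sub>0 nat"
  assumes occ: "\<And>a xs b ys. odd_closed E UNIV a xs \<Longrightarrow> odd_closed E UNIV b ys \<Longrightarrow> touch E (set xs) (set ys)"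
    and hall: "\<And>X. finite X \<Longrightarrow> (\<Sum>v\<in>X. lookup e v) \<le> (\<Sum>v\<in>nbrs X. lookup e v)"
    and even: "even (\<Sum>v\<in>keys e. lookup e v)"
  shows "e \<in> edge_mono ` mon"
proof -
  let ?l = "lookup e"
  define I where "I = Sigma (keys e) (\<lambda>v. {..<?l v})"
  define N where "N i = {j\<in>I. {fst i, fst j} \<in> E}" for i :: "'v \<times> nat"
  have fI: "finite I" unfolding I_def by auto
  have "\<exists>s. inj_on s I \<and> (\<forall>i\<in>I. s i \<in> N i)"
  proof (rule hall_marriage[OF fI])
    show "finite (N i)" for i unfolding N_def using fI by simp
    fix J assume J: "J \<subseteq> I"
    define X where "X = fst ` J"
    have fX: "finite X" unfolding X_def using J fI finite_subset by blast
    have cardS: "card (Sigma Y (\<lambda>v. {..<?l v})) = (\<Sum>v\<in>Y. ?l v)" if "finite Y" for Y :: "'v set"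
      using that by (subst card_SigmaI) auto
    have "J \<subseteq> Sigma X (\<lambda>v. {..<?l v})" using J unfolding X_def I_def by force
    then have "card J \<le> card (Sigma X (\<lambda>v. {..<?l v}))" using fX by (intro card_mono) auto
    also have "\<dots> = (\<Sum>v\<in>X. ?l v)" using cardS[OF fX] .
    also have "\<dots> \<le> (\<Sum>v\<in>nbrs X. ?l v)" by (rule hall[OF fX])
    also have "\<dots> = (\<Sum>v\<in>nbrs X \<inter> keys e. ?l v)"
      using finite_nbrs by (intro sum.mono_neutral_right) (auto simp: in_keys_iff)
    also have "\<dots> = card (Sigma (nbrs X \<inter> keys e) (\<lambda>v. {..<?l v}))"
      by (rule cardS[symmetric]) simp
    also have "\<dots> \<le> card (\<Union>i\<in>J. N i)"
    proof (rule card_mono)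
      show "finite (\<Union>i\<in>J. N i)" using J fI finite_subset[OF J fI] unfolding N_def by auto
      show "Sigma (nbrs X \<inter> keys e) (\<lambda>v. {..<?l v}) \<subseteq> (\<Union>i\<in>J. N i)"
        unfolding N_def nbrs_def X_def I_def by auto
    qed
    finally show "card J \<le> card (\<Union>i\<in>J. N i)" .
  qed
  then obtain s where s: "inj_on s I" "\<And>i. i \<in> I \<Longrightarrow> s i \<in> I" "\<And>i. i \<in> I \<Longrightarrow> {fst i, fst (s i)} \<in> E" unfolding N_def by blast
  have cnt: "card {i\<in>I. fst i = v} = ?l v" for v
  proof -
    have "{i\<in>I. fst i = v} = Pair v ` {..<?l v}" unfolding I_def by (auto simp: in_keys_iff)
    then show ?thesis by (simp add: card_image inj_on_def)
  qed
  have "\<exists>u\<in>mon. (\<forall>v. vdeg u v = ?l v) \<or> (\<exists>a xs. odd_closed E UNIV a xs \<and> (\<forall>v. vdeg u v + count_list xs v = ?l v))"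
    unfolding cnt[symmetric]
  proof (rule permutation_matching[OF _ fI s(1)])
    show "s ` I \<subseteq> I" using s(2) by blast
    show "{fst i, fst (s i)} \<in> E" if "i \<in> I" for i using s(3)[OF that] .
    show "touch E (set xs) (set ys)" if "odd_closed E UNIV a xs" "odd_closed E UNIV b ys" for a xs b ys using occ[OF that] .
  qed
  then obtain u where u: "u \<in> mon" "(\<forall>v. vdeg u v = ?l v) \<or> (\<exists>a xs. odd_closed E UNIV a xs \<and> (\<forall>v. vdeg u v + count_list xs v = ?l v))" by blast
  from u(2) show ?thesis
  proof
    assume "\<forall>v. vdeg u v = ?l v"
    then have "edge_mono u = e" by (intro poly_mapping_eqI) simp
    then show ?thesis using u(1) by blast
  next
    assume "\<exists>a xs. odd_closed E UNIV a xs \<and> (\<forall>v. vdeg u v + count_list xs v = ?l v)"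
    then obtain a xs where xs: "odd (length xs)" "\<And>v. vdeg u v + count_list xs v = ?l v" unfolding odd_closed_def by blast
    have sub: "set xs \<subseteq> keys e"
    proof
      fix v assume "v \<in> set xs"
      then have "count_list xs v \<noteq> 0" by (simp add: count_list_0_iff)
      then show "v \<in> keys e" using xs(2)[of v] by (simp add: in_keys_iff)
    qed
    have "(\<Sum>v\<in>keys e. ?l v) = (\<Sum>v\<in>keys e. vdeg u v) + (\<Sum>v\<in>keys e. count_list xs v)"
      using xs(2) by (simp add: sum.distrib[symmetric])
    moreover have "(\<Sum>v\<in>keys e. count_list xs v) = length xs"
      using sub by (intro sum_count_set) auto
    moreover have "even (\<Sum>v\<in>keys e. vdeg u v)"
    proof (rule even_vdeg_sum[OF u(1)])
      show "d \<subseteq> keys e \<or> d \<inter> keys e = {}" if d: "d \<in> E" "lookup u d > 0" for d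
      proof -
        have "v \<in> keys e" if "v \<in> d" for v
        proof -
          have "lookup u d \<le> vdeg u v" unfolding vdeg_eq[OF u(1)] using d(1) that finite_E by (intro member_le_sum) auto
          then have "?l v \<noteq> 0" using d(2) xs(2)[of v] by linarith
          then show ?thesis by (simp add: in_keys_iff)
        qed
        then show ?thesis by blast
      qed
    qed simp
    ultimately show ?thesis using even xs(1) by simp
  qed
qed

end

section \<open>Normality\<close>

definition lead :: "('a::linorder \<Rightarrow>\<^sub>0 'k::zero) \<Rightarrow> 'a" where
  "lead p = Max (keys p)"

lemma lead_in: "p \<noteq> 0 \<Longrightarrow> lead p \<in> keys p"
  unfolding lead_def by (rule Max_in) auto

lemma lead_ge: "\<alpha> \<in> keys p \<Longrightarrow> \<alpha> \<le> lead p"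
  unfolding lead_def by simp

text \<open>Addition of exponents is strictly monotone, so the top term of a product arises in only
  one way.\<close>

lemma lead_mult:
  fixes p q :: "('v::linorder \<Rightarrow>\<^sub>0 nat) \<Rightarrow>\<^sub>0 'k::field"
  assumes "p \<noteq> 0" "q \<noteq> 0"
  shows "lookup (p * q) (lead p + lead q) = lookup p (lead p) * lookup q (lead q)"
    and "lead (p * q) = lead p + lead q"
proof -
  have pq: "p * q = (\<Sum>\<alpha>\<in>keys p. \<Sum>\<beta>\<in>keys q.
      single (\<alpha> + \<beta>) (lookup p \<alpha> * lookup q \<beta>))"
    by (subst poly_mapping_sum_single[of p], subst poly_mapping_sum_single[of q]) (simp add: sum_product mult_single)
  have un: "\<alpha> + \<beta> = lead p + lead q \<longleftrightarrow> \<alpha> = lead p \<and> \<beta> = lead q"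
    if "\<alpha> \<in> keys p" "\<beta> \<in> keys q" for \<alpha> \<beta>
    using lead_ge[OF that(1)] lead_ge[OF that(2)]
    by (metis add_le_less_mono add_less_le_mono le_imp_less_or_eq less_irrefl)
  have "lookup (p * q) (lead p + lead q) = (\<Sum>\<alpha>\<in>keys p. \<Sum>\<beta>\<in>keys q.
      if \<alpha> = lead p then (if \<beta> = lead q then lookup p \<alpha> * lookup q \<beta> else 0) else 0)"
    unfolding pq lookup_sum lookup_single when_def using un by (intro sum.cong refl) auto
  also have "\<dots> = (\<Sum>\<alpha>\<in>keys p. if \<alpha> = lead p then (\<Sum>\<beta>\<in>keys q. if \<beta> = lead q then lookup p \<alpha> * lookup q \<beta> else 0) else 0)"
    by (intro sum.cong refl) auto
  also have "\<dots> = lookup p (lead p) * lookup q (lead q)"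
    using lead_in[OF assms(1)] lead_in[OF assms(2)] by simp
  finally show l: "lookup (p * q) (lead p + lead q) = lookup p (lead p) * lookup q (lead q)" .
  have "lookup (p * q) (lead p + lead q) \<noteq> 0"
    unfolding l using lead_in[OF assms(1)] lead_in[OF assms(2)] by (simp add: in_keys_iff)
  then have "lead p + lead q \<in> keys (p * q)" by (simp add: in_keys_iff)
  moreover have "\<gamma> \<le> lead p + lead q" if "\<gamma> \<in> keys (p * q)" for \<gamma>
    using keys_mult[of p q] that lead_ge[of _ p] lead_ge[of _ q] add_mono by blast
  ultimately show "lead (p * q) = lead p + lead q" unfolding lead_def[of "p * q"] by (intro Max_eqI) auto
qed

lemma lead_power:
  fixes p :: "('v::linorder \<Rightarrow>\<^sub>0 nat) \<Rightarrow>\<^sub>0 'k::field"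
  assumes "p \<noteq> 0"
  shows "lookup (lead (p ^ n)) v = n * lookup (lead p) v"
proof (induction n)
  case 0
  then show ?case by (simp add: lead_def)
next
  case (Suc n)
  then show ?case using lead_mult(2)[OF assms, of "p ^ n"] assms by (simp add: lookup_add)
qed

text \<open>The order compares exponents at the smallest vertex where they differ; on a finite set
  of vertices it is a lexicographic order on lists of fixed length.\<close>

lemma wf_exponents:
  assumes "finite V"
  shows "wf {(\<alpha>, \<beta>). keys \<alpha> \<subseteq> V \<and> keys \<beta> \<subseteq> V \<and> \<alpha> < (\<beta> :: 'v::linorder \<Rightarrow>\<^sub>0 nat)}"
proof -
  define vs where "vs = sorted_list_of_set V"
  have vs: "set vs = V" "sorted vs" "distinct vs" unfolding vs_def using assms by auto
  have "{(\<alpha>, \<beta>). keys \<alpha> \<subseteq> V \<and> keys \<beta> \<subseteq> V \<and> \<alpha> < (\<beta> :: 'v \<Rightarrow>\<^sub>0 nat)}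
      \<subseteq> inv_image (lex less_than) (\<lambda>\<alpha>. map (lookup \<alpha>) vs)"
  proof clarify
    fix \<alpha> \<beta> :: "'v \<Rightarrow>\<^sub>0 nat" assume b: "keys \<beta> \<subseteq> V" and lt: "\<alpha> < \<beta>"
    then obtain k where k: "lookup \<alpha> k < lookup \<beta> k"
      "\<And>k'. k' < k \<Longrightarrow> lookup \<alpha> k' = lookup \<beta> k'"
      unfolding less_poly_mapping.rep_eq less_fun_def by blast
    have "k \<in> keys \<beta>" using k(1) by (simp add: in_keys_iff)
    then have "k \<in> set vs" using b vs(1) by blast
    then obtain us ws where uw: "vs = us @ k # ws" by (meson split_list)
    have "u < k" if "u \<in> set us" for u using vs(2,3) that unfolding uw by (auto simp: sorted_append order_less_le)
    then have eq: "map (lookup \<alpha>) us = map (lookup \<beta>) us" using k(2) by auto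
    then show "(\<alpha>, \<beta>) \<in> inv_image (lex less_than) (\<lambda>\<alpha>. map (lookup \<alpha>) vs)"
      unfolding uw using k(1) by (auto simp: lex_conv intro!: exI[of _ "map (lookup \<beta>) us"])
  qed
  moreover have "wf (inv_image (lex less_than) (\<lambda>\<alpha>. map (lookup \<alpha>) vs))"
    by (intro wf_inv_image wf_lex wf_less_than)
  ultimately show ?thesis by (rule wf_subset[rotated])
qed

section \<open>The edge ring as a semigroup algebra\<close>

locale lgraph = vgraph E V for E :: "'v::linorder set set" and V
begin

definition degs :: "('v \<Rightarrow>\<^sub>0 nat) set" where
  "degs = edge_mono ` mon"

lemma degs_0: "0 \<in> degs" unfolding degs_def using mon_0 edge_mono_0 by (metis imageI)

lemma degs_add: "a \<in> degs \<Longrightarrow> b \<in> degs \<Longrightarrow> a + b \<in> degs"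
  unfolding degs_def using mon_add edge_mono_add by (metis (no_types, lifting) imageE imageI)

lemma edge_mono_edge:
  assumes "{u, v} \<in> E"
  shows "edge_mono (single {u, v} 1) = single u 1 + single v 1"
  by (intro poly_mapping_eqI) (use vdeg_single_edge[OF assms] in \<open>auto simp: lookup_add lookup_single when_def\<close>)

text \<open>The ring is generated by monomials and therefore spanned by them, so membership is a
  condition on exponents alone.\<close>

lemma edge_ring_iff:
  fixes p :: "('v \<Rightarrow>\<^sub>0 nat) \<Rightarrow>\<^sub>0 'k::field"
  shows "p \<in> edge_ring E \<longleftrightarrow> keys p \<subseteq> degs"
proof
  show "p \<in> edge_ring E \<Longrightarrow> keys p \<subseteq> degs"
  proof (induction rule: edge_ring.induct)
    case (const c)
    then show ?case using degs_0 by auto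
  next
    case (edge u v)
    have "single u 1 + single v 1 \<in> degs"
      using edge_mono_edge[OF edge(1)] mon_single[OF edge(1)] unfolding degs_def by (metis imageI)
    then show ?case by auto
  next
    case (add p q)
    then show ?case using keys_add[of p q] by blast
  next
    case (mult p q)
    then show ?case using keys_mult[of p q] degs_add by blast
  qed
  have sing: "\<forall>c. single (edge_mono x) (c::'k) \<in> edge_ring E" if "x \<in> mon" for x
    using that
  proof (induction x rule: edge_mono_induct)
    case (1 x)
    show ?case
    proof (cases "x = 0")
      case True
      then show ?thesis using edge_ring.const by auto
    next
      case False
      then obtain e where e: "e \<in> keys x" by fastforce
      then have eE: "e \<in> E" using 1(1) unfolding mon_def by auto
      obtain y where y: "y \<in> mon" "x = single e 1 + y" using split_edge[OF 1(1) e] by metis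
      obtain u v where uv: "u \<noteq> v" "e = {u, v}" using edgeE[OF eE] by metis
      have "\<forall>c. single (edge_mono y) (c::'k) \<in> edge_ring E"
        using 1(2)[OF eE y(1)] y by (simp add: edge_mono_add)
      moreover have "single (edge_mono (single e 1)) (1::'k) \<in> edge_ring E"
        using edge_mono_edge[of u v] eE uv edge_ring.edge[of u v E] by simp
      moreover have "single (edge_mono x) c
          = single (edge_mono (single e 1)) (1::'k) * single (edge_mono y) c" for c
        using y(2) by (simp add: mult_single edge_mono_add)
      ultimately show ?thesis using edge_ring.mult by metis
    qed
  qed (use that in auto)
  assume p: "keys p \<subseteq> degs"
  have zero: "(0 :: ('v \<Rightarrow>\<^sub>0 nat) \<Rightarrow>\<^sub>0 'k) \<in> edge_ring E" using edge_ring.const[of 0 E] by simp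
  have sum: "sum h S \<in> edge_ring E" if "\<And>x. x \<in> S \<Longrightarrow> h x \<in> edge_ring E" for h :: "_ \<Rightarrow> ('v \<Rightarrow>\<^sub>0 nat) \<Rightarrow>\<^sub>0 'k" and S
    using that by (induction S rule: infinite_finite_induct) (auto intro: zero edge_ring.add)
  have "(\<Sum>\<alpha>\<in>keys p. single \<alpha> (lookup p \<alpha>)) \<in> edge_ring E"
    using p sing unfolding degs_def by (intro sum) blast
  then show "p \<in> edge_ring E" using poly_mapping_sum_single[of p] by simp
qed

lemma degs_keys: "a \<in> degs \<Longrightarrow> keys a \<subseteq> V"
proof
  fix v assume a: "a \<in> degs" and v: "v \<in> keys a"
  obtain u where u: "u \<in> mon" "a = edge_mono u" using a unfolding degs_def by blast
  have "vdeg u v \<noteq> 0" using v u by (simp add: in_keys_iff)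
  then have "{e\<in>E. v \<in> e} \<noteq> {}" using vdeg_eq[OF u(1), of v] by (metis sum.empty)
  then show "v \<in> V" using edge_V by blast
qed

text \<open>The inequalities required by \<open>hall_degree\<close> hold for all degrees in
  \<open>degs\<close>. They hold for every \<open>k * (a - b)\<close> shifted by the fixed
  \<open>g\<close>, hence for \<open>a - b\<close> itself when \<open>k\<close> is large; parity is
  inherited from \<open>a\<close> and \<open>b\<close>.\<close>

lemma almost_integral_degree:
  assumes occ: "\<And>a xs b ys. odd_closed E UNIV a xs \<Longrightarrow> odd_closed E UNIV b ys \<Longrightarrow> touch E (set xs) (set ys)"
    and ab: "a \<in> degs" "b \<in> degs"
    and R: "\<And>k. \<exists>r\<in>degs. \<forall>v. lookup g v + k * lookup a v = lookup r v + k * lookup b v"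
  obtains e where "e \<in> degs" "a = b + e"
proof -
  have ge: "lookup b v \<le> lookup a v" for v
  proof (rule ccontr)
    assume "\<not> ?thesis"
    then have l: "Suc (lookup a v) \<le> lookup b v" by simp
    define k where "k = Suc (lookup g v)"
    obtain r where "lookup g v + k * lookup a v = lookup r v + k * lookup b v"
      using R[of k] by blast
    moreover have "k * Suc (lookup a v) \<le> k * lookup b v" using l by (rule mult_le_mono2)
    ultimately have "k + k * lookup a v \<le> lookup g v + k * lookup a v" by simp
    then show False unfolding k_def by simp
  qed
  define e where "e = a - b"
  have ae: "a = b + e" unfolding e_def by (intro poly_mapping_eqI) (use ge in \<open>simp add: lookup_add lookup_minus\<close>)
  have "e \<in> edge_mono ` mon"
  proof (rule hall_degree[OF occ])
    fix X :: "'v set" assume X: "finite X"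
    let ?s = "\<lambda>f Y. \<Sum>v\<in>Y. lookup f v"
    show "?s e X \<le> ?s e (nbrs X)"
    proof (rule ccontr)
      assume "\<not> ?thesis"
      then have l: "Suc (?s e (nbrs X)) \<le> ?s e X" by simp
      \<comment> \<open>Chosen so large that the shift by \<open>g\<close> cannot make up for a
        violated inequality.\<close>
      define k where "k = Suc (?s g (nbrs X))"
      obtain r where r: "r \<in> degs" "\<And>v. lookup g v + k * lookup a v = lookup r v + k * lookup b v"
        using R[of k] by blast
      have rv: "lookup r v = lookup g v + k * lookup e v" for v
        using r(2)[of v] unfolding ae lookup_add by (simp add: algebra_simps)
      have rs: "?s r Y = ?s g Y + k * ?s e Y" for Y unfolding rv by (simp add: sum.distrib sum_distrib_left)
      obtain u where u: "u \<in> mon" "r = edge_mono u" using r(1) unfolding degs_def by blast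
      have "?s r X \<le> ?s r (nbrs X)" using vdeg_nbrs[OF u(1) X] u(2) by simp
      then have "k * ?s e X \<le> ?s g (nbrs X) + k * ?s e (nbrs X)" unfolding rs by simp
      moreover have "k * Suc (?s e (nbrs X)) \<le> k * ?s e X" using l by (rule mult_le_mono2)
      ultimately have "k \<le> ?s g (nbrs X)" by simp
      then show False unfolding k_def by simp
    qed
  next
    let ?t = "\<lambda>f. \<Sum>v\<in>V. lookup f v"
    have ev: "even (?t c)" if cd: "c \<in> degs" for c
    proof -
      obtain u where u: "u \<in> mon" "c = edge_mono u" using cd unfolding degs_def by blast
      show ?thesis unfolding u(2) by (rule even_vdeg_sum[OF u(1) finite_V]) (use edge_V in blast)
    qed
    have "?t a = ?t b + ?t e" unfolding ae by (simp add: lookup_add sum.distrib)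
    then have "even (?t e)" using ev[OF ab(1)] ev[OF ab(2)] by (metis even_add)
    moreover have "keys e \<subseteq> V"
      using degs_keys[OF ab(1)] unfolding e_def by (auto simp: in_keys_iff lookup_minus subset_iff)
    then have "(\<Sum>v\<in>keys e. lookup e v) = ?t e"
      using finite_V by (intro sum.mono_neutral_left) (auto simp: in_keys_iff)
    ultimately show "even (\<Sum>v\<in>keys e. lookup e v)" by simp
  qed (use occ in auto)
  then show ?thesis using that ae unfolding degs_def by blast
qed

text \<open>Division by leading terms: subtracting a monomial multiple of \<open>b\<close> lowers
  the leading exponent of \<open>a\<close>, and by the binomial theorem the remainder satisfies the
  hypothesis with the same \<open>g\<close>.\<close>

lemma almost_integral_divides:
  fixes a b g :: "('v \<Rightarrow>\<^sub>0 nat) \<Rightarrow>\<^sub>0 'k::field"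
  assumes occ: "\<And>a xs b ys. odd_closed E UNIV a xs \<Longrightarrow> odd_closed E UNIV b ys \<Longrightarrow> touch E (set xs) (set ys)"
    and b: "b \<in> edge_ring E" "b \<noteq> 0" and g: "g \<noteq> 0"
    and a: "a \<in> edge_ring E" "\<And>k. \<exists>r\<in>edge_ring E. g * a ^ k = r * b ^ k"
  shows "\<exists>d\<in>edge_ring E. a = d * b"
proof -
  let ?D = "edge_ring E :: (('v \<Rightarrow>\<^sub>0 nat) \<Rightarrow>\<^sub>0 'k) set"
  define W where "W = {(\<alpha>, \<beta>). keys \<alpha> \<subseteq> V \<and> keys \<beta> \<subseteq> V \<and> \<alpha> < (\<beta> :: 'v \<Rightarrow>\<^sub>0 nat)}"
  have wfW: "wf W" unfolding W_def by (rule wf_exponents[OF finite_V])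
  have neg1: "- 1 \<in> ?D" using edge_ring.const[of "-1" E] by (simp add: single_uminus)
  have zero: "0 \<in> ?D" using edge_ring.const[of 0 E] by simp
  have ofn: "of_nat n \<in> ?D" for n using edge_ring.const[of "of_nat n" E] by (simp add: single_of_nat)
  have one: "1 \<in> ?D" using edge_ring.const[of 1 E] by simp
  have um: "- x \<in> ?D" if "x \<in> ?D" for x using edge_ring.mult[OF neg1 that] by simp
  have pw: "x ^ n \<in> ?D" if "x \<in> ?D" for x n using that by (induction n) (auto intro: one edge_ring.mult)
  have sm: "sum h S \<in> ?D" if "\<And>x. x \<in> S \<Longrightarrow> h x \<in> ?D" for h and S :: "nat set"
    using that by (induction S rule: infinite_finite_induct) (auto intro: zero edge_ring.add)
  have leaddeg: "lead x \<in> degs" if "x \<in> ?D" "x \<noteq> 0" for x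
    using that lead_in[OF that(2)] edge_ring_iff[of x] by blast
  have main: "\<forall>a. a \<in> ?D \<longrightarrow> (\<forall>k. \<exists>r\<in>?D. g * a ^ k = r * b ^ k) \<longrightarrow> (a \<noteq> 0 \<longrightarrow> lead a = \<alpha>) \<longrightarrow> (\<exists>d\<in>?D. a = d * b)" for \<alpha>
  proof (induction \<alpha> rule: wf_induct_rule[OF wfW])
    case (1 \<alpha>)
    show ?case
    proof (intro allI impI)
      fix a assume a: "a \<in> ?D" and R: "\<forall>k. \<exists>r\<in>?D. g * a ^ k = r * b ^ k" and la: "a \<noteq> 0 \<longrightarrow> lead a = \<alpha>"
      show "\<exists>d\<in>?D. a = d * b"
      proof (cases "a = 0")
        case True
        then show ?thesis using zero by (intro bexI[of _ 0]) auto
      next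
        case a0: False
        have "\<exists>r\<in>degs. \<forall>v. lookup (lead g) v + k * lookup (lead a) v
            = lookup r v + k * lookup (lead b) v" for k
        proof -
          obtain r where r: "r \<in> ?D" "g * a ^ k = r * b ^ k" using R by blast
          have r0: "r \<noteq> 0" using r(2) g a0 by auto
          have "lead g + lead (a ^ k) = lead r + lead (b ^ k)"
            using arg_cong[OF r(2), of lead] lead_mult(2)[OF g, of "a ^ k"] lead_mult(2)[OF r0, of "b ^ k"] a0 b(2) by simp
          then have "lookup (lead g + lead (a ^ k)) v = lookup (lead r + lead (b ^ k)) v" for v by simp
          then show ?thesis using leaddeg[OF r(1) r0] lead_power[OF a0] lead_power[OF b(2)]
            by (intro bexI[of _ "lead r"]) (auto simp: lookup_add)
        qed
        then obtain e where e: "e \<in> degs" "lead a = lead b + e"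
          using almost_integral_degree[of "lead a" "lead b" "lead g"] occ leaddeg[OF a a0] leaddeg[OF b] by blast
        define y where "y = single e (lookup a (lead a) / lookup b (lead b))"
        have lb: "lookup b (lead b) \<noteq> 0" "lookup a (lead a) \<noteq> 0"
          using lead_in[OF b(2)] lead_in[OF a0] by (simp_all add: in_keys_iff)
        have yD: "y \<in> ?D" unfolding edge_ring_iff y_def using e(1) by auto
        have y0: "y \<noteq> 0" unfolding y_def using lb by (metis divide_eq_0_iff lookup_single_eq lookup_zero)
        have ly: "lead y = e" 
        proof -
          have "keys y = {e}" unfolding y_def using lb by simp
          then show ?thesis by (simp add: lead_def)
        qed
        have lyb: "lead (y * b) = lead a" using lead_mult(2)[OF y0 b(2)] ly e(2) by (simp add: add.commute)
        have cyb: "lookup (y * b) (lead a) = lookup a (lead a)"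
          using lead_mult(1)[OF y0 b(2)] ly e(2) lb unfolding y_def by (simp add: add.commute)
        define a' where "a' = a - y * b"
        have a'D: "a' \<in> ?D" unfolding a'_def using edge_ring.add[OF a um[OF edge_ring.mult[OF yD b(1)]]] by simp
        have R': "\<exists>r\<in>?D. g * a' ^ k = r * b ^ k" for k
        proof -
          obtain r where r: "\<And>i. r i \<in> ?D" "\<And>i. g * a ^ i = r i * b ^ i" using R by metis
          define t where "t = - y"
          have "a' ^ k = (a + t * b) ^ k" unfolding a'_def t_def by simp
          also have "\<dots> = (\<Sum>i\<le>k. of_nat (k choose i) * a ^ i * (t * b) ^ (k - i))" by (rule binomial_ring)
          finally have "g * a' ^ k = (\<Sum>i\<le>k. of_nat (k choose i) * (g * a ^ i) * (t ^ (k - i) * b ^ (k - i)))"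
            by (simp add: sum_distrib_left power_mult_distrib algebra_simps)
          also have "\<dots> = (\<Sum>i\<le>k. (of_nat (k choose i) * r i * t ^ (k - i)) * b ^ k)"
          proof (intro sum.cong refl)
            fix i assume "i \<in> {..k}"
            then have "b ^ k = b ^ i * b ^ (k - i)" by (simp flip: power_add)
            then show "of_nat (k choose i) * (g * a ^ i) * (t ^ (k - i) * b ^ (k - i)) = of_nat (k choose i) * r i * t ^ (k - i) * b ^ k"
              unfolding r(2) by (simp add: algebra_simps)
          qed
          also have "\<dots> = (\<Sum>i\<le>k. of_nat (k choose i) * r i * t ^ (k - i)) * b ^ k" by (simp add: sum_distrib_right)
          finally have "g * a' ^ k = (\<Sum>i\<le>k. of_nat (k choose i) * r i * t ^ (k - i)) * b ^ k" .
          moreover have "(\<Sum>i\<le>k. of_nat (k choose i) * r i * t ^ (k - i)) \<in> ?D"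
            unfolding t_def by (intro sm edge_ring.mult ofn r(1) pw um yD)
          ultimately show ?thesis by blast
        qed
        have "\<exists>d\<in>?D. a' = d * b"
        proof (cases "a' = 0")
          case True
          then show ?thesis using zero by (intro bexI[of _ 0]) auto
        next
          case a'0: False
          have "lead a' \<noteq> lead a"
          proof
            assume "lead a' = lead a"
            then have "lookup a' (lead a) \<noteq> 0" using lead_in[OF a'0] by (simp add: in_keys_iff)
            then show False unfolding a'_def lookup_minus cyb by simp
          qed
          moreover have "lead a' \<le> lead a"
          proof -
            have "lead a' \<in> keys a \<or> lead a' \<in> keys (y * b)"
              using lead_in[OF a'0] unfolding a'_def by (auto simp: in_keys_iff lookup_minus)
            then show ?thesis using lead_ge[of "lead a'" a] lead_ge[of "lead a'" "y * b"] lyb by auto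
          qed
          ultimately have "lead a' < lead a" by simp
          moreover have "keys (lead a') \<subseteq> V" "keys (lead a) \<subseteq> V"
            using degs_keys leaddeg[OF a'D a'0] leaddeg[OF a a0] by blast+
          ultimately have "(lead a', \<alpha>) \<in> W" unfolding W_def using la a0 by auto
          then show ?thesis using 1[of "lead a'"] a'D R' by blast
        qed
        then obtain d where d: "d \<in> ?D" "a' = d * b" by blast
        then have "a = (d + y) * b" unfolding a'_def by (simp add: algebra_simps)
        then show ?thesis using edge_ring.add[OF d(1) yD] by blast
      qed
    qed
  qed
  show ?thesis using main[of "lead a"] a by blast
qed

text \<open>An integral equation of degree \<open>n\<close> makes \<open>b ^ n\<close> a common
  denominator of all powers of the fraction, which is the hypothesis of
  \<open>almost_integral_divides\<close>.\<close>

lemma normal_if_touching: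
  assumes occ: "\<And>a xs b ys. odd_closed E UNIV a xs \<Longrightarrow> odd_closed E UNIV b ys \<Longrightarrow> touch E (set xs) (set ys)"
  shows "normal_domain (edge_ring E :: (('v \<Rightarrow>\<^sub>0 nat) \<Rightarrow>\<^sub>0 'k::field) set)"
  unfolding normal_domain_def
proof (intro ballI impI)
  let ?D = "edge_ring E :: (('v \<Rightarrow>\<^sub>0 nat) \<Rightarrow>\<^sub>0 'k) set"
  fix a b assume ab: "a \<in> ?D" "b \<in> ?D" "b \<noteq> 0"
    and ex: "\<exists>n c. (\<forall>i<n. c i \<in> ?D) \<and> Fract a b ^ n + (\<Sum>i<n. Fract (c i) 1 * Fract a b ^ i) = 0"
  obtain n c where c: "\<And>i. i < n \<Longrightarrow> c i \<in> ?D" "Fract a b ^ n + (\<Sum>i<n. Fract (c i) 1 * Fract a b ^ i) = 0"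
    using ex by blast
  have zero: "0 \<in> ?D" using edge_ring.const[of 0 E] by simp
  have neg1: "- 1 \<in> ?D" using edge_ring.const[of "-1" E] by (simp add: single_uminus)
  have um: "- x \<in> ?D" if "x \<in> ?D" for x using edge_ring.mult[OF neg1 that] by simp
  have one: "1 \<in> ?D" using edge_ring.const[of 1 E] by simp
  have pw: "x ^ n \<in> ?D" if "x \<in> ?D" for x n using that by (induction n) (auto intro: one edge_ring.mult)
  have sm: "sum h S \<in> ?D" if "\<And>x. x \<in> S \<Longrightarrow> h x \<in> ?D" for h and S :: "nat set"
    using that by (induction S rule: infinite_finite_induct) (auto intro: zero edge_ring.add)
  have fpow: "Fract a b ^ i = Fract (a ^ i) (b ^ i)" for i
    by (induction i) (auto simp: One_fract_def)
  have fsum: "(\<Sum>i\<in>S. Fract (h i) (b ^ n)) = Fract (sum h S) (b ^ n)" if "finite S" for S :: "nat set" and h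
    using that
  proof (induction S rule: finite_induct)
    case empty
    then show ?case using ab(3) by (simp add: fract_collapse)
  next
    case (insert x S)
    have "Fract (h x) (b ^ n) + Fract (sum h S) (b ^ n) = Fract (h x + sum h S) (b ^ n)"
      using ab(3) by (simp add: eq_fract algebra_simps)
    then show ?case using insert by simp
  qed
  have "(\<Sum>i<n. Fract (c i) 1 * Fract a b ^ i) = (\<Sum>i<n. Fract (c i * a ^ i * b ^ (n - i)) (b ^ n))"
  proof (intro sum.cong refl)
    fix i assume "i \<in> {..<n}"
    then have "b ^ n = b ^ i * b ^ (n - i)" by (simp flip: power_add)
    then show "Fract (c i) 1 * Fract a b ^ i = Fract (c i * a ^ i * b ^ (n - i)) (b ^ n)"
      using ab(3) by (simp add: fpow eq_fract algebra_simps)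
  qed
  then have "Fract (a ^ n) (b ^ n) + Fract (\<Sum>i<n. c i * a ^ i * b ^ (n - i)) (b ^ n) = 0"
    using c(2) fsum[of "{..<n}" "\<lambda>i. c i * a ^ i * b ^ (n - i)"] by (simp add: fpow)
  then have "(a ^ n + (\<Sum>i<n. c i * a ^ i * b ^ (n - i))) * b ^ n = 0"
    using ab(3) by (simp add: eq_fract Zero_fract_def algebra_simps)
  then have eq0: "a ^ n + (\<Sum>i<n. c i * a ^ i * b ^ (n - i)) = 0"
    using power_not_zero[OF ab(3), of n] by (auto simp only: mult_eq_0_iff)
  \<comment> \<open>For \<open>k < n\<close> the factor \<open>b ^ n\<close> already contains
    \<open>b ^ k\<close>; from \<open>n\<close> on, the equation expresses \<open>a ^ k\<close>
    through lower powers.\<close>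
  have "\<exists>r\<in>?D. b ^ n * a ^ k = r * b ^ k" for k
  proof (induction k rule: less_induct)
    case (less k)
    show ?case
    proof (cases "k < n")
      case True
      then have "b ^ n = b ^ (n - k) * b ^ k" by (simp flip: power_add)
      then have "b ^ n * a ^ k = (a ^ k * b ^ (n - k)) * b ^ k" by (simp add: algebra_simps)
      then show ?thesis using edge_ring.mult[OF pw[OF ab(1)] pw[OF ab(2)]] by blast
    next
      case False
      have "\<exists>r\<in>?D. b ^ n * a ^ (k - n + i) = r * b ^ (k - n + i)" if "i < n" for i
        using less[of "k - n + i"] that False by simp
      then obtain r where r: "\<And>i. i < n \<Longrightarrow> r i \<in> ?D" "\<And>i. i < n \<Longrightarrow> b ^ n * a ^ (k - n + i) = r i * b ^ (k - n + i)" by metis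
      have an: "a ^ n = - (\<Sum>i<n. c i * a ^ i * b ^ (n - i))" using eq0 by (simp add: eq_neg_iff_add_eq_0)
      have "a ^ k = a ^ (k - n) * a ^ n" using False by (simp flip: power_add)
      then have "b ^ n * a ^ k = - (\<Sum>i<n. c i * b ^ (n - i) * (b ^ n * a ^ (k - n + i)))"
        unfolding an by (simp add: sum_distrib_left power_add algebra_simps)
      also have "(\<Sum>i<n. c i * b ^ (n - i) * (b ^ n * a ^ (k - n + i))) = (\<Sum>i<n. c i * r i * b ^ k)"
      proof (intro sum.cong refl)
        fix i assume i: "i \<in> {..<n}"
        then have "k = (n - i) + (k - n + i)" using False by simp
        then have "b ^ k = b ^ (n - i) * b ^ (k - n + i)" by (metis power_add)
        then show "c i * b ^ (n - i) * (b ^ n * a ^ (k - n + i)) = c i * r i * b ^ k"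
          using r(2)[of i] i by (simp add: algebra_simps)
      qed
      also have "- (\<Sum>i<n. c i * r i * b ^ k) = (- (\<Sum>i<n. c i * r i)) * b ^ k" by (simp add: sum_distrib_right)
      finally have "b ^ n * a ^ k = (- (\<Sum>i<n. c i * r i)) * b ^ k" .
      moreover have "- (\<Sum>i<n. c i * r i) \<in> ?D" using c(1) r(1) by (intro um sm edge_ring.mult) auto
      ultimately show ?thesis by blast
    qed
  qed
  then obtain d where "d \<in> ?D" "a = d * b"
    using almost_integral_divides[OF _ ab(2,3) power_not_zero[OF ab(3), of n] ab(1)] occ by blast
  then show "\<exists>d\<in>?D. Fract a b = Fract d 1" using ab(3) by (intro bexI[of _ d]) (auto simp: eq_fract)
qed

text \<open>Let \<open>M\<close> be the product of all vertices of two nontouching odd cycles. The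
  product of the cycle edges is \<open>M * M\<close>, so \<open>M\<close> is integral, and an odd
  walk between the cycles writes \<open>M\<close> as a fraction of edge monomials. But
  \<open>M\<close> is not in the ring: each edge within its support stays in one cycle, and
  \<open>card C\<close> is odd.\<close>

lemma touching_if_normal:
  assumes cV: "conn E V" and nd: "normal_domain (edge_ring E :: (('v \<Rightarrow>\<^sub>0 nat) \<Rightarrow>\<^sub>0 'k::field) set)"
    and C: "odd_hole E C" "odd_hole E C'"
  shows "touch E C C'"
proof (rule ccontr)
  let ?D = "edge_ring E :: (('v \<Rightarrow>\<^sub>0 nat) \<Rightarrow>\<^sub>0 'k) set"
  assume nt: "\<not> touch E C C'"
  then have dis: "C \<inter> C' = {}" unfolding touch_def by blast
  obtain c where c: "c \<in> C" using odd_hole_conn(4)[OF C(1)] by fastforce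
  obtain c' where c': "c' \<in> C'" using odd_hole_conn(4)[OF C(2)] by fastforce
  obtain xs where xs: "odd_closed E C c xs" "set xs = C" "distinct xs" using odd_hole_closed[OF C(1) c] by metis
  obtain ys where ys: "odd_closed E C' c' ys" "set ys = C'" "distinct ys" using odd_hole_closed[OF C(2) c'] by metis
  have w: "walk_from E C c xs c" "odd (length xs)" "walk_from E C' c' ys c'" "odd (length ys)"
    using xs ys unfolding odd_closed_def by auto
  have fC: "finite C" "finite C'" using odd_hole_conn(3) C by auto
  have cnt: "count_list xs v = (if v \<in> C then 1 else 0)" "count_list ys v = (if v \<in> C' then 1 else 0)" for v
    using count_list_map_distinct[OF xs(3), of "\<lambda>x. x" v] count_list_map_distinct[OF ys(3), of "\<lambda>x. x" v] xs(2) ys(2)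
    by (auto simp: Collect_conv_if)
  have CV: "C \<subseteq> V" "C' \<subseteq> V" using odd_hole_V C by auto
  have oV: "has_odd E V" using C(1) has_odd_mono[OF _ CV(1)] unfolding odd_hole_def by blast
  have "c \<in> V" "c' \<in> V" using c c' CV by auto
  then obtain ps where ps: "walk_from E V c ps c'" "even (length ps) = False" using conn_odd_parity[OF cV oV] by blast
  define T where "T = (\<Sum>v\<in>C \<union> C'. single v (1::nat))"
  have T: "lookup T v = (if v \<in> C \<union> C' then 1 else 0)" for v
    unfolding T_def lookup_sum lookup_single when_def using fC by simp
  \<comment> \<open>The half \<open>True\<close> of an odd closed walk counts the start once too
    often; the half \<open>False\<close> of the odd walk \<open>ps\<close> misses one visit at each
    of its ends \<open>c\<close> and \<open>c'\<close>, which compensates. So the degrees of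
    \<open>\<alpha>\<close> and \<open>\<beta>\<close> differ by \<open>T\<close>.\<close>
  define \<alpha> where "\<alpha> = half_walk True c xs + half_walk True c' ys + half_walk False c ps"
  define \<beta> where "\<beta> = half_walk True c ps"
  define \<delta> where "\<delta> = (half_walk True c xs + half_walk False c xs) + (half_walk True c' ys + half_walk False c' ys)"
  have m: "\<alpha> \<in> mon" "\<beta> \<in> mon" "\<delta> \<in> mon" unfolding \<alpha>_def \<beta>_def \<delta>_def
    by (intro mon_add half_walk_mon[OF w(1)] half_walk_mon[OF w(3)] half_walk_mon[OF ps(1)])+
  have e1: "edge_mono \<alpha> = T + edge_mono \<beta>"
  proof (rule poly_mapping_eqI)
    fix v
    show "vdeg \<alpha> v = lookup (T + edge_mono \<beta>) v"
      unfolding \<alpha>_def \<beta>_def edge_mono_add lookup_add T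
      using vdeg_half_walk[OF w(1), of v] vdeg_half_walk[OF w(3), of v] vdeg_half_walk[OF ps(1), of v] w(2,4) ps(2) cnt[of v] dis
      by (auto split: if_splits)
  qed
  have e2: "edge_mono \<delta> = T + T"
  proof (rule poly_mapping_eqI)
    fix v
    show "vdeg \<delta> v = lookup (T + T) v"
      unfolding \<delta>_def edge_mono_add lookup_add T
      using vdeg_half_walk[OF w(1), of v] vdeg_half_walk[OF w(3), of v] w(2,4) cnt[of v] dis
      by (auto split: if_splits)
  qed
  define A :: "('v \<Rightarrow>\<^sub>0 nat) \<Rightarrow>\<^sub>0 'k" where "A = single (edge_mono \<alpha>) 1"
  define B :: "('v \<Rightarrow>\<^sub>0 nat) \<Rightarrow>\<^sub>0 'k" where "B = single (edge_mono \<beta>) 1"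
  define M :: "('v \<Rightarrow>\<^sub>0 nat) \<Rightarrow>\<^sub>0 'k" where "M = single T 1"
  have D: "A \<in> ?D" "B \<in> ?D" "M * M \<in> ?D" unfolding edge_ring_iff A_def B_def M_def mult_single
    using m e2 unfolding degs_def by (auto intro: image_eqI[of _ edge_mono \<delta>])
  have AB: "A = M * B" unfolding A_def B_def M_def by (simp add: mult_single e1)
  have B0: "B \<noteq> 0" unfolding B_def by (metis lookup_single_eq lookup_zero zero_neq_one)
  have F: "Fract A B = Fract M 1" using B0 by (simp add: eq_fract AB)
  have neg1: "- 1 \<in> ?D" using edge_ring.const[of "-1" E] by (simp add: single_uminus)
  have zero: "0 \<in> ?D" using edge_ring.const[of 0 E] by simp
  \<comment> \<open>The coefficients of the monic equation \<open>X ^ 2 - M * M = 0\<close>.\<close>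
  define k where "k i = (if i = 0 then - (M * M) else 0)" for i :: nat
  have "\<forall>i<2. k i \<in> ?D" unfolding k_def using edge_ring.mult[OF neg1 D(3)] zero by auto
  moreover have "Fract A B ^ 2 + (\<Sum>i<2. Fract (k i) 1 * Fract A B ^ i) = 0"
  proof -
    have "Fract M 1 ^ 2 = Fract (M * M) 1" by (simp add: power2_eq_square)
    moreover have "Fract (- (M * M)) 1 = - Fract (M * M) 1" by simp
    moreover have "Fract (0 :: ('v \<Rightarrow>\<^sub>0 nat) \<Rightarrow>\<^sub>0 'k) 1 = 0" by (simp add: Zero_fract_def)
    ultimately show ?thesis unfolding F k_def by (simp add: numeral_2_eq_2)
  qed
  ultimately obtain d where d: "d \<in> ?D" "Fract A B = Fract d 1"
    using nd D(1,2) B0 unfolding normal_domain_def by blast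
  then have "d = M" using F by (simp add: eq_fract)
  then have "T \<in> degs" using d(1) unfolding edge_ring_iff M_def by simp
  then obtain u where u: "u \<in> mon" "T = edge_mono u" unfolding degs_def by blast
  have "even (\<Sum>v\<in>C. vdeg u v)"
  proof (rule even_vdeg_sum[OF u(1) fC(1)])
    fix e assume e: "e \<in> E" "lookup u e > 0"
    have sup: "v \<in> C \<union> C'" if "v \<in> e" for v
    proof -
      have "lookup u e \<le> vdeg u v" unfolding vdeg_eq[OF u(1)] using e(1) that finite_E by (intro member_le_sum) auto
      then have "lookup T v \<noteq> 0" using e(2) u(2) by simp
      then show ?thesis unfolding T by (auto split: if_splits)
    qed
    obtain p q where pq: "e = {p, q}" using edgeE[OF e(1)] by metis
    have "\<not> (p \<in> C \<and> q \<in> C')" "\<not> (q \<in> C \<and> p \<in> C')" using nt e(1) unfolding touch_def pq by (auto simp: insert_commute)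
    then show "e \<subseteq> C \<or> e \<inter> C = {}" using sup dis unfolding pq by auto
  qed
  moreover have "(\<Sum>v\<in>C. vdeg u v) = card C"
    unfolding u(2)[symmetric] T using fC by (simp add: sum.inter_restrict[symmetric])
  ultimately show False using odd_hole_conn(5)[OF C(1)] by simp
qed

lemma normal_iff:
  assumes "conn E V"
  shows "normal_domain (edge_ring E :: (('v \<Rightarrow>\<^sub>0 nat) \<Rightarrow>\<^sub>0 'k::field) set) \<longleftrightarrow>
    (\<forall>C C'. odd_hole E C \<longrightarrow> odd_hole E C' \<longrightarrow> touch E C C')"
proof
  assume "normal_domain (edge_ring E :: (('v \<Rightarrow>\<^sub>0 nat) \<Rightarrow>\<^sub>0 'k) set)"
  then show "\<forall>C C'. odd_hole E C \<longrightarrow> odd_hole E C' \<longrightarrow> touch E C C'" using touching_if_normal[OF assms] by blast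
next
  assume occ: "\<forall>C C'. odd_hole E C \<longrightarrow> odd_hole E C' \<longrightarrow> touch E C C'"
  have hole: "\<exists>C. odd_hole E C \<and> C \<subseteq> set xs" if "odd_closed E UNIV a xs" for a xs
  proof -
    have w: "walk_from E UNIV a xs a" "odd (length xs)" using that unfolding odd_closed_def by auto
    have "walk_from E (set xs) a xs a" using odd_closed_nonempty[OF that] by (intro walk_from_restrict[OF w(1)]) auto
    then have "has_odd E (set xs)" using w(2) unfolding has_odd_def odd_closed_def by blast
    then show ?thesis using odd_hole_exists by metis
  qed
  show "normal_domain (edge_ring E :: (('v \<Rightarrow>\<^sub>0 nat) \<Rightarrow>\<^sub>0 'k) set)"
  proof (rule normal_if_touching)
    fix a xs b ys assume "odd_closed E UNIV a xs" "odd_closed E UNIV b ys"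
    then obtain C C' where C: "odd_hole E C" "C \<subseteq> set xs" "odd_hole E C'" "C' \<subseteq> set ys" using hole by metis
    show "touch E (set xs) (set ys)" using occ C touch_mono by metis
  qed
qed

end

section \<open>Blocks and chordless cycles of the graph\<close>

lemma walk_Cons_iff: "walk X F (a # xs) \<longleftrightarrow> walk_from F X a xs (last (a # xs))"
proof (induction xs arbitrary: a)
  case Nil
  then show ?case by (auto simp: walk_def)
next
  case (Cons c xs)
  have "walk X F (a # c # xs) \<longleftrightarrow> a \<in> X \<and> {a, c} \<in> F \<and> walk X F (c # xs)"
  proof
    assume w: "walk X F (a # c # xs)"
    then have n: "{(a # c # xs) ! i, (a # c # xs) ! Suc i} \<in> F" if "Suc i < length (a # c # xs)" for i
      using that unfolding walk_def by blast
    have "{(c # xs) ! i, (c # xs) ! Suc i} \<in> F" if "Suc i < length (c # xs)" for i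
      using n[of "Suc i"] that by simp
    then show "a \<in> X \<and> {a, c} \<in> F \<and> walk X F (c # xs)" using n[of 0] w unfolding walk_def by auto
  next
    assume w: "a \<in> X \<and> {a, c} \<in> F \<and> walk X F (c # xs)"
    have "{(a # c # xs) ! i, (a # c # xs) ! Suc i} \<in> F" if "Suc i < length (a # c # xs)" for i
      using w that unfolding walk_def by (cases i) auto
    then show "walk X F (a # c # xs)" using w unfolding walk_def by auto
  qed
  then show ?case using Cons[of c] by simp
qed

lemma connected_graph_iff: "connected_graph X F \<longleftrightarrow> X \<noteq> {} \<and> conn F X"
proof -
  have "(\<exists>xs. walk X F xs \<and> hd xs = u \<and> last xs = v) \<longleftrightarrow> (\<exists>ys. walk_from F X u ys v)" for u v
  proof
    assume "\<exists>xs. walk X F xs \<and> hd xs = u \<and> last xs = v"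
    then obtain xs where xs: "walk X F xs" "hd xs = u" "last xs = v" by blast
    moreover from this(1) obtain a ys where "xs = a # ys" unfolding walk_def by (cases xs) auto
    ultimately show "\<exists>ys. walk_from F X u ys v" using walk_Cons_iff by fastforce
  next
    assume "\<exists>ys. walk_from F X u ys v"
    then obtain ys where ys: "walk_from F X u ys v" by blast
    then have "walk X F (u # ys)" "last (u # ys) = v" using walk_Cons_iff[of X F u ys] walk_from_ends[OF ys] by auto
    then show "\<exists>xs. walk X F xs \<and> hd xs = u \<and> last xs = v" by (intro exI[of _ "u # ys"]) auto
  qed
  then show ?thesis unfolding connected_graph_def conn_def by simp
qed

definition induced :: "'v set set \<Rightarrow> 'v set \<Rightarrow> 'v set set" where
  "induced E X = {e\<in>E. e \<subseteq> X}"

lemma walk_from_edges_mono: "walk_from F X a xs b \<Longrightarrow> F \<subseteq> F' \<Longrightarrow> walk_from F' X a xs b"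
  by (induction xs arbitrary: a) auto

lemma conn_edges_mono: "conn F X \<Longrightarrow> F \<subseteq> F' \<Longrightarrow> conn F' X"
  unfolding conn_def using walk_from_edges_mono by metis

lemma walk_from_induced: "walk_from E X a xs b \<Longrightarrow> walk_from (induced E X) X a xs b"
  by (induction xs arbitrary: a) (auto simp: induced_def dest: walk_from_ends)

lemma conn_induced: "conn (induced E X) X \<longleftrightarrow> conn E X"
proof
  show "conn (induced E X) X \<Longrightarrow> conn E X" by (rule conn_edges_mono) (auto simp: induced_def)
  show "conn E X \<Longrightarrow> conn (induced E X) X" unfolding conn_def using walk_from_induced by metis
qed

lemma biconnected_bicon:
  assumes "biconnected X F" "F \<subseteq> E"
  shows "bicon E X"
proof -
  have c: "conn F X" "2 \<le> card X" "\<And>x. x \<in> X \<Longrightarrow> conn {e\<in>F. x \<notin> e} (X - {x})"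
    using assms(1) unfolding biconnected_def del_vertex_def by (auto simp: connected_graph_iff)
  have "conn E (X - {x})" for x
  proof (cases "x \<in> X")
    case True
    show ?thesis by (rule conn_edges_mono[OF c(3)[OF True]]) (use assms(2) in auto)
  next
    case False
    then show ?thesis using conn_edges_mono[OF c(1) assms(2)] by simp
  qed
  then show ?thesis unfolding bicon_def using c(2) conn_edges_mono[OF c(1) assms(2)] by blast
qed

lemma bicon_biconnected:
  assumes "bicon E X"
  shows "biconnected X (induced E X)"
proof -
  have "X \<noteq> {}" using assms unfolding bicon_def by auto
  moreover have "X - {x} \<noteq> {}" for x
  proof
    assume "X - {x} = {}"
    then have "card X \<le> card {x}" by (intro card_mono) auto
    then show False using assms unfolding bicon_def by simp
  qed
  moreover have "{e \<in> induced E X. x \<notin> e} = induced E (X - {x})" for x unfolding induced_def by blast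
  ultimately show ?thesis using assms unfolding biconnected_def del_vertex_def bicon_def
    by (simp add: connected_graph_iff conn_induced)
qed

lemma bipartite_induced: "bipartite Y (induced E X) \<longleftrightarrow> \<not> has_odd E X"
proof
  assume "bipartite Y (induced E X)"
  then obtain c :: "'a \<Rightarrow> bool" where c: "\<And>u v. {u, v} \<in> induced E X \<Longrightarrow> c u \<noteq> c v" unfolding bipartite_def by blast
  show "\<not> has_odd E X"
    by (rule colouring_no_odd[of X "\<lambda>v. if c v then 1 else -1"]) (use c in \<open>auto simp: induced_def\<close>)
next
  assume "\<not> has_odd E X"
  then obtain s :: "'a \<Rightarrow> real" where s: "\<And>v. s v = 1 \<or> s v = -1"
    "\<And>u v. u \<in> X \<Longrightarrow> v \<in> X \<Longrightarrow> {u, v} \<in> E \<Longrightarrow> s v = - s u" using two_colouring by metis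
  have "(s u = 1) \<noteq> (s v = 1)" if "{u, v} \<in> induced E X" for u v
    using s(2)[of u v] s(1)[of u] that unfolding induced_def by auto
  then show "bipartite Y (induced E X)" unfolding bipartite_def by (intro exI[of _ "\<lambda>v. s v = 1"]) blast
qed

context vgraph
begin

text \<open>Maximality forces a block to be induced, so it is determined by its vertex set.\<close>

lemma is_block_iff: "is_block V E B \<longleftrightarrow> blk (fst B) \<and> snd B = induced E (fst B)"
proof
  assume b: "is_block V E B"
  have s: "fst B \<subseteq> V" "snd B \<subseteq> E" "\<And>e. e \<in> snd B \<Longrightarrow> e \<subseteq> fst B" "biconnected (fst B) (snd B)"
    using b unfolding is_block_def subgraph_def by auto
  have mx: "Y = fst B \<and> induced E Y = snd B" if Y: "fst B \<subseteq> Y" "Y \<subseteq> V" "bicon E Y" for Y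
  proof -
    have "subgraph Y (induced E Y) V E" using Y unfolding subgraph_def induced_def by auto
    moreover have "snd B \<subseteq> induced E Y" using s Y unfolding induced_def by blast
    ultimately show ?thesis using b bicon_biconnected[OF Y(3)] Y(1) unfolding is_block_def by blast
  qed
  have bc: "bicon E (fst B)" by (rule biconnected_bicon[OF s(4,2)])
  show "blk (fst B) \<and> snd B = induced E (fst B)" unfolding blk_def using mx bc s(1) by blast
next
  assume b: "blk (fst B) \<and> snd B = induced E (fst B)"
  have "VH = fst B \<and> EH = snd B"
    if h: "subgraph VH EH V E" "biconnected VH EH" "fst B \<subseteq> VH" "snd B \<subseteq> EH" for VH EH
  proof -
    have "bicon E VH" using biconnected_bicon[OF h(2)] h(1) unfolding subgraph_def by blast
    then have "VH = fst B" using b h unfolding blk_def subgraph_def by blast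
    moreover from this have "EH \<subseteq> snd B" using h(1) b unfolding subgraph_def induced_def by blast
    ultimately show ?thesis using h(4) by blast
  qed
  moreover have "subgraph (fst B) (snd B) V E" using b blkD(1) unfolding subgraph_def induced_def by auto
  moreover have "biconnected (fst B) (snd B)" using b bicon_biconnected blkD(2) by metis
  ultimately show "is_block V E B" unfolding is_block_def by blast
qed

lemma non_bipartite_blocks_eq: "non_bipartite_blocks V E = (\<lambda>X. (X, induced E X)) ` odd_blocks"
proof
  show "non_bipartite_blocks V E \<subseteq> (\<lambda>X. (X, induced E X)) ` odd_blocks"
  proof
    fix B assume "B \<in> non_bipartite_blocks V E"
    then have "is_block V E B" "\<not> bipartite (fst B) (snd B)" unfolding non_bipartite_blocks_def by auto
    then have "blk (fst B)" "has_odd E (fst B)" "B = (fst B, induced E (fst B))"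
      using is_block_iff bipartite_induced by (metis, metis, metis prod.collapse)
    then show "B \<in> (\<lambda>X. (X, induced E X)) ` odd_blocks" unfolding odd_blocks_def by blast
  qed
  show "(\<lambda>X. (X, induced E X)) ` odd_blocks \<subseteq> non_bipartite_blocks V E"
    unfolding non_bipartite_blocks_def odd_blocks_def by (auto simp: is_block_iff bipartite_induced)
qed

lemma odd_hole_degree:
  assumes "odd_hole E C" "v \<in> C"
  shows "card {e \<in> induced E C. v \<in> e} = 2"
proof -
  obtain t where t: "walk_from E C v (t @ [v]) v" "distinct (v # t)" "insert v (set t) = C" "even (length t)" "t \<noteq> []"
    using odd_hole_cycle[OF assms] by metis
  obtain h t' where h: "t = h # t'" using t(5) by (cases t) auto
  have e1: "{v, hd t} \<in> E" using t(1) h by simp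
  obtain b where b: "walk_from E C v t b" "walk_from E C b [v] v" using t(1) walk_from_append by metis
  have "b = last t" using walk_from_ends[OF b(1)] t(5) by auto
  then have e2: "{v, last t} \<in> E" using b(2) by (simp add: insert_commute)
  have "t' \<noteq> []" using t(4) h by auto
  then have ne: "hd t \<noteq> last t" using t(2) h by auto
  have "{e \<in> induced E C. v \<in> e} = {{v, hd t}, {v, last t}}"
  proof
    show "{e \<in> induced E C. v \<in> e} \<subseteq> {{v, hd t}, {v, last t}}"
    proof
      fix e assume e: "e \<in> {e \<in> induced E C. v \<in> e}"
      then have eE: "e \<in> E" "v \<in> e" "e \<subseteq> C" unfolding induced_def by auto
      obtain u where u: "e = {v, u}" using edge_memE[OF eE(1,2)] by metis
      then have "u = hd t \<or> u = last t" using odd_hole_neighbours[OF assms(1) t(1-4)] eE by auto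
      then show "e \<in> {{v, hd t}, {v, last t}}" using u by auto
    qed
    have "hd t \<in> C" "last t \<in> C" using t(3,5) by auto
    then show "{{v, hd t}, {v, last t}} \<subseteq> {e \<in> induced E C. v \<in> e}" using e1 e2 assms(2) unfolding induced_def by auto
  qed
  moreover have "{v, hd t} \<noteq> {v, last t}" using ne by (auto simp: doubleton_eq_iff)
  ultimately show ?thesis by simp
qed

lemma odd_hole_chordless: "odd_hole E C \<Longrightarrow> chordless_cycle V E C (induced E C)"
  unfolding chordless_cycle_def subgraph_def is_cycle_def
  using odd_hole_V[of C] odd_hole_conn[of C] odd_hole_degree[of C]
  by (auto simp: connected_graph_iff conn_induced) (auto simp: induced_def)

text \<open>In a two-regular graph, summing the signs of a two-colouring over all ends of edges
  shows that both classes are equally large, so an odd cycle is not bipartite. It contains a hole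
  \<open>H\<close>; were \<open>H\<close> smaller, connectedness would give a vertex of
  \<open>H\<close> a third edge.\<close>

lemma chordless_odd_hole:
  assumes cc: "chordless_cycle V E C F" and o: "odd (card C)"
  shows "odd_hole E C \<and> F = induced E C"
proof -
  have F: "F = induced E C" using cc unfolding chordless_cycle_def subgraph_def induced_def by blast
  have fC: "finite C" "C \<noteq> {}" "conn E C" "\<And>v. v \<in> C \<Longrightarrow> card {e \<in> induced E C. v \<in> e} = 2"
    using cc unfolding chordless_cycle_def is_cycle_def F by (auto simp: connected_graph_iff conn_induced)
  have fI: "finite (induced E C)" unfolding induced_def using finite_E by simp
  have "has_odd E C"
  proof (rule ccontr)
    assume "\<not> has_odd E C"
    then obtain s :: "'v \<Rightarrow> real" where s: "\<And>v. s v = 1 \<or> s v = -1"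
      "\<And>u v. u \<in> C \<Longrightarrow> v \<in> C \<Longrightarrow> {u, v} \<in> E \<Longrightarrow> s v = - s u" using two_colouring by metis
    have "(\<Sum>v\<in>C. s v * real (card {e \<in> induced E C. v \<in> e})) = (\<Sum>v\<in>C. \<Sum>e\<in>induced E C. if v \<in> e then s v else 0)"
      using fI by (intro sum.cong refl) (simp add: sum.inter_filter[symmetric])
    also have "\<dots> = (\<Sum>e\<in>induced E C. \<Sum>v\<in>C. if v \<in> e then s v else 0)" by (rule sum.swap)
    also have "\<dots> = 0"
    proof (rule sum.neutral, intro ballI)
      fix e assume e: "e \<in> induced E C"
      then obtain p q where pq: "p \<noteq> q" "e = {p, q}" using edgeE unfolding induced_def by (metis (no_types, lifting) mem_Collect_eq)
      have pC: "p \<in> C" "q \<in> C" "{p, q} \<in> E" using e pq unfolding induced_def by auto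
      have "(\<Sum>v\<in>C. if v \<in> e then s v else 0) = (\<Sum>v\<in>e. s v)"
        using fC(1) pC pq by (intro sum.mono_neutral_cong_right) auto
      then show "(\<Sum>v\<in>C. if v \<in> e then s v else 0) = 0" using s(2)[OF pC] pq by simp
    qed
    finally have "(\<Sum>v\<in>C. s v * 2) = 0" using fC(4) by simp
    then have z: "(\<Sum>v\<in>C. s v) = 0" by (simp add: sum_distrib_right[symmetric])
    define P where "P = {v\<in>C. s v = 1}"
    have "(\<Sum>v\<in>C. s v) = (\<Sum>v\<in>P. s v) + (\<Sum>v\<in>C - P. s v)"
      using fC(1) by (subst sum.subset_diff[of P C]) (auto simp: P_def)
    also have "(\<Sum>v\<in>P. s v) = real (card P)" unfolding P_def by simp
    also have "(\<Sum>v\<in>C - P. s v) = (\<Sum>v\<in>C - P. -1)" using s(1) unfolding P_def by (intro sum.cong) auto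
    finally have "real (card P) = real (card (C - P))" using z by simp
    then have "card P = card (C - P)" by simp
    moreover have "card C = card P + card (C - P)" using fC(1) by (subst card_Diff_subset) (auto simp: P_def card_mono finite_subset)
    ultimately show False using o by simp
  qed
  then obtain H where H: "H \<subseteq> C" "odd_hole E H" using odd_hole_exists by metis
  have "H = C"
  proof (rule ccontr)
    assume "H \<noteq> C"
    then obtain v where v: "v \<in> C" "v \<notin> H" using H(1) by blast
    obtain h where h: "h \<in> H" using odd_hole_conn(4)[OF H(2)] by fastforce
    obtain xs where "walk_from E C h xs v" using fC(3) h H(1) v(1) unfolding conn_def by blast
    then obtain p ws where p: "p \<in> H" "walk_from E C p ws v" "set ws \<inter> H = {}" "ws \<noteq> []" using last_exit[OF _ h v(2)] by metis
    then obtain q ws' where ws: "ws = q # ws'" by (cases ws) auto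
    have q: "{p, q} \<in> E" "q \<notin> H" "q \<in> C" "p \<in> C" using p ws walk_from_ends[OF p(2)] by auto
    have "insert {p, q} {e \<in> induced E H. p \<in> e} \<subseteq> {e \<in> induced E C. p \<in> e}"
      using q H(1) unfolding induced_def by auto
    then have "card (insert {p, q} {e \<in> induced E H. p \<in> e}) \<le> card {e \<in> induced E C. p \<in> e}"
      using fI by (intro card_mono) auto
    moreover have "card (insert {p, q} {e \<in> induced E H. p \<in> e}) = Suc (card {e \<in> induced E H. p \<in> e})"
      using q(2) finite_E unfolding induced_def by (intro card_insert_disjoint) auto
    ultimately show False using odd_hole_degree[OF H(2) p(1)] fC(4)[OF q(4)] by simp
  qed
  then show ?thesis using H F by simp
qed

lemma odd_chordless_cycles_in_eq:
  "odd_chordless_cycles_in V E (X, induced E X) = (\<lambda>C. (C, induced E C)) ` holes X"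
proof
  show "odd_chordless_cycles_in V E (X, induced E X) \<subseteq> (\<lambda>C. (C, induced E C)) ` holes X"
    unfolding odd_chordless_cycles_in_def holes_def using chordless_odd_hole by auto
  show "(\<lambda>C. (C, induced E C)) ` holes X \<subseteq> odd_chordless_cycles_in V E (X, induced E X)"
    unfolding odd_chordless_cycles_in_def holes_def
    using odd_hole_chordless odd_hole_conn(5) by (auto simp: induced_def)
qed

lemma block_type_iff: "blk X \<Longrightarrow> block_type V E i (X, induced E X) \<longleftrightarrow> card (holes X) = i"
proof -
  assume X: "blk X"
  have "holes X \<subseteq> Pow X" unfolding holes_def by auto
  then have "finite (holes X)" using blkD(5)[OF X] finite_subset by blast
  moreover have "card ((\<lambda>C. (C, induced E C)) ` holes X) = card (holes X)" by (intro card_image inj_onI) auto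
  ultimately show ?thesis unfolding block_type_def odd_chordless_cycles_in_eq is_block_iff using X by simp
qed

lemma strongly_contiguous_iff:
  assumes "X \<in> odd_blocks" "Y \<in> odd_blocks"
  shows "strongly_contiguous V E (X, induced E X) (Y, induced E Y) \<longleftrightarrow> strong X Y"
proof -
  have b: "blk X" "blk Y" using assms unfolding odd_blocks_def by auto
  show ?thesis unfolding strongly_contiguous_def strong_def non_bipartite_blocks_eq
      block_type_iff[OF b(1)] block_type_iff[OF b(2)] block_dist_le_1_def touch_def
    using assms by auto
qed

lemma odd_blocks_condition_iff:
  "card odd_blocks \<le> 1 \<or> (\<exists>X1 X2. X1 \<noteq> X2 \<and> odd_blocks = {X1, X2} \<and> strong X1 X2) \<longleftrightarrow>
   card (non_bipartite_blocks V E) \<le> 1 \<or>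
     (\<exists>B1 B2. B1 \<noteq> B2 \<and> non_bipartite_blocks V E = {B1, B2} \<and> strongly_contiguous V E B1 B2)"
proof -
  let ?f = "\<lambda>X. (X, induced E X)"
  have inj: "inj ?f" by (auto intro: injI)
  have "card (non_bipartite_blocks V E) = card odd_blocks"
    unfolding non_bipartite_blocks_eq by (intro card_image inj_onI) auto
  moreover have "(\<exists>X1 X2. X1 \<noteq> X2 \<and> odd_blocks = {X1, X2} \<and> strong X1 X2) \<longleftrightarrow>
     (\<exists>B1 B2. B1 \<noteq> B2 \<and> non_bipartite_blocks V E = {B1, B2} \<and> strongly_contiguous V E B1 B2)"
  proof
    assume "\<exists>X1 X2. X1 \<noteq> X2 \<and> odd_blocks = {X1, X2} \<and> strong X1 X2"
    then obtain X1 X2 where X: "X1 \<noteq> X2" "odd_blocks = {X1, X2}" "strong X1 X2" by (elim exE conjE) (rule that)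
    then have "non_bipartite_blocks V E = {?f X1, ?f X2}" "strongly_contiguous V E (?f X1) (?f X2)"
      using strongly_contiguous_iff[of X1 X2] unfolding non_bipartite_blocks_eq by simp_all
    then show "\<exists>B1 B2. B1 \<noteq> B2 \<and> non_bipartite_blocks V E = {B1, B2} \<and> strongly_contiguous V E B1 B2"
      using X(1) by (intro exI[of _ "?f X1"] exI[of _ "?f X2"]) simp
  next
    assume "\<exists>B1 B2. B1 \<noteq> B2 \<and> non_bipartite_blocks V E = {B1, B2} \<and> strongly_contiguous V E B1 B2"
    then obtain B1 B2 where B: "B1 \<noteq> B2" "?f ` odd_blocks = {B1, B2}" "strongly_contiguous V E B1 B2"
      unfolding non_bipartite_blocks_eq by (elim exE conjE) (rule that)
    then have "B1 \<in> ?f ` odd_blocks" "B2 \<in> ?f ` odd_blocks" by auto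
    then obtain X1 X2 where X: "X1 \<in> odd_blocks" "B1 = ?f X1" "X2 \<in> odd_blocks" "B2 = ?f X2" by blast
    have "?f ` odd_blocks = ?f ` {X1, X2}" using B(2) X by simp
    then have "odd_blocks = {X1, X2}" by (simp only: inj_image_eq_iff[OF inj])
    moreover have "strong X1 X2" using B(3) strongly_contiguous_iff[OF X(1,3)] X by simp
    ultimately show "\<exists>X1 X2. X1 \<noteq> X2 \<and> odd_blocks = {X1, X2} \<and> strong X1 X2"
      using B(1) X by (intro exI[of _ X1] exI[of _ X2]) simp
  qed
  ultimately show ?thesis by simp
qed

end

theorem theorem6p7:
  fixes V :: "'v::linorder set" and E :: "'v set set"
  assumes "simple_graph V E"
    and "connected_graph V E"
    and "complete_intersection TYPE('k::field) E"
  shows "normal_domain (edge_ring E :: (('v \<Rightarrow>\<^sub>0 nat) \<Rightarrow>\<^sub>0 'k) set) \<longleftrightarrow>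
           card (non_bipartite_blocks V E) \<le> 1 \<or>
           (\<exists>B1 B2. B1 \<noteq> B2 \<and> non_bipartite_blocks V E = {B1, B2} \<and>
               strongly_contiguous V E B1 B2)"
proof -
  have e: "\<exists>u v. u \<in> V \<and> v \<in> V \<and> u \<noteq> v \<and> e = {u, v}" if "e \<in> E" for e
    using assms(1) that unfolding simple_graph_def by blast
  have fV: "finite V" using assms(1) unfolding simple_graph_def by blast
  have "E \<subseteq> Pow V" using e by blast
  then have fE: "finite E" using fV finite_subset by blast
  have c2: "card e = 2" if "e \<in> E" for e using e[OF that] by auto
  interpret lgraph E V by unfold_locales (use fE c2 fV \<open>E \<subseteq> Pow V\<close> in auto)
  \<comment> \<open>The complete intersection hypothesis enters only through this duality.\<close>
  interpret cgraph E V
  proof unfold_locales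
    fix z w assume "minimal_pair z w"
    then obtain f where "weight f z \<noteq> weight f w"
      "\<And>x y v. x \<in> mon \<Longrightarrow> y \<in> mon \<Longrightarrow> edge_mono x = edge_mono y \<Longrightarrow> vdeg x v < vdeg z v \<Longrightarrow> weight f x = weight f y"
      using complete_intersection_dual[OF ugraph_axioms assms(3)] by metis
    then show "\<exists>f. weight f z \<noteq> weight f w \<and>
      (\<forall>x\<in>mon. \<forall>y\<in>mon. \<forall>v. edge_mono x = edge_mono y \<longrightarrow> vdeg x v < vdeg z v \<longrightarrow> weight f x = weight f y)" by blast
  qed
  have cV: "conn E V" using assms(2) by (simp add: connected_graph_iff)
  show ?thesis using normal_iff[OF cV, where 'k = 'k] odd_cycle_condition_iff[OF cV] odd_blocks_condition_iff by simp
qed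

end
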